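(* Assume that [Noise], [Factors], [Portfolio], [Growth] and [Minorization] (as described in the context) hold. Then there exists $\gamma_0<0$ such that for every $\gamma\in(\gamma_0,0)$ the Bellman equation $$v_\gamma(x)+\lambda_\gamma=\sup_{h\in U}\mu^\gamma\big(F(x,h,W_0)+v_\gamma(G(x,W_0))\big),\qquad x\in\mathbb{R}^k,$$ has a solution $(v_\gamma,\lambda_\gamma)\in\mathcal{C}_\omega(\mathbb{R}^k)\times\mathbb{R}$ (with $v_\gamma$ unique up to an additive constant and $\lambda_\gamma$ unique), and $$\lambda_\gamma\ge\sup_{H\in\mathcal{A}}\varphi^\gamma(V^H).$$ Moreover, if the function $a_1$ in [Growth] is bounded from above, then $$\lambda_\gamma=\sup_{H\in\mathcal{A}}\varphi^\gamma(V^H),$$ and the optimal strategy is defined by selectors to the Bellman equation: the strategy $\hat H_t=\hat h(X_t)$, $t\in\mathbb{T}$, where $\hat h\colon\mathbb{R}^k\to U$ is a Borel measurable map such that $\hat h(x)$ attains the supremum over $h\in U$ in the Bellman equation for each $x\in\mathbb{R}^k$, satisfies $\varphi^\gamma(V^{\hat H})=\sup_{H\in\mathcal{A}}\varphi^\gamma(V^H)$.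
   Context: Time set $\mathbb{T}=\mathbb{N}=\{0,1,2,\dots\}$; $(\Omega,\mathcal{F},\{\mathcal{F}_t\}_{t\in\mathbb{T}},\mathbb{P})$ is a filtered probability space with $\mathcal{F}_0$ trivial and $\mathcal{F}=\bigcup_t\mathcal{F}_t$; $\mathbb{E}$ is expectation under $\mathbb{P}$. $k,m$ are positive integers, $U\subset\mathbb{R}^m$ is a nonempty compact set, and $\mathcal{A}$ is the set of all $U$-valued adapted processes $H=(H_t)_{t\in\mathbb{T}}$ (portfolio strategies). $\mathcal{B}(\mathbb{R}^k)$ is the Borel $\sigma$-algebra. [Noise] The filtration is generated by a sequence $W=(W_t)_{t\in\mathbb{T}}$ of i.i.d. $\mathbb{R}^{k+m}$-valued random vectors, with $W_t$ independent of $\mathcal{F}_t$ for each $t$ (so $W_t$ is revealed only after time $t$). [Factors] The factor process satisfies $X_0\in\mathbb{R}^k$ and $X_{t+1}=G(X_t,W_t)$, where $G\colon\mathbb{R}^k\times\mathbb{R}^{k+m}\to\mathbb{R}^k$ is Borel measurable and continuous in the first variable. [Portfolio] For each $H\in\mathcal{A}$ the portfolio value process satisfies $V_0^H=V_0>0$ and $\ln(V_{t+1}^H/V_t^H)=F(X_t,H_t,W_t)$, where $F\colon\mathbb{R}^k\times U\times\mathbb{R}^{k+m}\to\mathbb{R}$ is Borel measurable and continuous with respect to the first two variables. [Growth] There are Borel functions $a_1,a_2\colon\mathbb{R}^{k+m}\to\mathbb{R}_+$, constants $b_1\in(0,1)$, $b_2>0$ and a continuous function $\omega\colon\mathbb{R}^k\to[0,\infty)$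 (the weight function) such that $\omega(G(x,w))\le a_1(w)+b_1\omega(x)$ and $|F(x,h,w)|\le a_2(w)+b_2\omega(x)$ for all $x\in\mathbb{R}^k$, $h\in U$, $w\in\mathbb{R}^{k+m}$; moreover $\mu^{\gamma}(a_1(W_0))$ and $\mu^{\gamma}(a_2(W_0))$ are finite for every $\gamma\in\mathbb{R}$, where $\mu^\gamma(Z)=\frac1\gamma\ln\mathbb{E}[e^{\gamma Z}]$ for $\gamma\ne0$ and $\mu^0(Z)=\mathbb{E}[Z]$. [Minorization] For every $R>0$ there exist a constant $c>0$ and a probability measure $\nu$ on $\mathbb{R}^k$ such that $\inf_{x:\,\omega(x)\le R}\mathbb{P}[G(x,W_0)\in A]\ge c\,\nu(A)$ for all $A\in\mathcal{B}(\mathbb{R}^k)$. $\mathcal{C}_\omega(\mathbb{R}^k)$ is the set of continuous $f\colon\mathbb{R}^k\to\mathbb{R}$ with $\|f\|_\omega:=\sup_x\frac{|f(x)|}{1+\omega(x)}<\infty$. The risk sensitive criterion is $\varphi^\gamma(V):=\liminf_{t\to\infty}\frac1t\frac1\gamma\ln\mathbb{E}[V_t^\gamma]$ for $\gamma<0$. *)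

theory Defs
  imports "HOL-Probability.Probability"
begin

(* "F = union of the F_t" is read as: F is the sigma-algebra generated by that union. *)
locale filtered_prob_space = prob_space M + filtration "space M" Fil
  for M :: "'a measure" and Fil :: "nat \<Rightarrow> 'a measure" +
  assumes Fil_subalgebra: "\<And>t. subalgebra M (Fil t)"
    and Fil_0_trivial: "sets (Fil 0) = {{}, space M}"
    and Fil_generates: "sets M = sigma_sets (space M) (\<Union>t. sets (Fil t))"

(* W t is revealed only after time t, so Fil t is generated by W 0, ..., W (t - 1). *)
locale noise = filtered_prob_space M Fil
  for M :: "'a measure" and Fil :: "nat \<Rightarrow> 'a measure" +
  fixes W :: "nat \<Rightarrow> 'a \<Rightarrow> real ^ 'd"
  assumes W_indep: "indep_vars (\<lambda>_. borel) W UNIV"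
    and W_identical: "\<And>t. distr M borel (W t) = distr M borel (W 0)"
    and Fil_eq: "\<And>t. sets (Fil t) =
      sigma_sets (space M) {W s -` A \<inter> space M | s A. s < t \<and> A \<in> sets borel}"
    and W_indep_Fil: "\<And>t. indep_set (sets (Fil t)) {W t -` A \<inter> space M | A. A \<in> sets borel}"

definition strategies ::
  "(nat \<Rightarrow> 'a measure) \<Rightarrow> (real ^ 'm) set \<Rightarrow> (nat \<Rightarrow> 'a \<Rightarrow> real ^ 'm) set" where
  "strategies Fil U = {H. \<forall>t. H t \<in> Fil t \<rightarrow>\<^sub>M restrict_space borel U}"

(* Expectations are taken in the extended sense, so that an infinite expectation is never
   confused with the default value 0 of the Bochner integral. *)
definition ln_ennreal :: "ennreal \<Rightarrow> ereal" where
  "ln_ennreal x = (if x = 0 then - \<infinity> else if x = \<infinity> then \<infinity> else ereal (ln (enn2real x)))"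

definition ext_expectation :: "'a measure \<Rightarrow> ('a \<Rightarrow> real) \<Rightarrow> ereal" where
  "ext_expectation M Z =
    enn2ereal (\<integral>\<^sup>+ w. ennreal (Z w) \<partial>M) - enn2ereal (\<integral>\<^sup>+ w. ennreal (- Z w) \<partial>M)"

definition entropic :: "'a measure \<Rightarrow> real \<Rightarrow> ('a \<Rightarrow> real) \<Rightarrow> ereal" where
  "entropic M \<gamma> Z =
    (if \<gamma> = 0 then ext_expectation M Z
     else ereal (1 / \<gamma>) * ln_ennreal (\<integral>\<^sup>+ w. ennreal (exp (\<gamma> * Z w)) \<partial>M))"

(* Only meant for a negative exponent and positive V; the irrelevant term t = 0 is 0. *)
definition risk_criterion :: "'a measure \<Rightarrow> real \<Rightarrow> (nat \<Rightarrow> 'a \<Rightarrow> real) \<Rightarrow> ereal" where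
  "risk_criterion M \<gamma> V =
    liminf (\<lambda>t. ereal (1 / real t) *
      (ereal (1 / \<gamma>) * ln_ennreal (\<integral>\<^sup>+ w. ennreal (V t w powr \<gamma>) \<partial>M)))"

definition factors ::
  "'a measure \<Rightarrow> (nat \<Rightarrow> 'a \<Rightarrow> real ^ 'd) \<Rightarrow> (real ^ 'k \<Rightarrow> real ^ 'd \<Rightarrow> real ^ 'k) \<Rightarrow>
   real ^ 'k \<Rightarrow> (nat \<Rightarrow> 'a \<Rightarrow> real ^ 'k) \<Rightarrow> bool" where
  "factors M W G x0 X \<longleftrightarrow>
    case_prod G \<in> borel \<Otimes>\<^sub>M borel \<rightarrow>\<^sub>M borel \<and>
    (\<forall>w. continuous_on UNIV (\<lambda>x. G x w)) \<and>
    (\<forall>\<omega>\<in>space M. X 0 \<omega> = x0 \<and> (\<forall>t. X (Suc t) \<omega> = G (X t \<omega>) (W t \<omega>)))"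

(* Positivity of the value process is implicit in the use of ln. The values of F for h
   outside U play no role. *)
definition portfolio ::
  "'a measure \<Rightarrow> (nat \<Rightarrow> 'a measure) \<Rightarrow> (nat \<Rightarrow> 'a \<Rightarrow> real ^ 'd) \<Rightarrow> (real ^ 'm) set \<Rightarrow>
   (nat \<Rightarrow> 'a \<Rightarrow> real ^ 'k) \<Rightarrow> (real ^ 'k \<Rightarrow> real ^ 'm \<Rightarrow> real ^ 'd \<Rightarrow> real) \<Rightarrow> real \<Rightarrow>
   ((nat \<Rightarrow> 'a \<Rightarrow> real ^ 'm) \<Rightarrow> nat \<Rightarrow> 'a \<Rightarrow> real) \<Rightarrow> bool" where
  "portfolio M Fil W U X F V0 V \<longleftrightarrow>
    (\<lambda>(x, h, w). F x h w) \<in> borel \<Otimes>\<^sub>M (restrict_space borel U \<Otimes>\<^sub>M borel) \<rightarrow>\<^sub>M borel \<and>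
    (\<forall>w. continuous_on (UNIV \<times> U) (\<lambda>(x, h). F x h w)) \<and>
    0 < V0 \<and>
    (\<forall>H\<in>strategies Fil U. \<forall>\<omega>\<in>space M.
      V H 0 \<omega> = V0 \<and>
      (\<forall>t. 0 < V H t \<omega> \<and> ln (V H (Suc t) \<omega> / V H t \<omega>) = F (X t \<omega>) (H t \<omega>) (W t \<omega>)))"

definition growth ::
  "'a measure \<Rightarrow> ('a \<Rightarrow> real ^ 'd) \<Rightarrow> (real ^ 'm) set \<Rightarrow> (real ^ 'k \<Rightarrow> real ^ 'd \<Rightarrow> real ^ 'k) \<Rightarrow>
   (real ^ 'k \<Rightarrow> real ^ 'm \<Rightarrow> real ^ 'd \<Rightarrow> real) \<Rightarrow> (real ^ 'd \<Rightarrow> real) \<Rightarrow> (real ^ 'd \<Rightarrow> real) \<Rightarrow>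
   real \<Rightarrow> real \<Rightarrow> (real ^ 'k \<Rightarrow> real) \<Rightarrow> bool" where
  "growth M W0 U G F a1 a2 b1 b2 weight \<longleftrightarrow>
    a1 \<in> borel_measurable borel \<and> (\<forall>w. 0 \<le> a1 w) \<and>
    a2 \<in> borel_measurable borel \<and> (\<forall>w. 0 \<le> a2 w) \<and>
    0 < b1 \<and> b1 < 1 \<and> 0 < b2 \<and>
    continuous_on UNIV weight \<and> (\<forall>x. 0 \<le> weight x) \<and>
    (\<forall>x w. weight (G x w) \<le> a1 w + b1 * weight x) \<and>
    (\<forall>x. \<forall>h\<in>U. \<forall>w. \<bar>F x h w\<bar> \<le> a2 w + b2 * weight x) \<and>
    (\<forall>\<gamma>. \<bar>entropic M \<gamma> (\<lambda>\<omega>. a1 (W0 \<omega>))\<bar> \<noteq> \<infinity> \<and> \<bar>entropic M \<gamma> (\<lambda>\<omega>. a2 (W0 \<omega>))\<bar> \<noteq> \<infinity>)"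

definition minorization ::
  "'a measure \<Rightarrow> ('a \<Rightarrow> real ^ 'd) \<Rightarrow> (real ^ 'k \<Rightarrow> real ^ 'd \<Rightarrow> real ^ 'k) \<Rightarrow>
   (real ^ 'k \<Rightarrow> real) \<Rightarrow> bool" where
  "minorization M W0 G weight \<longleftrightarrow>
    (\<forall>R>0. \<exists>c>0. \<exists>\<nu> :: (real ^ 'k) measure. prob_space \<nu> \<and> sets \<nu> = sets borel \<and>
      (\<forall>A\<in>sets borel.
        ennreal c * emeasure \<nu> A \<le>
          (INF x\<in>{x. weight x \<le> R}. emeasure M {\<omega>\<in>space M. G x (W0 \<omega>) \<in> A})))"

definition weighted_norm :: "('x \<Rightarrow> real) \<Rightarrow> ('x \<Rightarrow> real) \<Rightarrow> ereal" where
  "weighted_norm weight f = (SUP x. ereal (\<bar>f x\<bar> / (1 + weight x)))"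

definition C_weighted ::
  "('x::topological_space \<Rightarrow> real) \<Rightarrow> ('x \<Rightarrow> real) set" where
  "C_weighted weight = {f. continuous_on UNIV f \<and> weighted_norm weight f < \<infinity>}"

definition bellman_objective ::
  "'a measure \<Rightarrow> ('a \<Rightarrow> real ^ 'd) \<Rightarrow> (real ^ 'k \<Rightarrow> real ^ 'd \<Rightarrow> real ^ 'k) \<Rightarrow>
   (real ^ 'k \<Rightarrow> real ^ 'm \<Rightarrow> real ^ 'd \<Rightarrow> real) \<Rightarrow> real \<Rightarrow> (real ^ 'k \<Rightarrow> real) \<Rightarrow>
   real ^ 'k \<Rightarrow> real ^ 'm \<Rightarrow> ereal" where
  "bellman_objective M W0 G F \<gamma> v x h =
    entropic M \<gamma> (\<lambda>\<omega>. F x h (W0 \<omega>) + v (G x (W0 \<omega>)))"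

definition bellman_solution ::
  "'a measure \<Rightarrow> ('a \<Rightarrow> real ^ 'd) \<Rightarrow> (real ^ 'm) set \<Rightarrow>
   (real ^ 'k \<Rightarrow> real ^ 'd \<Rightarrow> real ^ 'k) \<Rightarrow> (real ^ 'k \<Rightarrow> real ^ 'm \<Rightarrow> real ^ 'd \<Rightarrow> real) \<Rightarrow>
   (real ^ 'k \<Rightarrow> real) \<Rightarrow> real \<Rightarrow> (real ^ 'k \<Rightarrow> real) \<Rightarrow> real \<Rightarrow> bool" where
  "bellman_solution M W0 U G F weight \<gamma> v lam \<longleftrightarrow>
    v \<in> C_weighted weight \<and>
    (\<forall>x. ereal (v x + lam) = (SUP h\<in>U. bellman_objective M W0 G F \<gamma> v x h))"

definition bellman_selector ::
  "'a measure \<Rightarrow> ('a \<Rightarrow> real ^ 'd) \<Rightarrow> (real ^ 'm) set \<Rightarrow>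
   (real ^ 'k \<Rightarrow> real ^ 'd \<Rightarrow> real ^ 'k) \<Rightarrow> (real ^ 'k \<Rightarrow> real ^ 'm \<Rightarrow> real ^ 'd \<Rightarrow> real) \<Rightarrow>
   real \<Rightarrow> (real ^ 'k \<Rightarrow> real) \<Rightarrow> (real ^ 'k \<Rightarrow> real ^ 'm) \<Rightarrow> bool" where
  "bellman_selector M W0 U G F \<gamma> v hsel \<longleftrightarrow>
    hsel \<in> borel_measurable borel \<and>
    (\<forall>x. hsel x \<in> U \<and>
      bellman_objective M W0 G F \<gamma> v x (hsel x) =
        (SUP h\<in>U. bellman_objective M W0 G F \<gamma> v x h))"

end

theory Submission
  imports Defs
begin

text \<open>Write \<open>\<theta> = - \<gamma> > 0\<close>. Differences of entropic utilities are bounded by expectations under laws tilted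
  by \<open>exp (- \<theta> (F + v))\<close>. As all exponential moments of \<open>a1 + a2\<close> are finite, these laws inherit the
  geometric drift of the weight, and they inherit the minorization, so by Harris' theorem in the form of
  Hairer and Mattingly the Bellman operator contracts a weighted span seminorm, at a rate that is uniform
  as long as \<open>\<theta> |v| \<le> K (1 + weight)\<close>. With arbitrary \<open>K\<close> this gives uniqueness for every \<open>\<theta>\<close>; with
  \<open>K = 1\<close> and \<open>\<theta>\<close> small a ball is invariant, and value iteration converges to a solution.

  For the upper bound on the criterion, \<open>E[V\<^sub>t\<^sup>\<gamma> exp (\<gamma> v (X\<^sub>t))]\<close> is at least a constant times
  \<open>exp (\<gamma> \<lambda> t)\<close>, and the unbounded factor \<open>exp (\<gamma> v (X\<^sub>t))\<close> is removed by Jensen's inequality under the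
  tilted laws, without changing the exponent \<open>\<gamma>\<close> as Hoelder's inequality would. If \<open>a1\<close> is bounded, so is
  \<open>weight (X\<^sub>t)\<close>, and a selector attains the bound.\<close>

section \<open>Tilted expectations\<close>

text \<open>A tilted law depends on the state, on the control and on \<open>v\<close>, and its
  density is unbounded in the noise. The contraction compares two states at which different controls
  are maximal, so two unrelated tilts occur in one estimate. For this reason the probabilistic
  lemmas never mention controls: they hold for every exponent \<open>Y\<close> with
  \<open>\<bar>Y w\<bar> \<le> K * (1 + a w + r)\<close>, where \<open>r\<close> is the weight of
  the current state, and their constants depend on \<open>K\<close> but not on \<open>Y\<close> or
  \<open>r\<close>.

  The restriction to small \<theta> breaks a circle. The contraction rate depends on the size of
  \<open>\<theta> * v\<close>, and the size of \<open>v\<close> depends on the rate. With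
  \<open>K = 1\<close> the rate is fixed first, for all \<theta> up to 1; it yields a bound on
  \<open>v\<close> in which \<theta> does not occur; only then is \<theta> chosen so small that
  \<open>\<theta> * v\<close> respects \<open>K = 1\<close>.

  A span seminorm is the right measure of distance because it ignores additive constants: the
  unknown eigenvalue drops out of every comparison and is recovered at the end from the value at one
  point.\<close>

locale exp_moments = prob_space P for P :: "'w measure" +
  fixes a :: "'w \<Rightarrow> real"
  assumes a_measurable [measurable]: "a \<in> borel_measurable P"
    and a_nonneg: "\<And>w. 0 \<le> a w"
    and exp_moment: "\<And>s. integrable P (\<lambda>w. exp (s * a w))"
begin

text \<open>A class closed under sums, products and \<open>exp\<close> of affinely dominated
  functions; membership settles all questions of integrability below.\<close>

definition tame :: "('w \<Rightarrow> real) \<Rightarrow> bool" where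
  "tame f \<longleftrightarrow> f \<in> borel_measurable P \<and> (\<exists>C s. \<forall>w. \<bar>f w\<bar> \<le> C * exp (s * a w))"

text \<open>\<open>r\<close> stands for the weight of the current state. Keeping it apart from
  \<open>K\<close> makes visible which constants are uniform in the state.\<close>

definition affinely_dominated :: "real \<Rightarrow> real \<Rightarrow> ('w \<Rightarrow> real) \<Rightarrow> bool" where
  "affinely_dominated K r Y \<longleftrightarrow> Y \<in> borel_measurable P \<and> (\<forall>w. \<bar>Y w\<bar> \<le> K * (1 + a w + r))"

text \<open>Expectation under the law with density proportional to \<open>exp (- Y)\<close>, as a
  quotient of integrals over \<open>P\<close>, so that no new measure has to be introduced.\<close>

definition tilt :: "('w \<Rightarrow> real) \<Rightarrow> ('w \<Rightarrow> real) \<Rightarrow> real" where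
  "tilt Y f = (\<integral>w. f w * exp (- Y w) \<partial>P) / (\<integral>w. exp (- Y w) \<partial>P)"

lemma tame_measurable [measurable_dest]: "tame f \<Longrightarrow> f \<in> borel_measurable P"
  by (simp add: tame_def)

lemma tame_integrable: "tame f \<Longrightarrow> integrable P f"
proof -
  assume f: "tame f"
  then obtain C s where "\<forall>w. \<bar>f w\<bar> \<le> C * exp (s * a w)" by (auto simp: tame_def)
  then show "integrable P f"
    using f by (intro Bochner_Integration.integrable_bound[OF integrable_mult_right[OF exp_moment[of s], of C]])
      (auto simp: tame_def intro: order_trans[OF _ abs_ge_self])
qed

lemma tame_bounded:
  assumes "f \<in> borel_measurable P" "\<And>w. \<bar>f w\<bar> \<le> g w" "tame g"
  shows "tame f"
proof -
  obtain C s where "\<forall>w. \<bar>g w\<bar> \<le> C * exp (s * a w)" using assms(3) by (auto simp: tame_def)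
  then have "\<bar>f w\<bar> \<le> C * exp (s * a w)" for w
    using assms(2)[of w] by (meson abs_ge_self order_trans)
  then show ?thesis using assms(1) by (auto simp: tame_def)
qed

lemma tame_const [intro]: "tame (\<lambda>_. c)"
  unfolding tame_def by (intro conjI exI[of _ "\<bar>c\<bar>"] exI[of _ 0]) auto

lemma tame_exp_a [intro]: "tame (\<lambda>w. exp (s * a w))"
  unfolding tame_def by (intro conjI exI[of _ 1] exI[of _ s]) auto

lemma tame_a [intro]: "tame a"
proof (rule tame_bounded[OF _ _ tame_exp_a[of 1]])
  show "\<bar>a w\<bar> \<le> exp (1 * a w)" for w
    using exp_ge_add_one_self[of "a w"] a_nonneg[of w] by (auto intro: order_trans[of _ "1 + a w"])
qed measurable

lemma tame_mult [intro]:
  assumes "tame f" "tame g" shows "tame (\<lambda>w. f w * g w)"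
proof -
  obtain C s where f: "\<forall>w. \<bar>f w\<bar> \<le> C * exp (s * a w)" using assms(1) by (auto simp: tame_def)
  obtain D t where g: "\<forall>w. \<bar>g w\<bar> \<le> D * exp (t * a w)" using assms(2) by (auto simp: tame_def)
  have "\<bar>f w * g w\<bar> \<le> (C * D) * exp ((s + t) * a w)" for w
  proof -
    have "\<bar>f w\<bar> * \<bar>g w\<bar> \<le> (C * exp (s * a w)) * (D * exp (t * a w))"
      using f g by (intro mult_mono) (auto intro: order_trans[OF abs_ge_zero])
    then show ?thesis by (simp add: abs_mult distrib_right exp_add) (simp add: mult_ac)
  qed
  then show ?thesis using assms by (auto simp: tame_def)
qed

lemma tame_add [intro]:
  assumes "tame f" "tame g" shows "tame (\<lambda>w. f w + g w)"
proof -
  obtain C s where f: "\<forall>w. \<bar>f w\<bar> \<le> C * exp (s * a w)" using assms(1) by (auto simp: tame_def)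
  obtain D t where g: "\<forall>w. \<bar>g w\<bar> \<le> D * exp (t * a w)" using assms(2) by (auto simp: tame_def)
  have "\<bar>f w + g w\<bar> \<le> (\<bar>C\<bar> + \<bar>D\<bar>) * exp ((\<bar>s\<bar> + \<bar>t\<bar>) * a w)" for w
  proof -
    have "C * exp (s * a w) \<le> \<bar>C\<bar> * exp ((\<bar>s\<bar> + \<bar>t\<bar>) * a w)"
      using a_nonneg[of w] by (intro mult_mono) (auto intro!: mult_right_mono)
    moreover have "D * exp (t * a w) \<le> \<bar>D\<bar> * exp ((\<bar>s\<bar> + \<bar>t\<bar>) * a w)"
      using a_nonneg[of w] by (intro mult_mono) (auto intro!: mult_right_mono)
    ultimately show ?thesis using f[rule_format, of w] g[rule_format, of w] abs_triangle_ineq[of "f w" "g w"]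
      unfolding distrib_right[of "\<bar>C\<bar>"] by linarith
  qed
  moreover have "(\<lambda>w. f w + g w) \<in> borel_measurable P" 
    using assms by (intro borel_measurable_add tame_measurable)
  ultimately show ?thesis unfolding tame_def by blast
qed

lemma tame_cmult [intro]: "tame f \<Longrightarrow> tame (\<lambda>w. c * f w)"
  by (intro tame_mult tame_const)

lemma tame_uminus [intro]: "tame f \<Longrightarrow> tame (\<lambda>w. - f w)"
  using tame_cmult[of f "-1"] by simp

lemma tame_diff [intro]: "tame f \<Longrightarrow> tame g \<Longrightarrow> tame (\<lambda>w. f w - g w)"
  using tame_add[OF _ tame_uminus, of f g] by simp

lemma affinely_dominated_uminus: "affinely_dominated K r Y \<Longrightarrow> affinely_dominated K r (\<lambda>w. - Y w)"
  by (simp add: affinely_dominated_def)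

lemma affinely_dominated_tame [intro]:
  assumes "affinely_dominated K r Y" shows "tame Y"
proof (rule tame_bounded)
  show "tame (\<lambda>w. K * (1 + a w + r))" by (intro tame_cmult tame_add tame_const tame_a)
qed (use assms in \<open>auto simp: affinely_dominated_def\<close>)

lemma affinely_dominated_exp [intro]:
  assumes "affinely_dominated K r Y" shows "tame (\<lambda>w. exp (Y w))"
  unfolding tame_def
proof (intro conjI exI allI)
  show "\<bar>exp (Y w)\<bar> \<le> exp (K * (1 + r)) * exp (K * a w)" for w
    using assms[unfolded affinely_dominated_def, THEN conjunct2, rule_format, of w]
    by (auto simp flip: exp_add simp: algebra_simps)
  show "(\<lambda>w. exp (Y w)) \<in> borel_measurable P" 
    using assms by (auto simp: affinely_dominated_def)
qed

lemma affinely_dominated_exp_minus [intro]: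
  "affinely_dominated K r Y \<Longrightarrow> tame (\<lambda>w. exp (- Y w))"
  using affinely_dominated_exp[OF affinely_dominated_uminus] .

lemma integral_pos:
  fixes f :: "'w \<Rightarrow> real"
  assumes "integrable P f" "\<And>w. 0 < f w" shows "0 < (\<integral>w. f w \<partial>P)"
proof -
  have "(\<integral>w. f w \<partial>P) \<noteq> 0"
  proof
    assume "(\<integral>w. f w \<partial>P) = 0"
    then have "AE w in P. f w = 0"
      using integral_nonneg_eq_0_iff_AE[OF assms(1) AE_I2] assms(2) by (simp add: less_imp_le)
    then have "AE w in P. False" by eventually_elim (use assms(2) in \<open>metis less_irrefl\<close>)
    then show False by simp
  qed
  moreover have "0 \<le> (\<integral>w. f w \<partial>P)" using assms by (intro integral_nonneg_AE) (auto intro: less_imp_le)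
  ultimately show ?thesis by simp
qed

lemma norm_const_pos:
  assumes "affinely_dominated K r Y" shows "0 < (\<integral>w. exp (- Y w) \<partial>P)"
  using affinely_dominated_exp_minus[OF assms] by (intro integral_pos tame_integrable) auto

lemma tilt_mono:
  assumes "affinely_dominated K r Y" "tame f" "tame g" "\<And>w. f w \<le> g w"
  shows "tilt Y f \<le> tilt Y g"
  unfolding tilt_def using norm_const_pos[OF assms(1)] affinely_dominated_exp_minus[OF assms(1)] assms(2-)
  by (intro divide_right_mono integral_mono tame_integrable tame_mult) auto

lemma tilt_add:
  assumes "affinely_dominated K r Y" "tame f" "tame g"
  shows "tilt Y (\<lambda>w. f w + g w) = tilt Y f + tilt Y g"
  unfolding tilt_def using affinely_dominated_exp_minus[OF assms(1)] assms(2-)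
  by (simp add: distrib_right Bochner_Integration.integral_add tame_integrable tame_mult add_divide_distrib)

lemma tilt_cmult: "tilt Y (\<lambda>w. c * f w) = c * tilt Y f"
  unfolding tilt_def by (simp add: mult.assoc)

lemma tilt_uminus: "tilt Y (\<lambda>w. - f w) = - tilt Y f"
  using tilt_cmult[of Y "-1" f] by simp

lemma tilt_diff:
  assumes "affinely_dominated K r Y" "tame f" "tame g"
  shows "tilt Y (\<lambda>w. f w - g w) = tilt Y f - tilt Y g"
  using tilt_add[OF assms(1,2) tame_uminus[OF assms(3)]] by (simp add: tilt_uminus)

lemma tilt_const:
  assumes "affinely_dominated K r Y" shows "tilt Y (\<lambda>_. c) = c"
  unfolding tilt_def using norm_const_pos[OF assms] by simp

text \<open>Jensen's inequality, from the tangent of \<open>exp\<close> at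
  \<open>c = tilt Y f\<close>: the linear term \<open>f w - c\<close> has tilted mean zero.\<close>

lemma exp_tilt_le:
  assumes "affinely_dominated K r Y" "tame f" "tame (\<lambda>w. exp (f w))"
  shows "exp (tilt Y f) \<le> tilt Y (\<lambda>w. exp (f w))"
proof -
  define c where "c = tilt Y f"
  have "exp c * (1 + (f w - c)) \<le> exp (f w)" for w
    using mult_left_mono[OF exp_ge_add_one_self[of "f w - c"], of "exp c"] by (simp flip: exp_add)
  then have "tilt Y (\<lambda>w. exp c * (1 + (f w - c))) \<le> tilt Y (\<lambda>w. exp (f w))"
    using assms by (intro tilt_mono[OF assms(1)] tame_cmult tame_add tame_diff tame_const) auto
  also have "tilt Y (\<lambda>w. exp c * (1 + (f w - c))) = exp c * (1 + (c - c))"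
    using assms by (simp add: tilt_cmult tilt_add[OF assms(1)] tilt_diff[OF assms(1)] tilt_const[OF assms(1)] tame_const tame_diff c_def)
  finally show ?thesis by (simp add: c_def)
qed

lemma integral_exp_mult:
  assumes "affinely_dominated K r Y"
  shows "(\<integral>w. f w * exp (- Y w) \<partial>P) = tilt Y f * (\<integral>w. exp (- Y w) \<partial>P)"
  unfolding tilt_def using norm_const_pos[OF assms] by simp

text \<open>The drift coefficient \<open>\<epsilon>\<close> is arbitrary since all exponential moments of \<open>a\<close> are finite:
  by Jensen, \<open>s E[a] \<le> ln E[exp (s a)]\<close> under the tilted law, with \<open>s\<close> as large as we like.\<close>

lemma tilt_a_le:
  assumes "0 \<le> K" "0 < \<epsilon>"
  shows "\<exists>C\<ge>0. \<forall>r\<ge>0. \<forall>Y. affinely_dominated K r Y \<longrightarrow> tilt Y a \<le> C + \<epsilon> * r"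
proof -
  \<comment> \<open>The bound on \<open>Y\<close> is used in the numerator and in the denominator of
    the tilt, which costs \<open>2 * K * (1 + r)\<close>. After division by \<open>s\<close> its
    slope in \<open>r\<close> must be at most \<epsilon>; the summand 1 keeps \<open>s\<close>
    positive when \<open>K = 0\<close>.\<close>
  define s where "s = 2 * K / \<epsilon> + 1"
  have s: "0 < s" "2 * K / s \<le> \<epsilon>" using assms by (auto simp: s_def field_simps add_pos_nonneg)
  define A where "A = (\<integral>w. exp ((s + K) * a w) \<partial>P)"
  define B where "B = (\<integral>w. exp (- K * a w) \<partial>P)"
  have A: "0 < A" and B: "0 < B" unfolding A_def B_def by (intro integral_pos exp_moment; simp)+
  define C where "C = (ln A + 2 * K - ln B) / s"
  have "tilt Y a \<le> C + \<epsilon> * r" if r: "r \<ge> 0" and Y: "affinely_dominated K r Y" for r Y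
  proof -
    have bd: "\<bar>Y w\<bar> \<le> K * (1 + r) + K * a w" for w
      using Y by (auto simp: affinely_dominated_def algebra_simps)
    have "exp (s * tilt Y a) \<le> tilt Y (\<lambda>w. exp (s * a w))"
      using exp_tilt_le[OF Y tame_cmult[OF tame_a] tame_exp_a, of s] by (simp add: tilt_cmult)
    also have "\<dots> \<le> (exp (K * (1 + r)) * A) / (exp (- (K * (1 + r))) * B)"
      unfolding tilt_def
    proof (intro frac_le)
      have "(\<integral>w. exp (s * a w) * exp (- Y w) \<partial>P) \<le> (\<integral>w. exp (K * (1 + r)) * exp ((s + K) * a w) \<partial>P)"
      proof (intro integral_mono)
        show "exp (s * a w) * exp (- Y w) \<le> exp (K * (1 + r)) * exp ((s + K) * a w)" for w
          using bd[of w] by (simp flip: exp_add add: algebra_simps)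
      qed (use affinely_dominated_exp_minus[OF Y] in \<open>auto intro!: tame_integrable tame_mult tame_exp_a exp_moment\<close>)
      then show "(\<integral>w. exp (s * a w) * exp (- Y w) \<partial>P) \<le> exp (K * (1 + r)) * A" by (simp add: A_def)
      have "(\<integral>w. exp (- (K * (1 + r))) * exp (- K * a w) \<partial>P) \<le> (\<integral>w. exp (- Y w) \<partial>P)"
      proof (intro integral_mono)
        show "exp (- (K * (1 + r))) * exp (- K * a w) \<le> exp (- Y w)" for w
          using bd[of w] by (simp flip: exp_add add: algebra_simps)
      qed (intro tame_integrable tame_cmult tame_exp_a affinely_dominated_exp_minus[OF Y])+
      then show "exp (- (K * (1 + r))) * B \<le> (\<integral>w. exp (- Y w) \<partial>P)" by (simp add: B_def)
      show "0 \<le> exp (K * (1 + r)) * A" "0 < exp (- (K * (1 + r))) * B" using A B by auto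
    qed
    also have "\<dots> = exp (ln A + 2 * K * (1 + r) - ln B)"
      using A B by (simp add: exp_add exp_diff exp_minus field_simps flip: power2_eq_square)
         (simp add: power2_eq_square flip: exp_add)
    finally have "s * tilt Y a \<le> ln A + 2 * K * (1 + r) - ln B" by simp
    then have "tilt Y a \<le> (ln A + 2 * K * (1 + r) - ln B) / s" using s by (simp add: field_simps)
    also have "\<dots> = C + (2 * K / s) * r" using s by (simp add: C_def field_simps)
    also have "\<dots> \<le> C + \<epsilon> * r" using s r by (intro add_left_mono mult_right_mono)
    finally show ?thesis .
  qed
  moreover have "C + \<epsilon> * r \<le> max 0 C + \<epsilon> * r" for r by simp
  ultimately show ?thesis by (intro exI[of _ "max 0 C"]) (meson max.cobounded1 order_trans)
qed

end

section \<open>Contraction of tilted kernels\<close>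

text \<open>One transition of the market, with the noise reduced to its law \<open>P\<close>. A
  single \<open>a\<close> dominates the noise in both growth bounds.\<close>

locale controlled_kernel = exp_moments P a for P :: "'w measure" and a :: "'w \<Rightarrow> real" +
  fixes U :: "'u::euclidean_space set"
    and G :: "'x::euclidean_space \<Rightarrow> 'w \<Rightarrow> 'x"
    and F :: "'x \<Rightarrow> 'u \<Rightarrow> 'w \<Rightarrow> real"
    and weight :: "'x \<Rightarrow> real"
    and b1 b2 :: real
  assumes U_nonempty: "U \<noteq> {}" and U_compact: "compact U"
    and G_measurable2: "case_prod G \<in> borel \<Otimes>\<^sub>M P \<rightarrow>\<^sub>M borel"
    and G_continuous: "\<And>w. continuous_on UNIV (\<lambda>x. G x w)"
    and F_measurable3: "(\<lambda>(x, h, w). F x h w) \<in> borel \<Otimes>\<^sub>M (restrict_space borel U \<Otimes>\<^sub>M P) \<rightarrow>\<^sub>M borel"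
    and F_continuous: "\<And>w. continuous_on (UNIV \<times> U) (\<lambda>(x, h). F x h w)"
    and b1: "0 < b1" "b1 < 1" and b2: "0 < b2"
    and weight_continuous: "continuous_on UNIV weight"
    and weight_nonneg: "\<And>x. 0 \<le> weight x"
    and weight_G: "\<And>x w. weight (G x w) \<le> a w + b1 * weight x"
    and F_bound: "\<And>x h w. h \<in> U \<Longrightarrow> \<bar>F x h w\<bar> \<le> a w + b2 * weight x"
    and minorized: "\<And>R. R > 0 \<Longrightarrow> \<exists>c>0. \<exists>\<nu>. prob_space \<nu> \<and> sets \<nu> = sets borel \<and>
      (\<forall>x A. weight x \<le> R \<longrightarrow> A \<in> sets borel \<longrightarrow>
        ennreal c * emeasure \<nu> A \<le> emeasure (distr P borel (G x)) A)"
begin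

lemma G_measurable [measurable]: "G x \<in> P \<rightarrow>\<^sub>M borel"
  using measurable_compose[OF measurable_Pair1' G_measurable2, of x] by simp

lemma F_measurable: "h \<in> U \<Longrightarrow> F x h \<in> borel_measurable P"
proof -
  assume "h \<in> U"
  then have "(\<lambda>w. (x, h, w)) \<in> P \<rightarrow>\<^sub>M borel \<Otimes>\<^sub>M (restrict_space borel U \<Otimes>\<^sub>M P)"
    by (auto intro!: measurable_Pair simp: space_restrict_space)
  from measurable_compose[OF this F_measurable3] show ?thesis by simp
qed

lemma weight_measurable [measurable]: "weight \<in> borel_measurable borel"
  using weight_continuous by (rule borel_measurable_continuous_onI)

lemma tame_weight_G: "tame (\<lambda>w. weight (G x w))"
proof (rule tame_bounded)
  show "\<bar>weight (G x w)\<bar> \<le> a w + b1 * weight x" for w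
    using weight_G[of x w] weight_nonneg[of "G x w"] by simp
  show "tame (\<lambda>w. a w + b1 * weight x)" by (intro tame_add tame_a tame_const)
qed measurable

lemma tame_compose_G:
  assumes "f \<in> borel_measurable borel" "\<And>x. \<bar>f x\<bar> \<le> C * (1 + weight x)"
  shows "tame (\<lambda>w. f (G x w))"
  using assms(1) by (intro tame_bounded[OF _ assms(2)] tame_cmult tame_add tame_const tame_weight_G measurable_compose[OF G_measurable])

text \<open>Tilting adds at most \<open>\<epsilon> * weight x\<close> to the mean of
  \<open>a\<close>. The choice \<open>\<epsilon> = (1 - b1) / 2\<close> leaves the coefficient
  \<open>(1 + b1) / 2 < 1\<close>, so the geometric drift survives.\<close>

lemma tilt_weight_G_le:
  assumes "0 \<le> K"
  shows "\<exists>C\<ge>0. \<exists>b>0. b < 1 \<and> (\<forall>x Y. affinely_dominated K (weight x) Y \<longrightarrow>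
    tilt Y (\<lambda>w. weight (G x w)) \<le> C + b * weight x)"
proof -
  obtain C where C: "C \<ge> 0" "\<And>r Y. r \<ge> 0 \<Longrightarrow> affinely_dominated K r Y \<Longrightarrow> tilt Y a \<le> C + (1 - b1) / 2 * r"
    using tilt_a_le[OF assms, of "(1 - b1) / 2"] b1 by auto
  have "tilt Y (\<lambda>w. weight (G x w)) \<le> C + (1 + b1) / 2 * weight x"
    if Y: "affinely_dominated K (weight x) Y" for x Y
  proof -
    have "tilt Y (\<lambda>w. weight (G x w)) \<le> tilt Y (\<lambda>w. a w + b1 * weight x)"
      by (intro tilt_mono[OF Y] tame_weight_G tame_add tame_a tame_const weight_G)
    also have "\<dots> = tilt Y a + b1 * weight x"
      by (simp add: tilt_add[OF Y] tame_a tame_const tilt_const[OF Y])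
    also have "\<dots> \<le> C + (1 - b1) / 2 * weight x + b1 * weight x"
      using C(2)[OF weight_nonneg Y] by simp
    finally show ?thesis by (simp add: field_simps)
  qed
  then show ?thesis using b1 C(1) by (intro exI[of _ C] conjI exI[of _ "(1 + b1) / 2"]) auto
qed

text \<open>Multiplying \<open>2 \<le> \<tau> exp (- Y) + exp Y / \<tau>\<close> by \<open>f\<close> and integrating transfers
  the minorization from \<open>P\<close> to every tilted law, although \<open>Y\<close> is unbounded.\<close>

lemma tilt_small_set:
  assumes K: "0 \<le> K"
  shows "\<exists>\<delta>>0. \<forall>x y Y Y' f. weight x \<le> R \<longrightarrow> weight y \<le> R \<longrightarrow>
    affinely_dominated K (weight x) Y \<longrightarrow> affinely_dominated K (weight y) Y' \<longrightarrow>
    f \<in> borel_measurable borel \<longrightarrow> (\<forall>z. 0 \<le> f z \<and> f z \<le> 1) \<longrightarrow>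
    \<delta> \<le> tilt Y (\<lambda>w. f (G x w)) + tilt Y' (\<lambda>w. 1 - f (G y w))"
proof -
  obtain c \<nu> where c: "c > 0" and \<nu>: "prob_space \<nu>" "sets \<nu> = sets borel"
    and minor: "\<And>x A. weight x \<le> R \<Longrightarrow> A \<in> sets borel \<Longrightarrow>
        ennreal c * emeasure \<nu> A \<le> emeasure (distr P borel (G x)) A"
    proof -
    assume thesis: "\<And>c \<nu>. \<lbrakk>c > 0; prob_space \<nu>; sets \<nu> = sets borel; \<And>x A. weight x \<le> R \<Longrightarrow> A \<in> sets borel \<Longrightarrow>
        ennreal c * emeasure \<nu> A \<le> emeasure (distr P borel (G x)) A\<rbrakk> \<Longrightarrow> thesis"
    \<comment> \<open>Minorization is assumed at positive levels, whereas \<open>R\<close> is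
      arbitrary here.\<close>
    have "weight x \<le> R \<Longrightarrow> weight x \<le> max R 1" for x by simp
    moreover have "max R 1 > 0" by simp
    ultimately show thesis using minorized[of "max R 1"] thesis by metis
  qed
  interpret \<nu>: prob_space \<nu> by fact
  have [measurable_cong]: "sets \<nu> = sets borel" by fact
  \<comment> \<open>\<open>D\<close> serves twice on the level set: for the integral of
    \<open>exp Y\<close>, and, applied to \<open>- Y\<close>, for the normalising constant of the
    tilted law.\<close>
  define D where "D = exp (K * (1 + R)) * (\<integral>w. exp (K * a w) \<partial>P)"
  have D: "0 < D" unfolding D_def by (intro mult_pos_pos integral_pos exp_moment) auto
  have exp_le_D: "(\<integral>w. exp (Y w) \<partial>P) \<le> D" if "r \<le> R" "affinely_dominated K r Y" for r Y
  proof -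
    have "(\<integral>w. exp (Y w) \<partial>P) \<le> (\<integral>w. exp (K * (1 + R)) * exp (K * a w) \<partial>P)"
    proof (intro integral_mono tame_integrable tame_cmult tame_exp_a affinely_dominated_exp)
      fix w
      have "Y w \<le> K * (1 + a w + r)" using that(2) by (auto simp: affinely_dominated_def abs_le_iff)
      also have "\<dots> \<le> K * (1 + a w + R)" using that(1) K by (intro mult_left_mono) auto
      finally show "exp (Y w) \<le> exp (K * (1 + R)) * exp (K * a w)"
        by (simp flip: exp_add add: algebra_simps)
    qed fact
    then show ?thesis by (simp add: D_def)
  qed
  have minor_fun: "c * (\<integral>z. f z \<partial>\<nu>) \<le> (\<integral>w. f (G x w) \<partial>P)"
    if f [measurable]: "f \<in> borel_measurable borel" and f01: "\<And>z. 0 \<le> f z \<and> f z \<le> 1" and x: "weight x \<le> R" for f x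
  proof -
    have "ennreal c * (\<integral>\<^sup>+z. ennreal (f z) \<partial>\<nu>) = (\<integral>\<^sup>+z. ennreal (f z) \<partial>scale_measure (ennreal c) \<nu>)"
      by (intro nn_integral_scale_measure[symmetric]) measurable
    also have "\<dots> \<le> (\<integral>\<^sup>+z. ennreal (f z) \<partial>distr P borel (G x))"
    proof (rule nn_integral_mono_measure)
      show "sets (scale_measure (ennreal c) \<nu>) = sets (distr P borel (G x))" using \<nu> by simp
      then show "scale_measure (ennreal c) \<nu> \<le> distr P borel (G x)"
        using minor[OF x] \<nu> by (auto simp: le_measure emeasure_notin_sets)
    qed
    also have "\<dots> = (\<integral>\<^sup>+w. ennreal (f (G x w)) \<partial>P)"
      by (intro nn_integral_distr) measurable
    finally have "ennreal c * (\<integral>\<^sup>+z. ennreal (f z) \<partial>\<nu>) \<le> (\<integral>\<^sup>+w. ennreal (f (G x w)) \<partial>P)" .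
    moreover have "integrable \<nu> f" "integrable P (\<lambda>w. f (G x w))"
      using f01 by (auto intro!: \<nu>.integrable_const_bound[of _ 1] integrable_const_bound[of _ 1])
    ultimately show ?thesis using f01 c
      by (simp add: nn_integral_eq_integral ennreal_mult'[symmetric] Bochner_Integration.integral_nonneg)
  qed
  define \<delta> where "\<delta> = c\<^sup>2 / (4 * D\<^sup>2)"
  have tilt_ge: "\<delta> \<le> tilt Y (\<lambda>w. f (G x w))"
    if f [measurable]: "f \<in> borel_measurable borel" and f01: "\<And>z. 0 \<le> f z \<and> f z \<le> 1" and x: "weight x \<le> R"
      and Y: "affinely_dominated K (weight x) Y" and half: "1 / 2 \<le> (\<integral>z. f z \<partial>\<nu>)" for f x Y
  proof -
    \<comment> \<open>This value makes the error term \<open>D / (2 * \<tau>)\<close> equal to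
      \<open>c / 4\<close>, half of the mass \<open>c / 2\<close> supplied by the minorization.
      Solving for the integral gives \<open>c\<^sup>2 / (4 * D)\<close>, and the normalising
      constant costs another factor \<open>D\<close>.\<close>
    define \<tau> where "\<tau> = 2 * D / c"
    have \<tau>: "\<tau> > 0" using D c by (simp add: \<tau>_def)
    have tame_f: "tame (\<lambda>w. f (G x w))"
      using f01 by (intro tame_bounded[OF _ _ tame_const[of 1]]) auto
    have tame_Y: "tame (\<lambda>w. exp (- Y w))" "tame (\<lambda>w. exp (Y w))"
      using Y by auto
    have "c / 2 \<le> c * (\<integral>z. f z \<partial>\<nu>)" using half c by (simp add: field_simps)
    also have "\<dots> \<le> (\<integral>w. f (G x w) \<partial>P)" using minor_fun[OF f f01 x] .
    also have "\<dots> \<le> (\<integral>w. \<tau> / 2 * (f (G x w) * exp (- Y w)) + 1 / (2 * \<tau>) * exp (Y w) \<partial>P)"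
    proof (intro integral_mono tame_integrable tame_f tame_add tame_cmult tame_mult tame_Y)
      fix w
      have "0 \<le> (\<tau> * exp (- Y w) - 1)\<^sup>2 / (\<tau> * exp (- Y w))" using \<tau> by simp
      also have "\<dots> = \<tau> * exp (- Y w) + exp (Y w) / \<tau> - 2"
        using \<tau> by (simp add: power2_eq_square field_simps exp_minus)
      finally have "f (G x w) * 2 \<le> f (G x w) * (\<tau> * exp (- Y w) + exp (Y w) / \<tau>)"
        using f01 by (intro mult_left_mono) auto
      moreover have "f (G x w) * (exp (Y w) / \<tau>) \<le> 1 * (exp (Y w) / \<tau>)"
        using f01 \<tau> by (intro mult_right_mono) auto
      ultimately have "2 * f (G x w) \<le> \<tau> * (f (G x w) * exp (- Y w)) + exp (Y w) / \<tau>"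
        by (simp add: distrib_left mult_ac)
      then show "f (G x w) \<le> \<tau> / 2 * (f (G x w) * exp (- Y w)) + 1 / (2 * \<tau>) * exp (Y w)"
        by simp
    qed
    also have "\<dots> = \<tau> / 2 * (\<integral>w. f (G x w) * exp (- Y w) \<partial>P) + 1 / (2 * \<tau>) * (\<integral>w. exp (Y w) \<partial>P)"
      using tame_f tame_Y by (simp add: Bochner_Integration.integral_add tame_integrable tame_mult)
    also have "\<dots> \<le> \<tau> / 2 * (\<integral>w. f (G x w) * exp (- Y w) \<partial>P) + 1 / (2 * \<tau>) * D"
      using exp_le_D[OF x Y] \<tau> by (intro add_left_mono mult_left_mono) auto
    finally have *: "c\<^sup>2 / (4 * D) \<le> (\<integral>w. f (G x w) * exp (- Y w) \<partial>P)"
      using c D by (simp add: \<tau>_def field_simps power2_eq_square)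
    have "c\<^sup>2 / (4 * D) / D \<le> tilt Y (\<lambda>w. f (G x w))"
      unfolding tilt_def using exp_le_D[OF x affinely_dominated_uminus[OF Y]] norm_const_pos[OF Y] * D
      by (intro frac_le order_trans[OF _ *]) auto
    then show ?thesis by (simp add: \<delta>_def power2_eq_square)
  qed
  have tilt_ge0: "0 \<le> tilt Y (\<lambda>w. f (G x w))" if "\<And>z. 0 \<le> f z" for f x Y
    unfolding tilt_def using that by (intro divide_nonneg_nonneg Bochner_Integration.integral_nonneg) auto
  \<comment> \<open>Either \<open>f\<close> or \<open>1 - f\<close> has \<nu>-integral at least one
    half, and the other summand is nonnegative. The infimum over \<open>f\<close> of this sum is one
    minus the total variation distance of the two tilted kernels.\<close>
  have "\<delta> \<le> tilt Y (\<lambda>w. f (G x w)) + tilt Y' (\<lambda>w. 1 - f (G y w))"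
    if xy: "weight x \<le> R" "weight y \<le> R" and Y: "affinely_dominated K (weight x) Y"
      and Y': "affinely_dominated K (weight y) Y'" and f [measurable]: "f \<in> borel_measurable borel"
      and f01: "\<And>z. 0 \<le> f z \<and> f z \<le> 1" for x y Y Y' f
  proof (cases "1 / 2 \<le> (\<integral>z. f z \<partial>\<nu>)")
    case True
    show ?thesis using tilt_ge[OF f f01 xy(1) Y True] tilt_ge0[of "\<lambda>z. 1 - f z" Y' y] f01 by auto
  next
    case False
    have "integrable \<nu> f" using f01 by (auto intro!: \<nu>.integrable_const_bound[of _ 1])
    then have "1 / 2 \<le> (\<integral>z. 1 - f z \<partial>\<nu>)"
      using False by (simp add: \<nu>.prob_space)
    from tilt_ge[OF _ _ xy(2) Y' this] show ?thesis using tilt_ge0[of f Y x] f01 by auto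
  qed
  then show ?thesis using c D by (intro exI[of _ \<delta>]) (auto simp: \<delta>_def)
qed

text \<open>Hairer and Mattingly's argument for Harris' theorem: the weight \<open>\<beta>\<close> is so small that on
  \<open>weight x + weight y \<le> R\<close> the overlap of the kernels beats the growth of the weight, while
  outside the drift alone contracts.\<close>

lemma tilt_contraction:
  assumes K: "0 \<le> K"
  shows "\<exists>\<beta>>0. \<exists>\<alpha>>0. \<beta> \<le> 1 \<and> \<alpha> < 1 \<and> (\<forall>x y Y Y' f s. 0 \<le> s \<longrightarrow>
    affinely_dominated K (weight x) Y \<longrightarrow> affinely_dominated K (weight y) Y' \<longrightarrow>
    f \<in> borel_measurable borel \<longrightarrow>
    (\<forall>u v. f u - f v \<le> s * (2 + \<beta> * weight u + \<beta> * weight v)) \<longrightarrow>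
    tilt Y (\<lambda>w. f (G x w)) - tilt Y' (\<lambda>w. f (G y w)) \<le> \<alpha> * (s * (2 + \<beta> * weight x + \<beta> * weight y)))"
proof -
  obtain C b where C: "C \<ge> 0" and b: "0 < b" "b < 1"
    and drift: "\<And>x Y. affinely_dominated K (weight x) Y \<Longrightarrow> tilt Y (\<lambda>w. weight (G x w)) \<le> C + b * weight x"
    using tilt_weight_G_le[OF K] by blast
  \<comment> \<open>For \<open>S > R\<close> the constant \<open>2 * C\<close> from two drift bounds
    consumes at most half of the decrease \<open>(1 - b) * S\<close>.\<close>
  define R where "R = 4 * C / (1 - b) + 1"
  have "(1 - b) * R = 4 * C + (1 - b)" using b by (simp add: R_def field_simps)
  moreover have "0 < R" using C b by (simp add: R_def add_nonneg_pos)
  ultimately have R: "R > 0" "4 * C \<le> (1 - b) * R" using b by auto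
  obtain \<delta>0 where \<delta>0: "\<delta>0 > 0" and small0: "\<And>x y Y Y' f. weight x \<le> R \<Longrightarrow> weight y \<le> R \<Longrightarrow>
    affinely_dominated K (weight x) Y \<Longrightarrow> affinely_dominated K (weight y) Y' \<Longrightarrow>
    f \<in> borel_measurable borel \<Longrightarrow> (\<forall>z. 0 \<le> f z \<and> f z \<le> 1) \<Longrightarrow>
    \<delta>0 \<le> tilt Y (\<lambda>w. f (G x w)) + tilt Y' (\<lambda>w. 1 - f (G y w))"
    using tilt_small_set[OF K, of R] by blast
  define \<delta> where "\<delta> = min 1 \<delta>0"
  have \<delta>: "0 < \<delta>" "\<delta> \<le> 1" "\<delta> \<le> \<delta>0" using \<delta>0 by (auto simp: \<delta>_def)
  \<comment> \<open>The overlap reduces 2 to \<open>2 * (1 - \<delta>)\<close>. With this \<beta>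
    the weight gives back at most \<delta>, so that \<open>2 - \<delta>\<close> remains, a factor
    \<open>1 - \<delta> / 2\<close>.\<close>
  define \<beta> where "\<beta> = min 1 (\<delta> / (2 * C + R))"
  have \<beta>: "0 < \<beta>" "\<beta> \<le> 1" "\<beta> * (2 * C + R) \<le> \<delta>"
    using \<delta> C R by (auto simp: \<beta>_def min_mult_distrib_right min_le_iff_disj add_nonneg_pos)
  \<comment> \<open>Outside the small set,
    \<open>\<eta> * (2 + \<beta> * S) \<le> \<beta> * (1 - b) * S / 2\<close> is required. As
    \<open>S / (2 + \<beta> * S)\<close> increases with \<open>S\<close>, the worst case is
    \<open>S = R\<close>.\<close>
  define \<eta> where "\<eta> = \<beta> * (1 - b) * R / (2 * (2 + \<beta> * R))"
  have pos: "0 < 2 + \<beta> * R" using \<beta> R by (auto intro!: add_pos_pos)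
  have \<eta>: "0 < \<eta>" using \<beta> b R pos by (auto simp: \<eta>_def)
  define \<alpha> where "\<alpha> = max (1 - \<delta> / 2) (1 - \<eta>)"
  have \<alpha>: "0 < \<alpha>" "\<alpha> < 1" using \<delta> \<eta> by (auto simp: \<alpha>_def)
  have "tilt Y (\<lambda>w. f (G x w)) - tilt Y' (\<lambda>w. f (G y w)) \<le> \<alpha> * (s * (2 + \<beta> * weight x + \<beta> * weight y))"
    if s: "0 < s" and Y: "affinely_dominated K (weight x) Y" and Y': "affinely_dominated K (weight y) Y'"
      and f [measurable]: "f \<in> borel_measurable borel"
      and osc: "\<And>u v. f u - f v \<le> s * (2 + \<beta> * weight u + \<beta> * weight v)" for x y Y Y' f s
  proof -
    \<comment> \<open>Passage from the span to a centred norm: all lower envelopes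
      \<open>f u - s * (1 + \<beta> * weight u)\<close> lie below all upper ones, and a constant
      between them gives
      \<open>\<bar>f u - c\<bar> \<le> s * (1 + \<beta> * weight u)\<close>.\<close>
    define c where "c = (SUP u. f u - s * (1 + \<beta> * weight u))"
    have up: "f u - s * (1 + \<beta> * weight u) \<le> f v + s * (1 + \<beta> * weight v)" for u v
      using osc[of u v] by (simp add: algebra_simps)
    have "f u - s * (1 + \<beta> * weight u) \<le> c" for u
      unfolding c_def using up by (intro cSUP_upper bdd_aboveI2[of _ _ "f undefined + s * (1 + \<beta> * weight undefined)"]) auto
    moreover have "c \<le> f v + s * (1 + \<beta> * weight v)" for v
      unfolding c_def using up by (intro cSUP_least) auto
    ultimately have fc: "\<bar>f u - c\<bar> \<le> s * (1 + \<beta> * weight u)" for u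
      by (smt (verit, best))
    have tame_f: "tame (\<lambda>w. f (G z w))" for z
    proof (rule tame_compose_G[OF f])
      show "\<bar>f u\<bar> \<le> (\<bar>c\<bar> + s) * (1 + weight u)" for u
      proof -
        have "s * (1 + \<beta> * weight u) \<le> s * (1 + weight u)"
          using s \<beta> weight_nonneg[of u] by (intro mult_left_mono) (auto intro: mult_left_le_one_le)
        moreover have "\<bar>c\<bar> \<le> \<bar>c\<bar> * (1 + weight u)"
          using weight_nonneg[of u] by (simp add: distrib_left)
        ultimately show ?thesis using fc[of u] by (simp add: distrib_right)
      qed
    qed
    define S where "S = weight x + weight y"
    have S: "0 \<le> S" "weight x \<le> S" "weight y \<le> S" using weight_nonneg by (auto simp: S_def)
    have eq: "tilt Y (\<lambda>w. f (G x w)) - tilt Y' (\<lambda>w. f (G y w)) =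
      tilt Y (\<lambda>w. f (G x w) - c) + tilt Y' (\<lambda>w. c - f (G y w))"
      by (simp add: tilt_diff[OF Y] tilt_diff[OF Y'] tame_f tame_const tilt_const[OF Y] tilt_const[OF Y'])
    have sum_drift: "tilt Y (\<lambda>w. weight (G x w)) + tilt Y' (\<lambda>w. weight (G y w)) \<le> 2 * C + b * S"
      using drift[OF Y] drift[OF Y'] by (simp add: S_def algebra_simps)
    have "tilt Y (\<lambda>w. f (G x w)) - tilt Y' (\<lambda>w. f (G y w)) \<le> \<alpha> * (s * (2 + \<beta> * S))"
    proof (cases "S \<le> R")
      case False
      have "tilt Y (\<lambda>w. f (G x w) - c) \<le> tilt Y (\<lambda>w. s * (1 + \<beta> * weight (G x w)))"
        using fc by (intro tilt_mono[OF Y] tame_diff tame_f tame_const tame_cmult tame_add tame_weight_G) (auto simp: abs_le_iff)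
      moreover have "tilt Y' (\<lambda>w. c - f (G y w)) \<le> tilt Y' (\<lambda>w. s * (1 + \<beta> * weight (G y w)))"
        using fc by (intro tilt_mono[OF Y'] tame_diff tame_f tame_const tame_cmult tame_add tame_weight_G) (auto simp: abs_le_iff)
      ultimately have "tilt Y (\<lambda>w. f (G x w)) - tilt Y' (\<lambda>w. f (G y w)) \<le>
          s * (2 + \<beta> * (tilt Y (\<lambda>w. weight (G x w)) + tilt Y' (\<lambda>w. weight (G y w))))"
        unfolding eq by (simp add: tilt_cmult tilt_add[OF Y] tilt_add[OF Y'] tame_const tame_cmult tame_weight_G
          tilt_const[OF Y] tilt_const[OF Y'] algebra_simps)
      also have "\<dots> \<le> s * (2 + \<beta> * (2 * C + b * S))"
        using sum_drift s \<beta> by (intro mult_left_mono add_left_mono) auto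
      also have "\<dots> \<le> s * ((1 - \<eta>) * (2 + \<beta> * S))"
      proof (rule mult_left_mono)
        have "R * (2 + \<beta> * S) \<le> S * (2 + \<beta> * R)" using False by (simp add: algebra_simps)
        then have scaled: "(\<beta> * (1 - b)) * (R * (2 + \<beta> * S)) \<le> (\<beta> * (1 - b)) * (S * (2 + \<beta> * R))"
          using \<beta> b by (intro mult_left_mono) auto
        have "\<eta> * (2 + \<beta> * S) = \<beta> * (1 - b) * (R * (2 + \<beta> * S)) / (2 * (2 + \<beta> * R))"
          by (simp only: \<eta>_def times_divide_eq_left mult.assoc)
        also have "\<dots> \<le> \<beta> * (1 - b) * (S * (2 + \<beta> * R)) / (2 * (2 + \<beta> * R))"
          using pos scaled by (intro divide_right_mono) auto
        also have "\<beta> * (1 - b) * (S * (2 + \<beta> * R)) / (2 * (2 + \<beta> * R)) = \<beta> * (1 - b) * S / 2"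
          using pos by (simp add: field_simps)
        finally have "\<eta> * (2 + \<beta> * S) \<le> \<beta> * (1 - b) * S / 2" .
        moreover have "\<beta> * (4 * C) \<le> \<beta> * ((1 - b) * S)"
          using R False \<beta> b by (intro mult_left_mono order_trans[OF R(2)]) auto
        ultimately show "2 + \<beta> * (2 * C + b * S) \<le> (1 - \<eta>) * (2 + \<beta> * S)"
          by (simp add: algebra_simps)
      qed (use s in auto)
      also have "\<dots> \<le> s * (\<alpha> * (2 + \<beta> * S))"
        using s \<beta> S by (intro mult_left_mono mult_right_mono) (auto simp: \<alpha>_def intro!: add_nonneg_nonneg)
      finally show ?thesis by (simp add: mult_ac)
    next
      case True
      \<comment> \<open>Truncation at the level \<open>s\<close> splits \<open>f - c\<close> into a
        bounded part, which the overlap of the kernels contracts, and a remainder below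
        \<open>s * \<beta> * weight\<close>, which the drift controls.\<close>
      define g where "g u = max (- s) (min s (f u - c))" for u
      have [measurable]: "g \<in> borel_measurable borel" unfolding g_def by measurable
      have g_bd: "- s \<le> g u" "g u \<le> s" for u using s by (auto simp: g_def)
      have g_near: "f u - c - g u \<le> s * \<beta> * weight u" "g u - (f u - c) \<le> s * \<beta> * weight u" for u
        using fc[of u] s mult_nonneg_nonneg[of "s * \<beta>" "weight u"] \<beta> weight_nonneg[of u]
        by (auto simp: g_def max_def min_def abs_le_iff algebra_simps)
      have tame_g: "tame (\<lambda>w. g (G z w))" for z
        using g_bd s by (intro tame_bounded[OF _ _ tame_const[of s]]) (auto simp: abs_le_iff minus_le_iff)
      \<comment> \<open>\<open>g\<close> rescaled to values in \<open>[0, 1]\<close> with reversed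
        sign, so that the overlap estimate bounds the difference of the tilted means of
        \<open>g\<close> from above.\<close>
      define \<psi> where "\<psi> u = (1 - g u / s) / 2" for u
      have [measurable]: "\<psi> \<in> borel_measurable borel" unfolding \<psi>_def by measurable
      have \<psi>01: "0 \<le> \<psi> z \<and> \<psi> z \<le> 1" for z
        using g_bd[of z] s by (auto simp: \<psi>_def field_simps)
      have g_eq: "g u = s * (1 - 2 * \<psi> u)" for u using s by (simp add: \<psi>_def field_simps)
      have tame_\<psi>: "tame (\<lambda>w. \<psi> (G z w))" for z
        using \<psi>01 by (intro tame_bounded[OF _ _ tame_const[of 1]]) auto
      have "\<delta> \<le> tilt Y (\<lambda>w. \<psi> (G x w)) + tilt Y' (\<lambda>w. 1 - \<psi> (G y w))"
        using small0[OF _ _ Y Y', of \<psi>] True S \<psi>01 \<delta> by auto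
      then have *: "\<delta> \<le> tilt Y (\<lambda>w. \<psi> (G x w)) + 1 - tilt Y' (\<lambda>w. \<psi> (G y w))"
        by (simp add: tilt_diff[OF Y'] tame_const tame_\<psi> tilt_const[OF Y'])
      have "tilt Y (\<lambda>w. g (G x w)) - tilt Y' (\<lambda>w. g (G y w)) = 
        s * (2 * (tilt Y' (\<lambda>w. \<psi> (G y w)) - tilt Y (\<lambda>w. \<psi> (G x w))))"
        unfolding g_eq by (simp add: tilt_cmult tilt_diff[OF Y'] tilt_diff[OF Y] tame_const tame_\<psi> tame_cmult
          tilt_const[OF Y'] tilt_const[OF Y] algebra_simps)
      also have "\<dots> \<le> s * (2 * (1 - \<delta>))"
        using * s by (intro mult_left_mono) auto
      finally have tilt_g: "tilt Y (\<lambda>w. g (G x w)) - tilt Y' (\<lambda>w. g (G y w)) \<le> s * (2 * (1 - \<delta>))" .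
      have "tilt Y (\<lambda>w. f (G x w) - c) \<le> tilt Y (\<lambda>w. g (G x w) + s * \<beta> * weight (G x w))"
        using g_near(1)
        by (intro tilt_mono[OF Y] tame_diff tame_f tame_const tame_cmult tame_add tame_g tame_weight_G) (auto simp: algebra_simps)
      moreover have "tilt Y' (\<lambda>w. c - f (G y w)) \<le> tilt Y' (\<lambda>w. s * \<beta> * weight (G y w) - g (G y w))"
        using g_near(2)
        by (intro tilt_mono[OF Y'] tame_diff tame_f tame_const tame_cmult tame_g tame_weight_G) (auto simp: algebra_simps)
      ultimately have "tilt Y (\<lambda>w. f (G x w)) - tilt Y' (\<lambda>w. f (G y w)) \<le>
          tilt Y (\<lambda>w. g (G x w)) - tilt Y' (\<lambda>w. g (G y w)) +
          s * (\<beta> * (tilt Y (\<lambda>w. weight (G x w)) + tilt Y' (\<lambda>w. weight (G y w))))"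
        unfolding eq by (simp add: tilt_cmult tilt_add[OF Y] tilt_diff[OF Y'] tame_g tame_const tame_cmult tame_weight_G
          algebra_simps)
      also have "\<dots> \<le> s * (2 * (1 - \<delta>)) + s * (\<beta> * (2 * C + b * S))"
        using s \<beta> by (intro add_mono[OF tilt_g mult_left_mono[OF mult_left_mono[OF sum_drift]]]) auto
      also have "\<dots> = s * (2 * (1 - \<delta>) + \<beta> * (2 * C + b * S))" by (simp add: algebra_simps)
      also have "\<dots> \<le> s * ((1 - \<delta> / 2) * (2 + \<beta> * S))"
      proof (rule mult_left_mono)
        have "b * S \<le> 1 * R" using True b S by (intro mult_mono) auto
        then have "\<beta> * (2 * C + b * S) \<le> \<beta> * (2 * C + R)" using \<beta> by (intro mult_left_mono) auto
        also have "\<dots> \<le> \<delta>" by fact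
        finally have "2 * (1 - \<delta>) + \<beta> * (2 * C + b * S) \<le> (1 - \<delta> / 2) * 2" by simp
        also have "\<dots> \<le> (1 - \<delta> / 2) * (2 + \<beta> * S)" using \<beta> S \<delta> by (intro mult_left_mono) auto
        finally show "2 * (1 - \<delta>) + \<beta> * (2 * C + b * S) \<le> (1 - \<delta> / 2) * (2 + \<beta> * S)" .
      qed (use s in auto)
      also have "\<dots> \<le> s * (\<alpha> * (2 + \<beta> * S))"
        using s \<beta> S by (intro mult_left_mono mult_right_mono) (auto simp: \<alpha>_def intro!: add_nonneg_nonneg)
      finally show ?thesis by (simp add: mult_ac)
    qed
    then show ?thesis by (simp add: S_def distrib_left add.assoc)
  qed
  \<comment> \<open>The rescaling divides by \<open>s\<close>, so \<open>s = 0\<close> is separate: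
    then \<open>f\<close> is constant.\<close>
  moreover have "tilt Y (\<lambda>w. f (G x w)) - tilt Y' (\<lambda>w. f (G y w)) \<le> 0"
    if Y: "affinely_dominated K (weight x) Y" and Y': "affinely_dominated K (weight y) Y'"
      and "\<And>u v. f u - f v \<le> 0" for x y Y Y' and f :: "'x \<Rightarrow> real"
  proof -
    have "f u = f undefined" for u using that(3)[of u undefined] that(3)[of undefined u] by simp
    then have "(\<lambda>w. f (G z w)) = (\<lambda>_. f undefined)" for z by blast
    then show ?thesis by (simp only: tilt_const[OF Y] tilt_const[OF Y'])
  qed
  ultimately have "tilt Y (\<lambda>w. f (G x w)) - tilt Y' (\<lambda>w. f (G y w)) \<le> \<alpha> * (s * (2 + \<beta> * weight x + \<beta> * weight y))"
    if "0 \<le> s" "affinely_dominated K (weight x) Y" "affinely_dominated K (weight y) Y'"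
      "f \<in> borel_measurable borel" "\<forall>u v. f u - f v \<le> s * (2 + \<beta> * weight u + \<beta> * weight v)" for x y Y Y' f s
    using that by (cases "s = 0") auto
  then show ?thesis using \<alpha> \<beta>(1,2) by blast
qed

end

section \<open>The Bellman operator\<close>

context exp_moments
begin

text \<open>The entropic utility \<open>\<mu>\<^sup>\<gamma>\<close> for \<open>\<gamma> = - \<theta>\<close>.\<close>

definition certainty_equiv :: "real \<Rightarrow> ('w \<Rightarrow> real) \<Rightarrow> real" where
  "certainty_equiv \<theta> Z = - ln (\<integral>w. exp (- (\<theta> * Z w)) \<partial>P) / \<theta>"

text \<open>The quotient of the two exponential integrals is the mean of
  \<open>exp (- \<theta> * (Z - Z'))\<close> under the law tilted by \<open>\<theta> * Z'\<close>,
  and Jensen applies. In other words, the tilted mean is the derivative at \<open>Z'\<close> of a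
  concave functional. No factor \<open>1 / \<theta>\<close> is left.\<close>

lemma certainty_equiv_diff_le:
  assumes \<theta>: "0 < \<theta>" and Z: "affinely_dominated K r (\<lambda>w. \<theta> * Z w)" and Z': "affinely_dominated K' r' (\<lambda>w. \<theta> * Z' w)"
  shows "certainty_equiv \<theta> Z - certainty_equiv \<theta> Z' \<le> tilt (\<lambda>w. \<theta> * Z' w) (\<lambda>w. Z w - Z' w)"
proof -
  let ?N = "\<integral>w. exp (- (\<theta> * Z w)) \<partial>P" and ?N' = "\<integral>w. exp (- (\<theta> * Z' w)) \<partial>P"
  define t where "t = tilt (\<lambda>w. \<theta> * Z' w) (\<lambda>w. Z w - Z' w)"
  have pos: "0 < ?N" "0 < ?N'" using norm_const_pos[OF Z] norm_const_pos[OF Z'] .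
  have tame: "tame Z" "tame Z'"
    using tame_cmult[OF affinely_dominated_tame[OF Z], of "1 / \<theta>"]
      tame_cmult[OF affinely_dominated_tame[OF Z'], of "1 / \<theta>"] \<theta> by auto
  have eq: "exp (- \<theta> * (Z w - Z' w)) = exp (- (\<theta> * Z w)) * exp (\<theta> * Z' w)" for w
    by (simp flip: exp_add add: algebra_simps)
  have "exp (- \<theta> * t) = exp (tilt (\<lambda>w. \<theta> * Z' w) (\<lambda>w. - \<theta> * (Z w - Z' w)))"
    by (simp only: tilt_cmult t_def)
  also have "\<dots> \<le> tilt (\<lambda>w. \<theta> * Z' w) (\<lambda>w. exp (- \<theta> * (Z w - Z' w)))"
  proof (rule exp_tilt_le[OF Z'])
    show "tame (\<lambda>w. exp (- \<theta> * (Z w - Z' w)))"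
      unfolding eq using Z Z' by (intro tame_mult affinely_dominated_exp affinely_dominated_exp_minus)
  qed (intro tame_cmult tame_diff tame)
  finally have "exp (- \<theta> * t) * ?N' \<le> (\<integral>w. exp (- \<theta> * (Z w - Z' w)) * exp (- (\<theta> * Z' w)) \<partial>P)"
    unfolding integral_exp_mult[OF Z'] using pos by (intro mult_right_mono) auto
  also have "\<dots> = ?N" by (simp flip: exp_add add: algebra_simps)
  finally have "exp (- \<theta> * t + ln ?N') \<le> exp (ln ?N)" by (simp only: exp_add exp_ln[OF pos(1)] exp_ln[OF pos(2)])
  then have "- \<theta> * t + ln ?N' \<le> ln ?N" by (simp only: exp_le_cancel_iff)
  then show ?thesis using \<theta> unfolding certainty_equiv_def t_def[symmetric] by (simp add: field_simps)
qed

end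

context controlled_kernel
begin

definition energy :: "real \<Rightarrow> ('x \<Rightarrow> real) \<Rightarrow> 'x \<Rightarrow> 'u \<Rightarrow> 'w \<Rightarrow> real" where
  "energy \<theta> f x h w = \<theta> * (F x h w + f (G x w))"

text \<open>The bound concerns \<open>\<theta> * f\<close>, which is what enters the exponent; hence
  one \<open>K\<close> governs the tilts for all \<theta> at the same time.\<close>

definition growth_class :: "real \<Rightarrow> real \<Rightarrow> ('x \<Rightarrow> real) \<Rightarrow> bool" where
  "growth_class K \<theta> f \<longleftrightarrow> continuous_on UNIV f \<and> (\<forall>x. \<theta> * \<bar>f x\<bar> \<le> K * (1 + weight x))"

definition objective :: "real \<Rightarrow> ('x \<Rightarrow> real) \<Rightarrow> 'x \<Rightarrow> 'u \<Rightarrow> real" where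
  "objective \<theta> f x h = certainty_equiv \<theta> (\<lambda>w. F x h w + f (G x w))"

definition bellman_op :: "real \<Rightarrow> ('x \<Rightarrow> real) \<Rightarrow> 'x \<Rightarrow> real" where
  "bellman_op \<theta> f x = (SUP h\<in>U. objective \<theta> f x h)"

text \<open>The weighted span seminorm of \<open>f\<close> is at most \<open>s\<close>. As a
  relation it avoids a supremum that may be infinite; exchanging \<open>u\<close> and
  \<open>v\<close> supplies the absolute value.\<close>

definition osc_le :: "real \<Rightarrow> real \<Rightarrow> ('x \<Rightarrow> real) \<Rightarrow> bool" where
  "osc_le \<beta> s f \<longleftrightarrow> (\<forall>u v. f u - f v \<le> s * (2 + \<beta> * weight u + \<beta> * weight v))"

lemma growth_class_measurable [measurable_dest]: "growth_class K \<theta> f \<Longrightarrow> f \<in> borel_measurable borel"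
  by (auto simp: growth_class_def intro: borel_measurable_continuous_onI)

lemma growth_class_mono:
  assumes "growth_class K \<theta> f" "K \<le> K'" shows "growth_class K' \<theta> f"
  using assms weight_nonneg unfolding growth_class_def
  by (meson add_nonneg_nonneg mult_right_mono order_trans zero_le_one)

lemma energy_dominated:
  assumes \<theta>: "0 < \<theta>" "\<theta> \<le> K" and f: "growth_class K \<theta> f" and h: "h \<in> U"
  shows "affinely_dominated (K * (2 + b2)) (weight x) (energy \<theta> f x h)"
  unfolding affinely_dominated_def
proof safe
  show "energy \<theta> f x h \<in> borel_measurable P"
    unfolding energy_def using F_measurable[OF h] measurable_compose[OF G_measurable growth_class_measurable[OF f]] by measurable
next
  fix w
  have K: "0 \<le> K" using \<theta> by simp
  have "\<bar>energy \<theta> f x h w\<bar> \<le> \<theta> * \<bar>F x h w\<bar> + \<theta> * \<bar>f (G x w)\<bar>"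
    using \<theta> abs_triangle_ineq[of "\<theta> * F x h w" "\<theta> * f (G x w)"] by (simp add: energy_def abs_mult distrib_left)
  also have "\<dots> \<le> K * (a w + b2 * weight x) + K * (1 + (a w + b1 * weight x))"
  proof (rule add_mono)
    show "\<theta> * \<bar>F x h w\<bar> \<le> K * (a w + b2 * weight x)"
      using \<theta> by (intro mult_mono F_bound h) auto
    have "\<theta> * \<bar>f (G x w)\<bar> \<le> K * (1 + weight (G x w))" using f by (auto simp: growth_class_def)
    also have "\<dots> \<le> K * (1 + (a w + b1 * weight x))"
      using weight_G K by (intro mult_left_mono) auto
    finally show "\<theta> * \<bar>f (G x w)\<bar> \<le> K * (1 + (a w + b1 * weight x))" .
  qed
  also have "\<dots> = K * (1 + 2 * a w + (b2 + b1) * weight x)" by (simp add: algebra_simps)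
  also have "\<dots> \<le> K * ((2 + b2) * (1 + a w + weight x))"
  proof (rule mult_left_mono[OF _ K])
    have "0 \<le> b2 * a w" "b1 * weight x \<le> 2 * weight x"
      using a_nonneg[of w] b1 b2 weight_nonneg[of x] by (auto intro!: mult_right_mono)
    then show "1 + 2 * a w + (b2 + b1) * weight x \<le> (2 + b2) * (1 + a w + weight x)"
      using b2 by (simp add: algebra_simps)
  qed
  finally show "\<bar>energy \<theta> f x h w\<bar> \<le> K * (2 + b2) * (1 + a w + weight x)" by (simp only: mult.assoc)
qed

lemma objective_diff_le:
  assumes \<theta>: "0 < \<theta>" "\<theta> \<le> K" and f: "growth_class K \<theta> f" and g: "growth_class K \<theta> g" and h: "h \<in> U"
  shows "objective \<theta> f x h - objective \<theta> g x h \<le> tilt (energy \<theta> g x h) (\<lambda>w. f (G x w) - g (G x w))"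
  using certainty_equiv_diff_le[OF \<theta>(1) energy_dominated[OF \<theta> f h, of x, unfolded energy_def[abs_def]]
      energy_dominated[OF \<theta> g h, of x, unfolded energy_def[abs_def]]]
  by (simp add: objective_def energy_def[abs_def])

lemma exp_objective:
  assumes \<theta>: "0 < \<theta>" "\<theta> \<le> K" and f: "growth_class K \<theta> f" and h: "h \<in> U"
  shows "(\<integral>w. exp (- energy \<theta> f x h w) \<partial>P) = exp (- \<theta> * objective \<theta> f x h)"
proof -
  have "0 < (\<integral>w. exp (- energy \<theta> f x h w) \<partial>P)" by (rule norm_const_pos[OF energy_dominated[OF assms]])
  then show ?thesis using \<theta> by (simp add: objective_def certainty_equiv_def energy_def)
qed

lemma objective_continuous:
  assumes \<theta>: "0 < \<theta>" "\<theta> \<le> K" and f: "growth_class K \<theta> f"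
  shows "continuous_on (UNIV \<times> U) (\<lambda>(x, h). objective \<theta> f x h)"
proof -
  have "continuous_on (UNIV \<times> U) (\<lambda>(x, h). \<integral>w. exp (- energy \<theta> f x h w) \<partial>P)"
    unfolding continuous_on_sequentially
  proof (intro allI ballI impI, elim conjE)
    fix z :: "nat \<Rightarrow> 'x \<times> 'u" and p assume p: "p \<in> UNIV \<times> U" and z: "\<forall>n. z n \<in> UNIV \<times> U" and lim: "z \<longlonglongrightarrow> p"
    \<comment> \<open>The weight is bounded along a convergent sequence, which provides one
      dominating function for all \<open>n\<close>.\<close>
    have "(\<lambda>n. weight (fst (z n))) \<longlonglongrightarrow> weight (fst p)"
      using weight_continuous tendsto_fst[OF lim] by (rule continuous_on_tendsto_compose) auto
    then have "Bseq (\<lambda>n. weight (fst (z n)))" by (intro convergent_imp_Bseq convergentI)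
    then obtain B where B: "\<And>n. weight (fst (z n)) \<le> B" unfolding Bseq_def by (auto simp: abs_le_iff)
    let ?K = "K * (2 + b2)"
    have dom: "affinely_dominated ?K (weight (fst (z n))) (energy \<theta> f (fst (z n)) (snd (z n)))" for n
      using z by (intro energy_dominated[OF \<theta> f]) (auto simp: mem_Times_iff)
    have cont: "continuous_on (UNIV \<times> U) (\<lambda>(x, h). energy \<theta> f x h w)" for w
    proof -
      have "continuous_on (UNIV \<times> U) (\<lambda>p. f (G (fst p) w))"
        using f[unfolded growth_class_def, THEN conjunct1] 
        by (rule continuous_on_compose2[OF _ continuous_on_compose2[OF G_continuous[of w] continuous_on_fst[OF continuous_on_id]]]) auto
      then show ?thesis
        using F_continuous[of w] unfolding energy_def case_prod_beta
        by (intro continuous_intros)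
    qed
    show "((\<lambda>(x, h). \<integral>w. exp (- energy \<theta> f x h w) \<partial>P) \<circ> z) \<longlonglongrightarrow> (\<lambda>(x, h). \<integral>w. exp (- energy \<theta> f x h w) \<partial>P) p"
      unfolding comp_def case_prod_beta
    proof (rule integral_dominated_convergence)
      show "integrable P (\<lambda>w. exp (?K * (1 + B)) * exp (?K * a w))"
        by (intro tame_integrable tame_cmult tame_exp_a)
      show "AE w in P. (\<lambda>n. exp (- energy \<theta> f (fst (z n)) (snd (z n)) w)) \<longlonglongrightarrow> exp (- energy \<theta> f (fst p) (snd p) w)"
      proof (intro AE_I2 tendsto_exp tendsto_minus)
        fix w
        show "(\<lambda>n. energy \<theta> f (fst (z n)) (snd (z n)) w) \<longlonglongrightarrow> energy \<theta> f (fst p) (snd p) w"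
          using continuous_on_tendsto_compose[OF cont[of w] lim p] z by (simp add: case_prod_beta)
      qed
      show "AE w in P. norm (exp (- energy \<theta> f (fst (z n)) (snd (z n)) w)) \<le> exp (?K * (1 + B)) * exp (?K * a w)" for n
      proof (rule AE_I2)
        fix w
        have "- energy \<theta> f (fst (z n)) (snd (z n)) w \<le> ?K * (1 + a w + weight (fst (z n)))"
          using dom[of n] by (auto simp: affinely_dominated_def abs_le_iff)
        also have "\<dots> \<le> ?K * (1 + a w + B)" using B[of n] \<theta> b2 by (intro mult_left_mono) auto
        finally show "norm (exp (- energy \<theta> f (fst (z n)) (snd (z n)) w)) \<le> exp (?K * (1 + B)) * exp (?K * a w)"
          by (simp flip: exp_add add: algebra_simps)
      qed
      show "(\<lambda>w. exp (- energy \<theta> f (fst (z n)) (snd (z n)) w)) \<in> borel_measurable P" for n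
        by (rule tame_measurable[OF affinely_dominated_exp_minus[OF dom]])
      show "(\<lambda>w. exp (- energy \<theta> f (fst p) (snd p) w)) \<in> borel_measurable P"
        using p by (intro tame_measurable[OF affinely_dominated_exp_minus[OF energy_dominated[OF \<theta> f]]]) (auto simp: mem_Times_iff)
    qed
  qed
  moreover have "(\<integral>w. exp (- energy \<theta> f x h w) \<partial>P) \<noteq> 0" if "h \<in> U" for x h
    using exp_objective[OF \<theta> f that] by simp
  ultimately show ?thesis
    using \<theta> unfolding objective_def certainty_equiv_def energy_def case_prod_beta
    by (intro continuous_intros) (auto simp: mem_Times_iff)
qed

lemma objective_attains:
  assumes \<theta>: "0 < \<theta>" "\<theta> \<le> K" and f: "growth_class K \<theta> f"
  shows "\<exists>h\<in>U. bellman_op \<theta> f x = objective \<theta> f x h"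
    and "h \<in> U \<Longrightarrow> objective \<theta> f x h \<le> bellman_op \<theta> f x"
proof -
  have "continuous_on U (objective \<theta> f x)"
    using continuous_on_compose2[OF objective_continuous[OF assms] continuous_on_Pair[OF continuous_on_const[of U x] continuous_on_id]]
    by auto
  from continuous_attains_sup[OF U_compact U_nonempty this]
  obtain h0 where h0: "h0 \<in> U" "\<And>h. h \<in> U \<Longrightarrow> objective \<theta> f x h \<le> objective \<theta> f x h0" by blast
  then have *: "bellman_op \<theta> f x = objective \<theta> f x h0"
    unfolding bellman_op_def by (intro cSup_eq_maximum) auto
  then show "\<exists>h\<in>U. bellman_op \<theta> f x = objective \<theta> f x h" using h0 by blast
  show "h \<in> U \<Longrightarrow> objective \<theta> f x h \<le> bellman_op \<theta> f x" using h0(2) * by simp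
qed

text \<open>Since \<open>U\<close> is compact, the objective is continuous in the state uniformly in
  the control, and this passes to the supremum.\<close>

lemma bellman_op_continuous:
  assumes \<theta>: "0 < \<theta>" "\<theta> \<le> K" and f: "growth_class K \<theta> f"
  shows "continuous_on UNIV (bellman_op \<theta> f)"
proof (clarsimp simp: continuous_on_iff)
  fix x :: 'x and e :: real assume e: "0 < e"
  have "uniformly_continuous_on (cball x 1 \<times> U) (\<lambda>(x, h). objective \<theta> f x h)"
    by (intro compact_uniformly_continuous continuous_on_subset[OF objective_continuous[OF assms]] compact_Times U_compact) auto
  then obtain d where d: "d > 0" "\<And>p q. p \<in> cball x 1 \<times> U \<Longrightarrow> q \<in> cball x 1 \<times> U \<Longrightarrow> dist q p < d \<Longrightarrow>
      dist ((\<lambda>(x, h). objective \<theta> f x h) q) ((\<lambda>(x, h). objective \<theta> f x h) p) < e"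
    unfolding uniformly_continuous_on_def using e by metis
  show "\<exists>d>0. \<forall>x'. dist x' x < d \<longrightarrow> dist (bellman_op \<theta> f x') (bellman_op \<theta> f x) < e"
  proof (intro exI[of _ "min d 1"] conjI allI impI)
    fix y assume y: "dist y x < min d 1"
    then have close: "\<bar>objective \<theta> f y h - objective \<theta> f x h\<bar> < e" if "h \<in> U" for h
      using d(2)[of "(x, h)" "(y, h)"] that by (auto simp: dist_Pair_Pair dist_real_def dist_commute)
    obtain hx where hx: "hx \<in> U" "bellman_op \<theta> f x = objective \<theta> f x hx" using objective_attains(1)[OF assms] by blast
    obtain hy where hy: "hy \<in> U" "bellman_op \<theta> f y = objective \<theta> f y hy" using objective_attains(1)[OF assms] by blast
    show "dist (bellman_op \<theta> f y) (bellman_op \<theta> f x) < e"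
      using close[OF hx(1)] close[OF hy(1)] hx(2) hy(2) objective_attains(2)[OF assms hx(1), of y]
        objective_attains(2)[OF assms hy(1), of x] unfolding dist_real_def by linarith
  qed (use d in auto)
qed

text \<open>At \<open>x\<close> the maximiser for \<open>f\<close> is inserted into the problem of
  \<open>g\<close>, at \<open>y\<close> the maximiser for \<open>g\<close> into that of
  \<open>f\<close>. Both increments become tilted means of \<open>f - g\<close>, under tilts that
  have nothing in common except their domination constant.\<close>

lemma bellman_op_contraction:
  assumes K: "0 \<le> K"
  shows "\<exists>\<beta>>0. \<exists>\<alpha>>0. \<beta> \<le> 1 \<and> \<alpha> < 1 \<and> (\<forall>\<theta> f g s. 0 < \<theta> \<longrightarrow> \<theta> \<le> K \<longrightarrow>
    growth_class K \<theta> f \<longrightarrow> growth_class K \<theta> g \<longrightarrow> 0 \<le> s \<longrightarrow> osc_le \<beta> s (\<lambda>u. f u - g u) \<longrightarrow>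
    osc_le \<beta> (\<alpha> * s) (\<lambda>u. bellman_op \<theta> f u - bellman_op \<theta> g u))"
proof -
  have "0 \<le> K * (2 + b2)" using K b2 by simp
  from tilt_contraction[OF this] obtain \<beta> \<alpha> where ab: "\<beta> > 0" "\<alpha> > 0" "\<beta> \<le> 1" "\<alpha> < 1"
    and contr: "\<And>x y Y Y' f s. 0 \<le> s \<Longrightarrow>
      affinely_dominated (K * (2 + b2)) (weight x) Y \<Longrightarrow> affinely_dominated (K * (2 + b2)) (weight y) Y' \<Longrightarrow>
      f \<in> borel_measurable borel \<Longrightarrow> (\<forall>u v. f u - f v \<le> s * (2 + \<beta> * weight u + \<beta> * weight v)) \<Longrightarrow>
      tilt Y (\<lambda>w. f (G x w)) - tilt Y' (\<lambda>w. f (G y w)) \<le> \<alpha> * (s * (2 + \<beta> * weight x + \<beta> * weight y))"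
    by blast
  have "bellman_op \<theta> f x - bellman_op \<theta> g x - (bellman_op \<theta> f y - bellman_op \<theta> g y) \<le> \<alpha> * s * (2 + \<beta> * weight x + \<beta> * weight y)"
    if \<theta>: "0 < \<theta>" "\<theta> \<le> K" and f: "growth_class K \<theta> f" and g: "growth_class K \<theta> g"
      and s: "0 \<le> s" and osc: "osc_le \<beta> s (\<lambda>u. f u - g u)" for \<theta> f g s x y
  proof -
    obtain h where h: "h \<in> U" "bellman_op \<theta> f x = objective \<theta> f x h" using objective_attains(1)[OF \<theta> f] by blast
    obtain h' where h': "h' \<in> U" "bellman_op \<theta> g y = objective \<theta> g y h'" using objective_attains(1)[OF \<theta> g] by blast
    note Y = energy_dominated[OF \<theta> g h(1), of x] and Y' = energy_dominated[OF \<theta> f h'(1), of y]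
    have [measurable]: "f \<in> borel_measurable borel" "g \<in> borel_measurable borel"
      using f g by (auto dest: growth_class_measurable)
    have "bellman_op \<theta> f x - bellman_op \<theta> g x \<le> tilt (energy \<theta> g x h) (\<lambda>w. f (G x w) - g (G x w))"
      using objective_diff_le[OF \<theta> f g h(1), of x] objective_attains(2)[OF \<theta> g h(1), of x] h(2) by simp
    moreover have "bellman_op \<theta> g y - bellman_op \<theta> f y \<le> tilt (energy \<theta> f y h') (\<lambda>w. g (G y w) - f (G y w))"
      using objective_diff_le[OF \<theta> g f h'(1), of y] objective_attains(2)[OF \<theta> f h'(1), of y] h'(2) by simp
    moreover have "tilt (energy \<theta> f y h') (\<lambda>w. g (G y w) - f (G y w)) = - tilt (energy \<theta> f y h') (\<lambda>w. f (G y w) - g (G y w))"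
      by (simp flip: tilt_uminus)
    moreover have "tilt (energy \<theta> g x h) (\<lambda>w. f (G x w) - g (G x w)) - tilt (energy \<theta> f y h') (\<lambda>w. f (G y w) - g (G y w))
        \<le> \<alpha> * (s * (2 + \<beta> * weight x + \<beta> * weight y))"
      using osc by (intro contr[of s x _ y _ "\<lambda>u. f u - g u", OF s Y Y']) (auto simp: osc_le_def)
    ultimately show ?thesis by (simp add: mult.assoc)
  qed
  then show ?thesis using ab unfolding osc_le_def
    by (intro exI[of _ \<beta>] conjI exI[of _ \<alpha>] allI impI) auto
qed

text \<open>The first step of value iteration must be bounded uniformly in \<theta>, although
  \<open>certainty_equiv\<close> divides by \<theta>. Comparing the payoff with zero in both
  directions replaces the logarithm by tilted means of \<open>F\<close>.\<close>

lemma bellman_op_zero_bound: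
  "\<exists>C\<ge>0. \<forall>\<theta>. 0 < \<theta> \<longrightarrow> \<theta> \<le> 1 \<longrightarrow> (\<forall>x. \<bar>bellman_op \<theta> (\<lambda>_. 0) x\<bar> \<le> C * (1 + weight x))"
proof -
  obtain C where C: "C \<ge> 0" "\<And>r Y. r \<ge> 0 \<Longrightarrow> affinely_dominated (2 + b2) r Y \<Longrightarrow> tilt Y a \<le> C + 1 * r"
    using tilt_a_le[of "2 + b2" 1] b2 by auto
  have "\<bar>bellman_op \<theta> (\<lambda>_. 0) x\<bar> \<le> (C + 1 + b2) * (1 + weight x)" if \<theta>: "0 < \<theta>" "\<theta> \<le> 1" for \<theta> x
  proof -
    have g: "growth_class 1 \<theta> (\<lambda>_. 0)" using weight_nonneg by (auto simp: growth_class_def)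
    obtain h where h: "h \<in> U" "bellman_op \<theta> (\<lambda>_. 0) x = objective \<theta> (\<lambda>_. 0) x h"
      using objective_attains(1)[OF \<theta> g] by blast
    have Y: "affinely_dominated (2 + b2) (weight x) (\<lambda>w. \<theta> * F x h w)"
      using energy_dominated[OF \<theta> g h(1), of x] by (simp add: energy_def[abs_def])
    have Y0: "affinely_dominated (2 + b2) (weight x) (\<lambda>w. \<theta> * 0)"
      using a_nonneg weight_nonneg b2 by (auto simp: affinely_dominated_def intro!: add_nonneg_nonneg)
    have tF: "tame (F x h)" using tame_cmult[OF affinely_dominated_tame[OF Y], of "1 / \<theta>"] \<theta> by simp
    have bound: "tilt Z f \<le> (C + 1 + b2) * (1 + weight x)"
      if Z: "affinely_dominated (2 + b2) (weight x) Z" and f: "tame f" "\<And>w. f w \<le> \<bar>F x h w\<bar>" for Z f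
    proof -
      have "tilt Z f \<le> tilt Z (\<lambda>w. a w + b2 * weight x)"
        using f F_bound[OF h(1), of x] by (intro tilt_mono[OF Z] tame_add tame_a tame_const) (auto intro: order_trans)
      also have "\<dots> = tilt Z a + b2 * weight x" by (simp add: tilt_add[OF Z] tame_a tame_const tilt_const[OF Z])
      also have "\<dots> \<le> C + weight x + b2 * weight x" using C(2)[OF weight_nonneg Z] by simp
      also have "\<dots> \<le> (C + 1 + b2) * (1 + weight x)"
        using C(1) b2 mult_nonneg_nonneg[OF C(1) weight_nonneg[of x]] by (simp add: algebra_simps)
      finally show ?thesis .
    qed
    have zero: "certainty_equiv \<theta> (\<lambda>_. 0) = 0" by (simp add: certainty_equiv_def prob_space)
    have "certainty_equiv \<theta> (F x h) - certainty_equiv \<theta> (\<lambda>_. 0) \<le> (C + 1 + b2) * (1 + weight x)"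
      using tF by (intro order_trans[OF certainty_equiv_diff_le[OF \<theta>(1) Y Y0] bound[OF Y0]]) auto
    moreover have "certainty_equiv \<theta> (\<lambda>_. 0) - certainty_equiv \<theta> (F x h) \<le> (C + 1 + b2) * (1 + weight x)"
      using tF by (intro order_trans[OF certainty_equiv_diff_le[OF \<theta>(1) Y0 Y] bound[OF Y]]) auto
    ultimately show ?thesis using h(2) zero by (simp add: objective_def abs_le_iff)
  qed
  then show ?thesis using C b2 by (intro exI[of _ "C + 1 + b2"]) auto
qed

end

section \<open>Solutions of the Bellman equation\<close>

context controlled_kernel
begin

lemma osc_le_add: "osc_le \<beta> s f \<Longrightarrow> osc_le \<beta> t g \<Longrightarrow> osc_le \<beta> (s + t) (\<lambda>u. f u + g u)"
  unfolding osc_le_def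
proof (intro allI)
  fix u v assume "\<forall>u v. f u - f v \<le> s * (2 + \<beta> * weight u + \<beta> * weight v)"
    "\<forall>u v. g u - g v \<le> t * (2 + \<beta> * weight u + \<beta> * weight v)"
  then have "f u - f v \<le> s * (2 + \<beta> * weight u + \<beta> * weight v)" "g u - g v \<le> t * (2 + \<beta> * weight u + \<beta> * weight v)"
    by blast+
  then show "f u + g u - (f v + g v) \<le> (s + t) * (2 + \<beta> * weight u + \<beta> * weight v)"
    unfolding distrib_right[of s t] by linarith
qed

lemma osc_le_uminus: "osc_le \<beta> s f \<Longrightarrow> osc_le \<beta> s (\<lambda>u. - f u)"
  unfolding osc_le_def
proof (intro allI)
  fix u v assume "\<forall>u v. f u - f v \<le> s * (2 + \<beta> * weight u + \<beta> * weight v)"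
  then have "f v - f u \<le> s * (2 + \<beta> * weight v + \<beta> * weight u)" by blast
  then show "- f u - - f v \<le> s * (2 + \<beta> * weight u + \<beta> * weight v)" by (simp add: add_ac)
qed

lemma osc_le_mono:
  assumes "osc_le \<beta> s f" "s \<le> t" "0 \<le> \<beta>" shows "osc_le \<beta> t f"
  unfolding osc_le_def
proof (intro allI)
  fix u v
  have "f u - f v \<le> s * (2 + \<beta> * weight u + \<beta> * weight v)" using assms(1) by (auto simp: osc_le_def)
  also have "\<dots> \<le> t * (2 + \<beta> * weight u + \<beta> * weight v)"
    using assms(2,3) weight_nonneg by (intro mult_right_mono) (auto intro!: add_nonneg_nonneg)
  finally show "f u - f v \<le> t * (2 + \<beta> * weight u + \<beta> * weight v)" .
qed

lemma osc_le_shift: "osc_le \<beta> s (\<lambda>u. f u + c) \<longleftrightarrow> osc_le \<beta> s f"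
  by (simp add: osc_le_def)

lemma osc_le_limit_const:
  assumes "\<And>n. osc_le \<beta> (s n) f" "s \<longlonglongrightarrow> 0" shows "f u = f v"
proof -
  have "f u - f v \<le> 0" for u v
  proof (rule LIMSEQ_le_const)
    show "(\<lambda>n. s n * (2 + \<beta> * weight u + \<beta> * weight v)) \<longlonglongrightarrow> 0"
      using tendsto_mult_right[OF assms(2)] by simp
  qed (use assms(1) in \<open>auto simp: osc_le_def\<close>)
  from this[of u v] this[of v u] show ?thesis by simp
qed

lemma bounded_osc_le:
  assumes "\<And>x. \<bar>f x\<bar> \<le> C * (1 + weight x)" "0 < \<beta>" "\<beta> \<le> 1"
  shows "osc_le \<beta> (C / \<beta>) f"
  unfolding osc_le_def
proof (intro allI)
  fix u v
  have "0 \<le> \<bar>f u\<bar>" by simp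
  also have "\<dots> \<le> C * (1 + weight u)" by fact
  finally have C: "0 \<le> C" using weight_nonneg[of u] by (auto simp: zero_le_mult_iff)
  have "f u - f v \<le> C * (1 + weight u) + C * (1 + weight v)" using assms(1)[of u] assms(1)[of v] by linarith
  also have "\<dots> \<le> C * (2 / \<beta> + weight u + weight v)"
    unfolding distrib_left[symmetric] using assms(2,3) by (intro mult_left_mono C) (simp add: field_simps)
  also have "\<dots> = C / \<beta> * (2 + \<beta> * weight u + \<beta> * weight v)" using assms(2) by (simp add: field_simps)
  finally show "f u - f v \<le> C / \<beta> * (2 + \<beta> * weight u + \<beta> * weight v)" .
qed

text \<open>The tilted mean of a constant is that constant, so the comparison bound gives both
  inequalities. Shifting alters the growth constant, hence the common class
  \<open>L\<close>.\<close>

lemma objective_shift: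
  assumes \<theta>: "0 < \<theta>" and f: "growth_class K \<theta> f" "growth_class K' \<theta> (\<lambda>x. f x + c)" and h: "h \<in> U"
  shows "objective \<theta> (\<lambda>x. f x + c) x h = objective \<theta> f x h + c"
proof -
  define L where "L = max \<theta> (max K K')"
  have L: "\<theta> \<le> L" "growth_class L \<theta> f" "growth_class L \<theta> (\<lambda>x. f x + c)"
    using f by (auto simp: L_def intro: growth_class_mono)
  have "objective \<theta> (\<lambda>x. f x + c) x h - objective \<theta> f x h \<le> c"
    using objective_diff_le[OF \<theta> L(1,3,2) h, of x] tilt_const[OF energy_dominated[OF \<theta> L(1,2) h], of x c] by simp
  moreover have "objective \<theta> f x h - objective \<theta> (\<lambda>x. f x + c) x h \<le> - c"
    using objective_diff_le[OF \<theta> L(1,2,3) h, of x] tilt_const[OF energy_dominated[OF \<theta> L(1,3) h], of x "- c"] by simp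
  ultimately show ?thesis by simp
qed

lemma growth_classI:
  assumes "continuous_on UNIV f" "\<And>x. \<bar>f x\<bar> \<le> C * (1 + weight x)" "0 < \<theta>" "\<theta> * C \<le> K"
  shows "growth_class K \<theta> f"
  unfolding growth_class_def
proof (intro conjI allI assms(1))
  fix x
  have "\<theta> * \<bar>f x\<bar> \<le> \<theta> * C * (1 + weight x)" using assms(2)[of x] assms(3) by (simp add: mult_left_mono mult.assoc)
  also have "\<dots> \<le> K * (1 + weight x)" using assms(4) weight_nonneg[of x] by (intro mult_right_mono) auto
  finally show "\<theta> * \<bar>f x\<bar> \<le> K * (1 + weight x)" .
qed

text \<open>\<open>osc_le\<close> ignores the constant \<open>l' - l\<close>, so the contraction
  turns any bound on the span of \<open>g - f\<close> into a smaller bound on the same span.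
  Iteration makes the span zero, and the shift rule then identifies the eigenvalues.\<close>

lemma bellman_unique:
  assumes \<theta>: "0 < \<theta>"
    and f: "continuous_on UNIV f" "\<And>x. \<bar>f x\<bar> \<le> C * (1 + weight x)" "\<And>x. bellman_op \<theta> f x = f x + l"
    and g: "continuous_on UNIV g" "\<And>x. \<bar>g x\<bar> \<le> C' * (1 + weight x)" "\<And>x. bellman_op \<theta> g x = g x + l'"
  shows "l' = l \<and> (\<exists>c. \<forall>x. g x = f x + c)"
proof -
  define K where "K = max \<theta> (max (\<theta> * C) (\<theta> * C'))"
  have K: "0 \<le> K" "\<theta> \<le> K" "\<theta> * C \<le> K" "\<theta> * C' \<le> K" using \<theta> by (auto simp: K_def)
  have gc: "growth_class K \<theta> f" "growth_class K \<theta> g"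
    using growth_classI[OF f(1,2) \<theta> K(3)] growth_classI[OF g(1,2) \<theta> K(4)] .
  obtain \<beta> \<alpha> where ab: "\<beta> > 0" "\<alpha> > 0" "\<beta> \<le> 1" "\<alpha> < 1" and contr: "\<And>s. 0 \<le> s \<Longrightarrow> osc_le \<beta> s (\<lambda>u. g u - f u) \<Longrightarrow>
    osc_le \<beta> (\<alpha> * s) (\<lambda>u. bellman_op \<theta> g u - bellman_op \<theta> f u)"
    using bellman_op_contraction[OF K(1)] \<theta> K(2) gc by blast
  define s where "s = (C + C') / \<beta>"
  have "\<bar>g x - f x\<bar> \<le> (C + C') * (1 + weight x)" for x
    using f(2)[of x] g(2)[of x] unfolding distrib_right[of C] by linarith
  from bounded_osc_le[OF this ab(1,3)] have s: "osc_le \<beta> s (\<lambda>u. g u - f u)" by (simp add: s_def)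
  have "0 \<le> C * (1 + weight undefined)" "0 \<le> C' * (1 + weight undefined)"
    using f(2) g(2) by (auto intro: order_trans[OF abs_ge_zero])
  then have "0 \<le> C" "0 \<le> C'" using weight_nonneg[of undefined] by (auto simp: zero_le_mult_iff)
  then have s0: "0 \<le> s" using ab by (simp add: s_def)
  have "osc_le \<beta> (\<alpha> ^ n * s) (\<lambda>u. g u - f u)" for n
  proof (induction n)
    case (Suc n)
    have "osc_le \<beta> (\<alpha> * (\<alpha> ^ n * s)) (\<lambda>u. bellman_op \<theta> g u - bellman_op \<theta> f u)"
      using Suc s0 ab by (intro contr) auto
    then have "osc_le \<beta> (\<alpha> * (\<alpha> ^ n * s)) (\<lambda>u. (g u - f u) + (l' - l))"
      by (simp add: f(3) g(3) algebra_simps)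
    then show ?case by (simp only: osc_le_shift power_Suc mult.assoc)
  qed (use s in simp)
  moreover have "(\<lambda>n. \<alpha> ^ n * s) \<longlonglongrightarrow> 0"
    using ab by (intro tendsto_mult_left_zero LIMSEQ_realpow_zero) auto
  ultimately have const: "g x - f x = g undefined - f undefined" for x by (rule osc_le_limit_const)
  define c where "c = g undefined - f undefined"
  have gf: "g x = f x + c" for x using const[of x] by (simp add: c_def)
  then have g_eq: "g = (\<lambda>x. f x + c)" by auto
  have "bellman_op \<theta> g undefined = bellman_op \<theta> f undefined + c"
  proof -
    have obj: "objective \<theta> g x h = objective \<theta> f x h + c" if "h \<in> U" for x h
      unfolding g_eq using objective_shift[OF \<theta> gc(1) _ that] gc(2) unfolding g_eq by blast
    obtain h where h: "h \<in> U" "bellman_op \<theta> g undefined = objective \<theta> g undefined h"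
      using objective_attains(1)[OF \<theta> K(2) gc(2)] by blast
    obtain h' where h': "h' \<in> U" "bellman_op \<theta> f undefined = objective \<theta> f undefined h'"
      using objective_attains(1)[OF \<theta> K(2) gc(1)] by blast
    show ?thesis using obj[OF h(1), of undefined] obj[OF h'(1), of undefined] h(2) h'(2)
      objective_attains(2)[OF \<theta> K(2) gc(2) h'(1), of undefined] objective_attains(2)[OF \<theta> K(2) gc(1) h(1), of undefined]
      by linarith
  qed
  then have "l' = l" using f(3) g(3) gf by simp
  then show ?thesis using gf by blast
qed

text \<open>For small \<open>\<theta>\<close> the contraction rate is uniform over the ball of radius \<open>M\<close>, which is therefore
  invariant, and the normalised value iteration \<open>u\<close> started at \<open>0\<close> converges.\<close>

lemma bellman_exists:
  "\<exists>\<theta>0>0. \<forall>\<theta>. 0 < \<theta> \<longrightarrow> \<theta> < \<theta>0 \<longrightarrow> (\<exists>f l C. continuous_on UNIV f \<and>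
    (\<forall>x. \<bar>f x\<bar> \<le> C * (1 + weight x)) \<and> (\<forall>x. bellman_op \<theta> f x = f x + l))"
proof -
  obtain \<beta> \<alpha> where ab: "\<beta> > 0" "\<alpha> > 0" "\<beta> \<le> 1" "\<alpha> < 1"
    and contr: "\<And>\<theta> f g s. 0 < \<theta> \<Longrightarrow> \<theta> \<le> 1 \<Longrightarrow> growth_class 1 \<theta> f \<Longrightarrow> growth_class 1 \<theta> g \<Longrightarrow> 0 \<le> s \<Longrightarrow>
      osc_le \<beta> s (\<lambda>u. f u - g u) \<Longrightarrow> osc_le \<beta> (\<alpha> * s) (\<lambda>u. bellman_op \<theta> f u - bellman_op \<theta> g u)"
    using bellman_op_contraction[of 1] by auto
  obtain C0 where C0: "C0 \<ge> 0" "\<And>\<theta> x. 0 < \<theta> \<Longrightarrow> \<theta> \<le> 1 \<Longrightarrow> \<bar>bellman_op \<theta> (\<lambda>_. 0) x\<bar> \<le> C0 * (1 + weight x)"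
    using bellman_op_zero_bound by blast
  define s0 where "s0 = C0 / \<beta>"
  \<comment> \<open>The fixed point of \<open>M \<mapsto> \<alpha> * M + s0\<close>: contraction
    around the image of 0 maps the ball of radius \<open>M\<close> into itself. It is also the sum
    of all step sizes of the iteration.\<close>
  define M where "M = s0 / (1 - \<alpha>)"
  \<comment> \<open>Together with \<open>f 0 = 0\<close>, the span bound \<open>M\<close> gives the
    pointwise bound \<open>D * (1 + weight x)\<close>. \<open>D\<close> is fixed before \<theta>,
    and the threshold \<open>1 / (1 + D)\<close> ensures \<open>\<theta> \<le> 1\<close> and
    \<open>\<theta> * D \<le> 1\<close>.\<close>
  define D where "D = M * (2 + weight 0)"
  have nonneg: "0 \<le> s0" "0 \<le> M" "0 \<le> D" using ab C0 weight_nonneg by (auto simp: s0_def M_def D_def)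
  have M_eq: "\<alpha> * M + s0 = M" using ab by (simp add: M_def field_simps)
  have "\<exists>f l C. continuous_on UNIV f \<and> (\<forall>x. \<bar>f x\<bar> \<le> C * (1 + weight x)) \<and> (\<forall>x. bellman_op \<theta> f x = f x + l)"
    if \<theta>: "0 < \<theta>" "\<theta> < 1 / (1 + D)" for \<theta>
  proof -
    have "1 / (1 + D) \<le> 1" using nonneg by simp
    then have \<theta>1: "\<theta> \<le> 1" using \<theta> by linarith
    have "\<theta> * (1 + D) < 1" using \<theta> nonneg by (simp add: field_simps)
    then have \<theta>D: "\<theta> * D \<le> 1" using \<theta> by (simp add: distrib_left)
    define ball where "ball f \<longleftrightarrow> continuous_on UNIV f \<and> f 0 = 0 \<and> osc_le \<beta> M f" for f
    have ball_bound: "\<bar>f x\<bar> \<le> D * (1 + weight x)" if "f 0 = 0" "osc_le \<beta> M f" for f x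
    proof -
      have "\<bar>f x\<bar> \<le> M * (2 + \<beta> * weight x + \<beta> * weight 0)"
        using that(2)[unfolded osc_le_def, rule_format, of x 0] that(2)[unfolded osc_le_def, rule_format, of 0 x] that(1)
        by (simp add: abs_le_iff add_ac)
      also have "\<dots> \<le> M * ((2 + weight 0) * (1 + weight x))"
      proof (rule mult_left_mono)
        have "\<beta> * weight x \<le> weight x" "\<beta> * weight 0 \<le> weight 0"
          using ab weight_nonneg by (auto intro: mult_left_le_one_le)
        moreover have "0 \<le> weight 0 * weight x" using weight_nonneg by simp
        ultimately show "2 + \<beta> * weight x + \<beta> * weight 0 \<le> (2 + weight 0) * (1 + weight x)"
          using weight_nonneg[of x] by (simp add: algebra_simps)
      qed (use nonneg in auto)
      finally show ?thesis by (simp add: D_def mult.assoc)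
    qed
    have ball_gc: "growth_class 1 \<theta> f" if "ball f" for f
      using that ball_bound \<theta>(1) \<theta>D unfolding ball_def by (intro growth_classI[of f D]) auto
    \<comment> \<open>Subtracting the value at 0 stops the eigenvalue from accumulating along the
      iteration, and the span does not notice.\<close>
    define N where "N f x = bellman_op \<theta> f x - bellman_op \<theta> f 0" for f x
    have N_contr: "osc_le \<beta> (\<alpha> * s) (\<lambda>u. N f u - N g u)"
      if "ball f" "ball g" "0 \<le> s" "osc_le \<beta> s (\<lambda>u. f u - g u)" for f g s
    proof -
      have "osc_le \<beta> (\<alpha> * s) (\<lambda>u. (bellman_op \<theta> f u - bellman_op \<theta> g u) + (bellman_op \<theta> g 0 - bellman_op \<theta> f 0))"
        unfolding osc_le_shift using that ball_gc \<theta>(1) \<theta>1 by (intro contr) auto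
      then show ?thesis by (simp add: N_def algebra_simps)
    qed
    have ball0: "ball (\<lambda>_. 0)"
      using nonneg ab weight_nonneg by (auto simp: ball_def osc_le_def intro!: add_nonneg_nonneg mult_nonneg_nonneg)
    have N0: "osc_le \<beta> s0 (N (\<lambda>_. 0))"
    proof -
      have "osc_le \<beta> s0 (bellman_op \<theta> (\<lambda>_. 0))"
        unfolding s0_def using C0(2) \<theta>(1) \<theta>1 ab by (intro bounded_osc_le) auto
      then show ?thesis by (simp add: N_def osc_le_def)
    qed
    have ball_N: "ball (N f)" if "ball f" for f
      unfolding ball_def
    proof (intro conjI)
      show "continuous_on UNIV (N f)"
        unfolding N_def using bellman_op_continuous[OF \<theta>(1) \<theta>1 ball_gc[OF that]] by (intro continuous_intros)
      show "N f 0 = 0" by (simp add: N_def)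
      have "osc_le \<beta> (\<alpha> * M) (\<lambda>u. N f u - N (\<lambda>_. 0) u)"
        using that ball0 nonneg by (intro N_contr) (auto simp: ball_def)
      from osc_le_add[OF this N0] show "osc_le \<beta> M (N f)" by (simp add: M_eq)
    qed
    define u where "u n = (N ^^ n) (\<lambda>_. 0)" for n
    have u0: "u 0 = (\<lambda>_. 0)" and uSuc: "u (Suc n) = N (u n)" for n by (auto simp: u_def)
    have ball_u: "ball (u n)" for n by (induction n) (auto simp: u0 uSuc ball0 ball_N)
    have step: "osc_le \<beta> (\<alpha> ^ n * s0) (\<lambda>x. u (Suc n) x - u n x)" for n
    proof (induction n)
      case 0 show ?case using N0 by (simp add: u0 uSuc)
    next
      case (Suc n)
      have "osc_le \<beta> (\<alpha> * (\<alpha> ^ n * s0)) (\<lambda>x. N (u (Suc n)) x - N (u n) x)"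
        using ab nonneg by (intro N_contr ball_u Suc) auto
      then show ?case by (simp add: uSuc mult.assoc)
    qed
    \<comment> \<open>The tail of the geometric series of step sizes from index \<open>n\<close>
      on.\<close>
    define t where "t n = s0 * \<alpha> ^ n / (1 - \<alpha>)" for n
    have t_Suc: "t n = t (Suc n) + \<alpha> ^ n * s0" for n using ab by (simp add: t_def field_simps)
    have t_nonneg: "0 \<le> t n" for n using ab nonneg by (simp add: t_def)
    have t_lim: "t \<longlonglongrightarrow> 0"
      unfolding t_def using ab by (intro tendsto_divide_zero tendsto_mult_right_zero LIMSEQ_realpow_zero) auto
    have tail: "osc_le \<beta> (t n - t (n + k)) (\<lambda>x. u (n + k) x - u n x)" for n k
    proof (induction k)
      case 0 show ?case by (simp add: osc_le_def)
    next
      case (Suc k)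
      from osc_le_add[OF Suc step[of "n + k"]] show ?case using t_Suc[of "n + k"] by (simp add: algebra_simps)
    qed
    define B where "B x = 2 + \<beta> * weight x + \<beta> * weight 0" for x
    define d where "d n x = u (Suc n) x - u n x" for n x
    have d_bound: "\<bar>d n x\<bar> \<le> \<alpha> ^ n * (s0 * B x)" for n x
    proof -
      have "d n 0 = 0" using ball_u by (auto simp: d_def ball_def)
      then show ?thesis
        using step[of n, unfolded osc_le_def, rule_format, of x 0] step[of n, unfolded osc_le_def, rule_format, of 0 x]
        by (simp add: d_def B_def abs_le_iff algebra_simps)
    qed
    have sum_d: "(\<Sum>i<n. d i x) = u n x" for n x by (induction n) (auto simp: u0 d_def)
    define f where "f x = (\<Sum>n. d n x)" for x
    have summable: "summable (\<lambda>n. d n x)" for x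
    proof (rule summable_comparison_test)
      show "\<exists>N. \<forall>n\<ge>N. norm (d n x) \<le> \<alpha> ^ n * (s0 * B x)" using d_bound by auto
      show "summable (\<lambda>n. \<alpha> ^ n * (s0 * B x))" using ab by (intro summable_mult2 summable_geometric) auto
    qed
    have u_lim: "(\<lambda>n. u n x) \<longlonglongrightarrow> f x" for x
      using summable_LIMSEQ[OF summable[of x]] unfolding sum_d f_def .
    \<comment> \<open>The increments are summable uniformly only where the weight is bounded. The
      open sublevel sets cover the space, which suffices for continuity.\<close>
    have cont_R: "continuous_on {x. weight x < R} f" for R
    proof (rule uniform_limit_theorem)
      show "uniform_limit {x. weight x < R} (\<lambda>n x. \<Sum>i<n. d i x) f sequentially"
        unfolding f_def[abs_def]
      proof (rule Weierstrass_m_test[where M = "\<lambda>n. \<alpha> ^ n * (s0 * (2 + \<beta> * R + \<beta> * weight 0))"])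
        fix n x assume "x \<in> {x. weight x < R}"
        then have "s0 * B x \<le> s0 * (2 + \<beta> * R + \<beta> * weight 0)" using ab nonneg unfolding B_def by (intro mult_left_mono) auto
        then show "norm (d n x) \<le> \<alpha> ^ n * (s0 * (2 + \<beta> * R + \<beta> * weight 0))"
          using order_trans[OF d_bound[of n x] mult_left_mono[of _ _ "\<alpha> ^ n"]] ab by simp
      next
        show "summable (\<lambda>n. \<alpha> ^ n * (s0 * (2 + \<beta> * R + \<beta> * weight 0)))" 
          using ab by (intro summable_mult2 summable_geometric) auto
      qed
      show "\<forall>\<^sub>F n in sequentially. continuous_on {x. weight x < R} (\<lambda>x. \<Sum>i<n. d i x)"
        unfolding sum_d using ball_u unfolding ball_def
        by (intro always_eventually allI) (metis continuous_on_subset subset_UNIV)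
    qed auto
    have open_R: "open {x. weight x < R}" for R
      using open_Collect_less[OF weight_continuous continuous_on_const] .
    have cont_f: "continuous_on UNIV f"
    proof -
      have "isCont f x" for x
        using cont_R[of "weight x + 1"] open_R[of "weight x + 1"] by (simp add: continuous_on_eq_continuous_at)
      then show ?thesis by (simp add: continuous_on_eq_continuous_at)
    qed
    have f_u: "osc_le \<beta> (t n) (\<lambda>x. f x - u n x)" for n
      unfolding osc_le_def
    proof (intro allI)
      fix x y
      have lim: "(\<lambda>k. u (n + k) x - u n x - (u (n + k) y - u n y)) \<longlonglongrightarrow> f x - u n x - (f y - u n y)"
        using u_lim[THEN LIMSEQ_ignore_initial_segment, of n] by (intro tendsto_intros) (auto simp: add_ac)
      have "osc_le \<beta> (t n) (\<lambda>x. u (n + k) x - u n x)" for k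
        using tail[of n k] t_nonneg[of "n + k"] ab by (auto intro: osc_le_mono)
      then show "f x - u n x - (f y - u n y) \<le> t n * (2 + \<beta> * weight x + \<beta> * weight y)"
        by (intro LIMSEQ_le_const2[OF lim]) (auto simp: osc_le_def)
    qed
    have "f 0 = 0" using ball_u by (simp add: f_def d_def ball_def)
    moreover have "osc_le \<beta> M f" using f_u[of 0] by (simp add: u0 t_def M_def)
    ultimately have ball_f: "ball f" and f_bound: "\<And>x. \<bar>f x\<bar> \<le> D * (1 + weight x)"
      using cont_f ball_bound by (auto simp: ball_def)
    have "osc_le \<beta> (\<alpha> * t n + t (Suc n)) (\<lambda>x. N f x - f x)" for n
    proof -
      have "osc_le \<beta> (\<alpha> * t n) (\<lambda>x. N f x - u (Suc n) x)"
        unfolding uSuc by (intro N_contr ball_f ball_u t_nonneg f_u)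
      from osc_le_add[OF this osc_le_uminus[OF f_u[of "Suc n"]]] show ?thesis by simp
    qed
    moreover have "(\<lambda>n. \<alpha> * t n + t (Suc n)) \<longlonglongrightarrow> 0"
      using t_lim LIMSEQ_Suc[OF t_lim] by (intro tendsto_add_zero tendsto_mult_right_zero)
    ultimately have const: "N f x - f x = N f 0 - f 0" for x by (rule osc_le_limit_const)
    \<comment> \<open>The residual of \<open>N\<close> is constant and vanishes at 0, so the
      eigenvalue is the constant removed by the normalisation.\<close>
    have "bellman_op \<theta> f x = f x + bellman_op \<theta> f 0" for x
      using const[of x] \<open>f 0 = 0\<close> unfolding N_def by linarith
    then show ?thesis using cont_f f_bound by blast
  qed
  then show ?thesis using nonneg by (intro exI[of _ "1 / (1 + D)"]) auto
qed

text \<open>This removes the unbounded factor \<open>exp (- \<theta> f)\<close> from the estimate of the growth rate. With \<open>E\<close> the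
  fixed point of the drift bound, \<open>weight - E\<close> contracts by \<open>b\<close> under every tilted law, so by Jensen
  the exponents \<open>K b\<^sup>j (weight - E)\<close> are carried along without loss.\<close>

lemma lower_family:
  assumes \<theta>: "0 < \<theta>"
    and f: "continuous_on UNIV f" "\<And>x. \<bar>f x\<bar> \<le> C * (1 + weight x)" "\<And>x. bellman_op \<theta> f x = f x + l"
  shows "\<exists>\<psi>::nat \<Rightarrow> 'x \<Rightarrow> real. (\<forall>j. \<psi> j \<in> borel_measurable borel) \<and> (\<forall>j x. 0 \<le> \<psi> j x) \<and> (\<forall>x. \<psi> 0 x \<le> 1) \<and>
    (\<forall>x. \<exists>c>0. \<forall>j. c \<le> \<psi> j x) \<and>
    (\<forall>j x. \<forall>h\<in>U. ennreal (exp (- \<theta> * l) * \<psi> (Suc j) x) \<le> (\<integral>\<^sup>+w. ennreal (exp (- \<theta> * F x h w) * \<psi> j (G x w)) \<partial>P))"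
proof -
  define K where "K = max \<theta> (\<theta> * C)"
  have K: "0 \<le> K" "\<theta> \<le> K" using \<theta> by (auto simp: K_def)
  have gc: "growth_class K \<theta> f"
    by (rule growth_classI[OF f(1,2) \<theta>]) (simp add: K_def)
  note dom = energy_dominated[OF \<theta> K(2) gc]
  have [measurable]: "f \<in> borel_measurable borel" using gc by (rule growth_class_measurable)
  have K2: "0 \<le> K * (2 + b2)" using K b2 by simp
  obtain D b where D: "D \<ge> 0" and b: "0 < b" "b < 1"
    and drift: "\<And>x Y. affinely_dominated (K * (2 + b2)) (weight x) Y \<Longrightarrow> tilt Y (\<lambda>w. weight (G x w)) \<le> D + b * weight x"
    using tilt_weight_G_le[OF K2] by blast
  define E where "E = D / (1 - b)"
  have E: "E \<ge> 0" "D + b * E = E" using D b by (auto simp: E_def field_simps)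
  \<comment> \<open>Chosen so that the exponent of \<open>\<psi> 0\<close> is
    \<open>- \<theta> * f x - K * (1 + weight x)\<close>, which the growth bound makes
    nonpositive.\<close>
  define S where "S = K + K * E"
  have S: "0 \<le> S" using K E by (simp add: S_def)
  define \<psi> where "\<psi> j x = exp (- (\<theta> * f x) - S - K * b ^ j * (weight x - E))" for j x
  have [measurable]: "\<psi> j \<in> borel_measurable borel" for j unfolding \<psi>_def by measurable
  have "\<psi> 0 x \<le> 1" for x
  proof -
    have "\<theta> * - f x \<le> \<theta> * \<bar>f x\<bar>" using \<theta> by (intro mult_left_mono) auto
    also have "\<dots> \<le> K * (1 + weight x)" using gc by (auto simp: growth_class_def)
    finally show ?thesis by (simp add: \<psi>_def S_def algebra_simps)
  qed
  moreover have "\<exists>c>0. \<forall>j. c \<le> \<psi> j x" for x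
  \<comment> \<open>Independence of \<open>j\<close> matters because \<open>j\<close> will be the
    time horizon; it follows from \<open>b ^ j \<le> 1\<close> and \<open>E \<ge> 0\<close>.\<close>
  proof (intro exI[of _ "exp (- (\<theta> * f x) - S - K * weight x)"] conjI allI)
    fix j
    have "b ^ j * (weight x - E) \<le> b ^ j * weight x" using E b by (intro mult_left_mono) auto
    also have "\<dots> \<le> weight x" using b weight_nonneg[of x] by (intro mult_left_le_one_le) (auto simp: power_le_one)
    finally have "K * (b ^ j * (weight x - E)) \<le> K * weight x" using K by (intro mult_left_mono) auto
    then show "exp (- (\<theta> * f x) - S - K * weight x) \<le> \<psi> j x" by (simp add: \<psi>_def mult.assoc)
  qed auto
  moreover have "ennreal (exp (- \<theta> * l) * \<psi> (Suc j) x) \<le> (\<integral>\<^sup>+w. ennreal (exp (- \<theta> * F x h w) * \<psi> j (G x w)) \<partial>P)"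
    if h: "h \<in> U" for j x h
  proof -
    \<comment> \<open>The slope in the weight at index \<open>j\<close>. The tilted mean of
      \<open>weight - E\<close> is at most \<open>b\<close> times its current value, which turns the
      slope into \<open>r * b\<close>, the one at index \<open>Suc j\<close>.\<close>
    define r where "r = K * b ^ j"
    have r: "0 \<le> r" using K b by (simp add: r_def)
    define g where "g w = - S - r * (weight (G x w) - E)" for w
    let ?Y = "energy \<theta> f x h"
    note Y = dom[OF h, of x]
    have tg: "tame g" unfolding g_def by (intro tame_diff tame_const tame_cmult tame_weight_G)
    have teg: "tame (\<lambda>w. exp (g w))"
    proof (rule tame_bounded[OF _ _ tame_const])
      show "(\<lambda>w. exp (g w)) \<in> borel_measurable P" using tame_measurable[OF tg] by measurable
      show "\<bar>exp (g w)\<bar> \<le> exp (r * E)" for w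
        using S r mult_nonneg_nonneg[OF r weight_nonneg[of "G x w"]] by (simp add: g_def algebra_simps)
    qed
    \<comment> \<open>The factor \<open>exp (- \<theta> * f)\<close> inside \<psi> completes the
      payoff to the unnormalised tilted density.\<close>
    have eq: "exp (- \<theta> * F x h w) * \<psi> j (G x w) = exp (g w) * exp (- ?Y w)" for w
      by (simp add: \<psi>_def g_def r_def energy_def algebra_simps flip: exp_add)
    have "exp (- \<theta> * l) * \<psi> (Suc j) x = exp (- \<theta> * (f x + l)) * exp (- S - r * b * (weight x - E))"
      by (simp add: \<psi>_def r_def algebra_simps flip: exp_add)
    also have "\<dots> \<le> exp (- \<theta> * objective \<theta> f x h) * exp (tilt ?Y g)"
    proof (intro mult_mono)
      show "exp (- \<theta> * (f x + l)) \<le> exp (- \<theta> * objective \<theta> f x h)"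
        using objective_attains(2)[OF \<theta> K(2) gc h, of x] f(3)[of x] \<theta> by simp
      have "tilt ?Y g = - S - r * (tilt ?Y (\<lambda>w. weight (G x w)) - E)"
        unfolding g_def by (simp add: tilt_diff[OF Y] tilt_cmult tame_diff tame_const tame_cmult tame_weight_G tilt_const[OF Y])
      moreover have "r * (tilt ?Y (\<lambda>w. weight (G x w)) - E) \<le> r * (b * (weight x - E))"
      proof (rule mult_left_mono[OF _ r])
        show "tilt ?Y (\<lambda>w. weight (G x w)) - E \<le> b * (weight x - E)"
          using drift[OF Y] E(2) by (simp add: algebra_simps)
      qed
      ultimately show "exp (- S - r * b * (weight x - E)) \<le> exp (tilt ?Y g)" by (simp add: mult.assoc)
    qed auto
    also have "\<dots> \<le> exp (- \<theta> * objective \<theta> f x h) * tilt ?Y (\<lambda>w. exp (g w))"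
      by (intro mult_left_mono exp_tilt_le[OF Y tg teg]) auto
    also have "\<dots> = (\<integral>w. exp (g w) * exp (- ?Y w) \<partial>P)"
      unfolding integral_exp_mult[OF Y] exp_objective[OF \<theta> K(2) gc h] by simp
    finally show ?thesis
      unfolding eq by (subst nn_integral_eq_integral)
        (auto intro!: tame_integrable tame_mult teg affinely_dominated_exp_minus[OF Y] ennreal_leI)
  qed
  ultimately show ?thesis by (intro exI[of _ \<psi>]) (auto simp: \<psi>_def)
qed

end

section \<open>Measurable selection and independence\<close>

text \<open>Kuratowski and Ryll-Nardzewski's selection: \<open>path x\<close> lists the least indices of nested balls of
  radius \<open>2\<^sup>-\<^sup>n\<close> that still meet the set of maximisers; the centres converge to the selected one.\<close>

lemma measurable_argmax:
  fixes J :: "'x::euclidean_space \<Rightarrow> 'u::euclidean_space \<Rightarrow> real"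
  assumes U: "compact U" "U \<noteq> {}" and J: "continuous_on (UNIV \<times> U) (\<lambda>(x, h). J x h)"
  shows "\<exists>s\<in>borel_measurable borel. \<forall>x. s x \<in> U \<and> (\<forall>h\<in>U. J x h \<le> J x (s x))"
proof -
  define S where "S x = {h\<in>U. \<forall>h'\<in>U. J x h' \<le> J x h}" for x
  \<comment> \<open>The set of maximisers has a closed graph.\<close>
  have S_limit: "h \<in> S x" if xn: "xn \<longlonglongrightarrow> x" and hn: "hn \<longlonglongrightarrow> h" and S: "\<And>n::nat. hn n \<in> S (xn n)" for xn x hn h
  proof -
    have h: "h \<in> U"
      using S by (intro closed_sequentially[OF compact_imp_closed[OF U(1)] _ hn]) (simp add: S_def)
    have lim: "(\<lambda>n. J (xn n) (kn n)) \<longlonglongrightarrow> J x k" if "kn \<longlonglongrightarrow> k" "k \<in> U" "\<And>n. kn n \<in> U" for kn k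
      using continuous_on_tendsto_compose[OF J tendsto_Pair[OF xn that(1)]] that by (simp add: case_prod_beta)
    have "J x h' \<le> J x h" if "h' \<in> U" for h'
    proof (rule LIMSEQ_le[OF lim[of "\<lambda>_. h'"] lim[OF hn h]])
      show "hn n \<in> U" for n using S[of n] by (simp add: S_def)
      show "\<exists>N. \<forall>n\<ge>N. J (xn n) h' \<le> J (xn n) (hn n)" using S that by (auto simp: S_def)
    qed (use that in auto)
    then show ?thesis using h by (simp add: S_def)
  qed
  have S_nonempty: "S x \<noteq> {}" for x
  proof -
    have "continuous_on U (\<lambda>h. J x h)"
      using continuous_on_compose2[OF J continuous_on_Pair[OF continuous_on_const[of U x] continuous_on_id]] by auto
    from continuous_attains_sup[OF U this] show ?thesis by (auto simp: S_def)
  qed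
  \<comment> \<open>These sets are even closed: maximisers lie in the compact \<open>U\<close>, so a
    subsequence converges, and the graph is closed.\<close>
  have hit_measurable: "{x. S x \<inter> C \<noteq> {}} \<in> sets borel" if C: "closed C" for C
  proof (rule borel_closed, unfold closed_sequential_limits, safe)
    fix xn x assume xn: "\<forall>n. xn n \<in> {x. S x \<inter> C \<noteq> {}}" "xn \<longlonglongrightarrow> x" and empty: "S x \<inter> C = {}"
    then have "\<forall>n. \<exists>h. h \<in> S (xn n) \<inter> C" by blast
    then obtain hn where hn: "\<And>n. hn n \<in> S (xn n)" "\<And>n. hn n \<in> C" by (metis IntE)
    have "\<forall>n. hn n \<in> U" using hn(1) by (auto simp: S_def)
    then obtain h r where r: "strict_mono (r :: nat \<Rightarrow> nat)" "(hn \<circ> r) \<longlonglongrightarrow> h"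
      using U(1) unfolding compact_def by metis
    have "h \<in> S x"
      using hn(1) by (intro S_limit[OF LIMSEQ_subseq_LIMSEQ[OF xn(2) r(1)] r(2)]) auto
    moreover have "h \<in> C" using hn(2) by (intro closed_sequentially[OF C _ r(2)]) auto
    ultimately show False using empty by blast
  qed
  obtain D :: "'u set" where D: "countable D" "\<And>X. open X \<Longrightarrow> X \<noteq> {} \<Longrightarrow> \<exists>d\<in>D. d \<in> X"
    by (rule countable_dense_setE) blast
  have "D \<noteq> {}" using D(2)[of UNIV] by auto
  define d where "d = from_nat_into D"
  have dense: "\<exists>i. h \<in> cball (d i) e" if "0 < e" for h e
  proof -
    obtain y where "y \<in> D" "y \<in> ball h e" using D(2)[of "ball h e"] \<open>0 < e\<close> by auto
    then show ?thesis
      using from_nat_into_surj[OF D(1), of y] by (auto simp: d_def dist_commute intro: less_imp_le)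
  qed
  \<comment> \<open>The newest index is the head of the list, so the length of the tail determines
    the radius of the next ball.\<close>
  define C where "C = rec_list UNIV (\<lambda>i p Cp. Cp \<inter> cball (d i) ((1/2) ^ length p))"
  have C_Nil: "C [] = UNIV" and C_Cons: "C (i # p) = C p \<inter> cball (d i) ((1/2) ^ length p)" for i p
    by (simp_all add: C_def)
  have closed_C: "closed (C p)" for p by (induction p) (auto simp: C_Nil C_Cons)
  define path where "path x = rec_nat [] (\<lambda>_ p. (LEAST i. S x \<inter> C (i # p) \<noteq> {}) # p)" for x
  have path_0: "path x 0 = []"
    and path_Suc: "path x (Suc n) = (LEAST i. S x \<inter> C (i # path x n) \<noteq> {}) # path x n" for x n
    by (simp_all add: path_def)
  have length_path: "length (path x n) = n" for x n by (induction n) (simp_all add: path_0 path_Suc)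
  have hit: "S x \<inter> C (path x n) \<noteq> {}" for x n
  proof (induction n)
    case 0 show ?case using S_nonempty by (simp add: path_0 C_Nil)
  next
    case (Suc n)
    then obtain h where h: "h \<in> S x" "h \<in> C (path x n)" by blast
    obtain i where "h \<in> cball (d i) ((1/2) ^ length (path x n))" using dense[of "(1/2) ^ length (path x n)" h] by auto
    then have "S x \<inter> C (i # path x n) \<noteq> {}" using h by (auto simp: C_Cons)
    then show ?case unfolding path_Suc by (rule LeastI)
  qed
  have path_measurable: "(\<lambda>x. path x n) \<in> borel \<rightarrow>\<^sub>M count_space UNIV" for n
  proof (induction n)
    case 0 show ?case by (simp add: path_0)
  next
    case (Suc n)
    \<comment> \<open>There are countably many lists, so the next choice may be examined with the
      prefix \<open>p\<close> held fixed.\<close>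
    have "(\<lambda>x. (LEAST i. S x \<inter> C (i # p) \<noteq> {}) # p) \<in> borel \<rightarrow>\<^sub>M count_space UNIV" for p
    proof -
      have [measurable]: "Measurable.pred borel (\<lambda>x. S x \<inter> C (i # p) \<noteq> {})" for i
        using hit_measurable[OF closed_C, of "i # p"] by (simp add: Measurable.pred_def)
      show ?thesis by (rule measurable_compose[OF measurable_Least]) auto
    qed
    from measurable_compose_countable[OF this Suc] show ?case by (simp add: path_Suc)
  qed
  have "\<exists>h. h \<in> S x \<and> (\<lambda>n. d (hd (path x (Suc n)))) \<longlonglongrightarrow> h" for x
  proof -
    have "\<exists>h. h \<in> (\<Inter>n. U \<inter> C (path x n))"
    proof -
      have dec: "m \<le> n \<Longrightarrow> U \<inter> C (path x n) \<subseteq> U \<inter> C (path x m)" for m n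
        by (induction n rule: dec_induct) (auto simp: path_Suc C_Cons)
      have "\<Inter>(range (\<lambda>n. U \<inter> C (path x n))) \<noteq> {}"
      proof (rule compact_nest[OF _ _ dec])
        show "compact (U \<inter> C (path x n))" for n using U(1) closed_C by (rule compact_Int_closed)
        show "U \<inter> C (path x n) \<noteq> {}" for n using hit[of x n] by (auto simp: S_def)
      qed
      then show ?thesis by blast
    qed
    then obtain h where h: "\<And>n. h \<in> C (path x n)" by blast
    have near: "k \<in> C (path x (Suc n)) \<Longrightarrow> dist (d (hd (path x (Suc n)))) k \<le> (1/2) ^ n" for k n
      by (simp add: path_Suc C_Cons length_path)
    have pow: "(\<lambda>n. (1/2) ^ n) \<longlonglongrightarrow> (0::real)" by (intro LIMSEQ_realpow_zero) auto
    have d_lim: "(\<lambda>n. d (hd (path x (Suc n)))) \<longlonglongrightarrow> h"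
      using near[OF h] by (intro metric_LIMSEQ_I metric_tendsto_imp_tendsto[OF pow, THEN metric_LIMSEQ_D]) auto
    \<comment> \<open>The nested compact sets yield a limit in \<open>U\<close>, not yet a
      maximiser. Maximisers \<open>k n\<close> from the same balls have the same limit, and the
      closed graph applies to them.\<close>
    have "\<forall>n. \<exists>k. k \<in> S x \<and> k \<in> C (path x (Suc n))" using hit by blast
    then obtain k where k: "\<And>n. k n \<in> S x" "\<And>n. k n \<in> C (path x (Suc n))" by metis
    have "(\<lambda>n. dist (d (hd (path x (Suc n)))) (k n)) \<longlonglongrightarrow> 0"
      using near[OF k(2)] by (intro tendsto_sandwich[OF _ _ tendsto_const pow]) auto
    then have "(\<lambda>n. d (hd (path x (Suc n))) - k n) \<longlonglongrightarrow> 0"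
      by (simp add: dist_norm tendsto_norm_zero_iff)
    from tendsto_diff[OF d_lim this] have "k \<longlonglongrightarrow> h" by simp
    then show ?thesis using d_lim S_limit[OF tendsto_const, of k h x] k(1) by blast
  qed
  then obtain s where s: "\<And>x. s x \<in> S x" "\<And>x. (\<lambda>n. d (hd (path x (Suc n)))) \<longlonglongrightarrow> s x" by metis
  have "s \<in> borel_measurable borel"
  proof (rule borel_measurable_LIMSEQ_metric[OF _ s(2)])
    show "(\<lambda>x. d (hd (path x (Suc n)))) \<in> borel_measurable borel" for n
      by (rule measurable_compose[OF path_measurable]) auto
  qed
  then show ?thesis using s(1) by (intro bexI[of _ s]) (auto simp: S_def)
qed

text \<open>The joint law of \<open>Y\<close> and \<open>W\<close> agrees with the product of the
  marginals on rectangles, hence everywhere. Fubini then freezes \<open>Y\<close> while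
  \<open>W\<close> is integrated out.\<close>

lemma (in prob_space) nn_integral_indep:
  assumes indep: "indep_set (sets N) {W -` A \<inter> space M | A. A \<in> sets S}" and N: "subalgebra M N"
    and Y: "Y \<in> N \<rightarrow>\<^sub>M T" and W [measurable]: "W \<in> M \<rightarrow>\<^sub>M S" and f [measurable]: "f \<in> borel_measurable (T \<Otimes>\<^sub>M S)"
  shows "(\<integral>\<^sup>+ \<omega>. f (Y \<omega>, W \<omega>) \<partial>M) = (\<integral>\<^sup>+ \<omega>. \<integral>\<^sup>+ w. f (Y \<omega>, w) \<partial>distr M S W \<partial>M)"
proof -
  have Y' [measurable]: "Y \<in> M \<rightarrow>\<^sub>M T" using measurable_from_subalg[OF N Y] .
  interpret W: prob_space "distr M S W" by (rule prob_space_distr) fact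
  have spN: "space N = space M" using N by (simp add: subalgebra_def)
  interpret Y: prob_space "distr M T Y" by (rule prob_space_distr) fact
  have eq: "distr M T Y \<Otimes>\<^sub>M distr M S W = distr M (T \<Otimes>\<^sub>M S) (\<lambda>\<omega>. (Y \<omega>, W \<omega>))"
  proof (rule pair_measure_eqI)
    show "sigma_finite_measure (distr M T Y)" "sigma_finite_measure (distr M S W)" by unfold_locales
    show "sets (distr M T Y \<Otimes>\<^sub>M distr M S W) = sets (distr M (T \<Otimes>\<^sub>M S) (\<lambda>\<omega>. (Y \<omega>, W \<omega>)))"
      by (simp cong: sets_pair_measure_cong)
    fix A B assume "A \<in> sets (distr M T Y)" "B \<in> sets (distr M S W)"
    then have AB [measurable]: "A \<in> sets T" "B \<in> sets S" by auto
    have "prob ((Y -` A \<inter> space M) \<inter> (W -` B \<inter> space M)) = prob (Y -` A \<inter> space M) * prob (W -` B \<inter> space M)"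
      using AB measurable_sets[OF Y AB(1)] by (intro indep_setD[OF indep]) (auto simp: spN)
    moreover have "(\<lambda>\<omega>. (Y \<omega>, W \<omega>)) -` (A \<times> B) \<inter> space M = (Y -` A \<inter> space M) \<inter> (W -` B \<inter> space M)" by auto
    ultimately show "emeasure (distr M T Y) A * emeasure (distr M S W) B = emeasure (distr M (T \<Otimes>\<^sub>M S) (\<lambda>\<omega>. (Y \<omega>, W \<omega>))) (A \<times> B)"
      by (simp add: emeasure_distr emeasure_eq_measure ennreal_mult)
  qed
  have [measurable]: "f \<in> borel_measurable (T \<Otimes>\<^sub>M distr M S W)" "f \<in> borel_measurable (distr M T Y \<Otimes>\<^sub>M distr M S W)"
    using f by (simp_all cong: measurable_cong_sets)
  have "(\<integral>\<^sup>+ \<omega>. f (Y \<omega>, W \<omega>) \<partial>M) = integral\<^sup>N (distr M (T \<Otimes>\<^sub>M S) (\<lambda>\<omega>. (Y \<omega>, W \<omega>))) f"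
    by (simp add: nn_integral_distr)
  also have "\<dots> = (\<integral>\<^sup>+ y. \<integral>\<^sup>+ w. f (y, w) \<partial>distr M S W \<partial>distr M T Y)"
    unfolding eq[symmetric] by (subst W.nn_integral_fst) auto
  also have "\<dots> = (\<integral>\<^sup>+ \<omega>. \<integral>\<^sup>+ w. f (Y \<omega>, w) \<partial>distr M S W \<partial>M)"
    by (rule nn_integral_distr) (auto intro: W.borel_measurable_nn_integral_fst)
  finally show ?thesis .
qed

lemma ln_ennreal_mono: "x \<le> y \<Longrightarrow> ln_ennreal x \<le> ln_ennreal y"
  unfolding ln_ennreal_def
  by (cases x; cases y) (auto simp: top_unique ennreal_eq_0_iff ennreal_le_iff)

lemma ln_ennreal_ennreal: "0 < x \<Longrightarrow> ln_ennreal (ennreal x) = ereal (ln x)"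
  by (simp add: ln_ennreal_def)

section \<open>The controlled market\<close>

lemma (in prob_space) exp_sum_integrable:
  fixes Z1 Z2 :: "'a \<Rightarrow> real"
  assumes [measurable]: "Z1 \<in> borel_measurable M" "Z2 \<in> borel_measurable M"
    and nonneg: "\<And>\<omega>. 0 \<le> Z1 \<omega>" "\<And>\<omega>. 0 \<le> Z2 \<omega>"
    and fin: "\<And>\<gamma>. \<bar>entropic M \<gamma> Z1\<bar> \<noteq> \<infinity>" "\<And>\<gamma>. \<bar>entropic M \<gamma> Z2\<bar> \<noteq> \<infinity>"
  shows "integrable M (\<lambda>\<omega>. exp (s * (Z1 \<omega> + Z2 \<omega>)))"
proof -
  \<comment> \<open>The factor 2 comes from \<open>Z1 + Z2 \<le> 2 * max Z1 Z2\<close>. The summand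
    1 covers \<open>s = 0\<close>, where \<open>entropic\<close> would be a mean without exponential
    information.\<close>
  define q where "q = 2 * \<bar>s\<bar> + 1"
  have q: "q > 0" by (simp add: q_def)
  have int: "integrable M (\<lambda>\<omega>. exp (q * Z \<omega>))" 
    if [measurable]: "Z \<in> borel_measurable M" and "\<bar>entropic M q Z\<bar> \<noteq> \<infinity>" for Z
  proof (rule integrableI_bounded)
    have "(\<integral>\<^sup>+ \<omega>. ennreal (exp (q * Z \<omega>)) \<partial>M) \<noteq> \<infinity>"
      using that(2) q by (auto simp: entropic_def ln_ennreal_def)
    then show "(\<integral>\<^sup>+ \<omega>. ennreal (norm (exp (q * Z \<omega>))) \<partial>M) < \<infinity>" by (simp add: less_top)
  qed measurable
  show ?thesis
  proof (rule Bochner_Integration.integrable_bound)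
    show "integrable M (\<lambda>\<omega>. exp (q * Z1 \<omega>) + exp (q * Z2 \<omega>))"
      using int[OF _ fin(1)] int[OF _ fin(2)] by simp
    show "AE \<omega> in M. norm (exp (s * (Z1 \<omega> + Z2 \<omega>))) \<le> norm (exp (q * Z1 \<omega>) + exp (q * Z2 \<omega>))"
    proof (rule AE_I2)
      fix \<omega>
      let ?m = "max (Z1 \<omega>) (Z2 \<omega>)"
      have "s * (Z1 \<omega> + Z2 \<omega>) \<le> \<bar>s\<bar> * (?m + ?m)"
        using nonneg[of \<omega>] by (intro mult_mono add_mono) auto
      also have "\<dots> \<le> q * ?m" using nonneg[of \<omega>] by (auto simp: q_def algebra_simps max_def)
      finally have "exp (s * (Z1 \<omega> + Z2 \<omega>)) \<le> exp (q * ?m)" by simp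
      also have "\<dots> \<le> exp (q * Z1 \<omega>) + exp (q * Z2 \<omega>)" by (auto simp: max_def)
      finally show "norm (exp (s * (Z1 \<omega> + Z2 \<omega>))) \<le> norm (exp (q * Z1 \<omega>) + exp (q * Z2 \<omega>))" by simp
    qed
  qed measurable
qed

locale controlled_market = noise M Fil W
  for M :: "'a measure" and Fil :: "nat \<Rightarrow> 'a measure" and W :: "nat \<Rightarrow> 'a \<Rightarrow> real ^ 'd" +
  fixes U :: "(real ^ 'm) set"
    and G :: "real ^ 'k \<Rightarrow> real ^ 'd \<Rightarrow> real ^ 'k"
    and F :: "real ^ 'k \<Rightarrow> real ^ 'm \<Rightarrow> real ^ 'd \<Rightarrow> real"
    and x0 :: "real ^ 'k"
    and X :: "nat \<Rightarrow> 'a \<Rightarrow> real ^ 'k"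
    and V0 :: real
    and V :: "(nat \<Rightarrow> 'a \<Rightarrow> real ^ 'm) \<Rightarrow> nat \<Rightarrow> 'a \<Rightarrow> real"
    and a1 a2 :: "real ^ 'd \<Rightarrow> real"
    and b1 b2 :: real
    and weight :: "real ^ 'k \<Rightarrow> real"
  assumes U: "U \<noteq> {}" "compact U"
    and factors: "factors M W G x0 X"
    and portfolio: "portfolio M Fil W U X F V0 V"
    and growth: "growth M (W 0) U G F a1 a2 b1 b2 weight"
    and minorization: "minorization M (W 0) G weight"
begin

lemma W_measurable [measurable]: "W t \<in> M \<rightarrow>\<^sub>M borel"
  using W_indep by (auto simp: indep_vars_def)

lemma space_Fil: "space (Fil t) = space M"
  using Fil_subalgebra[of t] by (simp add: subalgebra_def)

lemma W_adapted: "W t \<in> Fil (Suc t) \<rightarrow>\<^sub>M borel"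
proof (rule measurableI)
  fix A :: "(real ^ 'd) set" assume "A \<in> sets borel"
  then have "W t -` A \<inter> space M \<in> sets (Fil (Suc t))"
    unfolding Fil_eq by (intro sigma_sets.Basic) blast
  then show "W t -` A \<inter> space (Fil (Suc t)) \<in> sets (Fil (Suc t))" by (simp add: space_Fil)
qed auto

lemma Fil_Suc: "f \<in> Fil t \<rightarrow>\<^sub>M N \<Longrightarrow> f \<in> Fil (Suc t) \<rightarrow>\<^sub>M N"
  by (rule measurable_from_subalg[of "Fil (Suc t)" "Fil t"])
    (auto simp: subalgebra_def space_Fil intro: sets_F_mono[of t "Suc t", THEN subsetD])

definition P :: "(real ^ 'd) measure" where "P = distr M borel (W 0)"

lemma sets_P [measurable_cong]: "sets P = sets borel"
  by (simp add: P_def)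

lemma P_eq: "distr M borel (W t) = P" unfolding P_def by (rule W_identical)

text \<open>\<open>a1 + a2\<close> dominates the noise in both growth bounds, and its exponential
  moments follow from those of the summands.\<close>

sublocale kernel: controlled_kernel P "\<lambda>w. a1 w + a2 w" U G F weight b1 b2
proof -
  interpret P: prob_space P unfolding P_def by (rule prob_space_distr) measurable
  note g = growth[unfolded growth_def]
  have [measurable]: "a1 \<in> borel_measurable borel" "a2 \<in> borel_measurable borel" using g by auto
  show "controlled_kernel P (\<lambda>w. a1 w + a2 w) U G F weight b1 b2"
  proof (unfold_locales)
    show "(\<lambda>w. a1 w + a2 w) \<in> borel_measurable P" by measurable
    show "0 \<le> a1 w + a2 w" for w using g by simp
    show "integrable P (\<lambda>w. exp (s * (a1 w + a2 w)))" for s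
    proof -
      have "integrable M (\<lambda>\<omega>. exp (s * (a1 (W 0 \<omega>) + a2 (W 0 \<omega>))))"
        by (rule exp_sum_integrable) (use g in simp_all)
      then show ?thesis unfolding P_def by (subst integrable_distr_eq) simp_all
    qed
    show "case_prod G \<in> borel \<Otimes>\<^sub>M P \<rightarrow>\<^sub>M borel"
      using factors unfolding factors_def by (simp cong: measurable_cong_sets add: sets_P)
    have "(\<lambda>(x, h, w). F x h w) \<in> borel \<Otimes>\<^sub>M (restrict_space borel U \<Otimes>\<^sub>M borel) \<rightarrow>\<^sub>M borel"
      using portfolio by (simp add: portfolio_def)
    moreover have sets_eq: "sets (borel \<Otimes>\<^sub>M (restrict_space borel U \<Otimes>\<^sub>M P)) = sets (borel \<Otimes>\<^sub>M (restrict_space borel U \<Otimes>\<^sub>M borel))"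
      by (intro sets_pair_measure_cong sets_P refl)
    ultimately show "(\<lambda>(x, h, w). F x h w) \<in> borel \<Otimes>\<^sub>M (restrict_space borel U \<Otimes>\<^sub>M P) \<rightarrow>\<^sub>M borel"
      unfolding measurable_cong_sets[OF sets_eq refl] by simp
    show "continuous_on UNIV (\<lambda>x. G x w)" for w using factors by (simp add: factors_def)
    show "continuous_on (UNIV \<times> U) (\<lambda>(x, h). F x h w)" for w using portfolio by (simp add: portfolio_def)
    show "weight (G x w) \<le> a1 w + a2 w + b1 * weight x" for x w
    proof -
      have "weight (G x w) \<le> a1 w + b1 * weight x" "0 \<le> a2 w" using g by blast+
      then show ?thesis by simp
    qed
    show "\<bar>F x h w\<bar> \<le> a1 w + a2 w + b2 * weight x" if "h \<in> U" for x h w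
    proof -
      have "\<bar>F x h w\<bar> \<le> a2 w + b2 * weight x" "0 \<le> a1 w" using g that by blast+
      then show ?thesis by simp
    qed
    show "\<exists>c>0. \<exists>\<nu>. prob_space \<nu> \<and> sets \<nu> = sets borel \<and> (\<forall>x A. weight x \<le> R \<longrightarrow> A \<in> sets borel \<longrightarrow>
      ennreal c * emeasure \<nu> A \<le> emeasure (distr P borel (G x)) A)" if "0 < R" for R
    proof -
      obtain c and \<nu> :: "(real ^ 'k) measure" where c: "c > 0" and \<nu>: "prob_space \<nu>" "sets \<nu> = sets borel"
        and le: "\<And>A. A \<in> sets borel \<Longrightarrow> ennreal c * emeasure \<nu> A \<le>
          (INF x\<in>{x. weight x \<le> R}. emeasure M {\<omega>\<in>space M. G x (W 0 \<omega>) \<in> A})"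
        using minorization \<open>0 < R\<close> unfolding minorization_def by blast
      have G [measurable]: "G x \<in> borel \<rightarrow>\<^sub>M borel" for x
      proof -
        have "case_prod G \<in> borel \<Otimes>\<^sub>M borel \<rightarrow>\<^sub>M borel" using factors by (simp add: factors_def)
        from measurable_compose[OF measurable_Pair1' this, of x] show ?thesis by simp
      qed
      have "ennreal c * emeasure \<nu> A \<le> emeasure (distr P borel (G x)) A"
        if "weight x \<le> R" and [measurable]: "A \<in> sets borel" for x A
      proof -
        have "emeasure (distr P borel (G x)) A = emeasure M {\<omega>\<in>space M. G x (W 0 \<omega>) \<in> A}"
          unfolding P_def by (simp add: distr_distr emeasure_distr comp_def vimage_def Int_def conj_commute)
        then show ?thesis using le[of A] that by (auto simp: le_INF_iff)
      qed
      then show ?thesis using c \<nu> by blast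
    qed
  qed (use g U in auto)
qed

lemma nn_integral_P: "f \<in> borel_measurable borel \<Longrightarrow> (\<integral>\<^sup>+w. f w \<partial>P) = (\<integral>\<^sup>+\<omega>. f (W 0 \<omega>) \<partial>M)"
  unfolding P_def by (rule nn_integral_distr) measurable

lemma X_0: "\<omega> \<in> space M \<Longrightarrow> X 0 \<omega> = x0" and X_Suc: "\<omega> \<in> space M \<Longrightarrow> X (Suc t) \<omega> = G (X t \<omega>) (W t \<omega>)"
  using factors by (auto simp: factors_def)

lemma X_adapted: "X t \<in> Fil t \<rightarrow>\<^sub>M borel"
proof (induction t)
  case 0
  have "(\<lambda>_. x0) \<in> Fil 0 \<rightarrow>\<^sub>M borel" by simp
  then show ?case by (rule measurable_cong[THEN iffD2, rotated]) (simp add: space_Fil X_0)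
next
  case (Suc t)
  have "(\<lambda>\<omega>. case_prod G (X t \<omega>, W t \<omega>)) \<in> Fil (Suc t) \<rightarrow>\<^sub>M borel"
    using factors by (intro measurable_compose[OF measurable_Pair[OF Fil_Suc[OF Suc] W_adapted]]) (simp add: factors_def)
  then show ?case by (rule measurable_cong[THEN iffD2, rotated]) (simp add: space_Fil X_Suc)
qed

context
  fixes H assumes H: "H \<in> strategies Fil U"
begin

lemma H_adapted: "H t \<in> Fil t \<rightarrow>\<^sub>M restrict_space borel U"
  using H by (simp add: strategies_def)

lemma H_in_U: "\<omega> \<in> space M \<Longrightarrow> H t \<omega> \<in> U"
  using measurable_space[OF H_adapted, of \<omega> t] by (simp add: space_Fil space_restrict_space)

lemma V_0: "\<omega> \<in> space M \<Longrightarrow> V H 0 \<omega> = V0" and V0_pos: "0 < V0"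
  and V_pos: "\<omega> \<in> space M \<Longrightarrow> 0 < V H t \<omega>"
  using portfolio H by (auto simp: portfolio_def)

lemma V_Suc: 
  assumes "\<omega> \<in> space M" shows "V H (Suc t) \<omega> = V H t \<omega> * exp (F (X t \<omega>) (H t \<omega>) (W t \<omega>))"
proof -
  have "ln (V H (Suc t) \<omega> / V H t \<omega>) = F (X t \<omega>) (H t \<omega>) (W t \<omega>)"
    using portfolio H assms by (auto simp: portfolio_def)
  moreover have "0 < V H t \<omega>" "0 < V H (Suc t) \<omega>" using V_pos[OF assms] by auto
  ultimately have "exp (F (X t \<omega>) (H t \<omega>) (W t \<omega>)) = V H (Suc t) \<omega> / V H t \<omega>"
    by (metis divide_pos_pos exp_ln)
  then show ?thesis using \<open>0 < V H t \<omega>\<close> by simp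
qed

lemma F_process_measurable:
  assumes "f \<in> N \<rightarrow>\<^sub>M borel" "g \<in> N \<rightarrow>\<^sub>M restrict_space borel U" "k \<in> N \<rightarrow>\<^sub>M borel"
  shows "(\<lambda>z. F (f z) (g z) (k z)) \<in> borel_measurable N"
proof -
  have "(\<lambda>(x, h, w). F x h w) \<in> borel \<Otimes>\<^sub>M (restrict_space borel U \<Otimes>\<^sub>M borel) \<rightarrow>\<^sub>M borel"
    using portfolio by (simp add: portfolio_def)
  from measurable_compose[OF measurable_Pair[OF assms(1) measurable_Pair[OF assms(2,3)]] this]
  show ?thesis by simp
qed

lemma V_adapted: "V H t \<in> borel_measurable (Fil t)"
proof (induction t)
  case 0
  have "(\<lambda>_. V0) \<in> Fil 0 \<rightarrow>\<^sub>M borel" by simp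
  then show ?case by (rule measurable_cong[THEN iffD2, rotated]) (simp add: space_Fil V_0)
next
  case (Suc t)
  have "(\<lambda>\<omega>. V H t \<omega> * exp (F (X t \<omega>) (H t \<omega>) (W t \<omega>))) \<in> borel_measurable (Fil (Suc t))"
    by (intro borel_measurable_times Fil_Suc[OF Suc] borel_measurable_exp measurable_compose[OF _ borel_measurable_exp]
      F_process_measurable Fil_Suc[OF X_adapted] Fil_Suc[OF H_adapted] W_adapted)
  then show ?case by (rule measurable_cong[THEN iffD2, rotated]) (simp add: space_Fil V_Suc)
qed

text \<open>Conditioning on the past of \<open>t\<close>: value, factor and control are known, while
  \<open>W t\<close> is independent with law \<open>P\<close>.\<close>

lemma V_step:
  assumes [measurable]: "f \<in> borel_measurable borel" and f: "\<And>x. 0 \<le> f x"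
  shows "(\<integral>\<^sup>+\<omega>. ennreal (V H (Suc t) \<omega> powr - \<theta> * f (X (Suc t) \<omega>)) \<partial>M) =
    (\<integral>\<^sup>+\<omega>. ennreal (V H t \<omega> powr - \<theta>) * (\<integral>\<^sup>+w. ennreal (exp (- \<theta> * F (X t \<omega>) (H t \<omega>) w) * f (G (X t \<omega>) w)) \<partial>P) \<partial>M)"
proof -
  let ?N = "borel \<Otimes>\<^sub>M (borel \<Otimes>\<^sub>M restrict_space borel U) :: (real \<times> (real ^ 'k) \<times> (real ^ 'm)) measure"
  let ?f = "\<lambda>((v, x, h), w). ennreal (v powr - \<theta>) * ennreal (exp (- \<theta> * F x h w) * f (G x w))"
  \<comment> \<open>The control is carried as a separate coordinate, so strategies that depend on
    the whole past are covered.\<close>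
  let ?Y = "\<lambda>\<omega>. (V H t \<omega>, X t \<omega>, H t \<omega>)"
  have Y: "?Y \<in> Fil t \<rightarrow>\<^sub>M ?N" by (intro measurable_Pair V_adapted X_adapted H_adapted)
  have [measurable]: "(\<lambda>p. F (fst (snd (fst p))) (snd (snd (fst p))) (snd p)) \<in> borel_measurable (?N \<Otimes>\<^sub>M borel)"
    by (rule F_process_measurable) measurable
  have [measurable]: "(\<lambda>p. G (fst (snd (fst p))) (snd p)) \<in> ?N \<Otimes>\<^sub>M borel \<rightarrow>\<^sub>M borel"
  proof -
    have "(\<lambda>p. (fst (snd (fst p)), snd p)) \<in> ?N \<Otimes>\<^sub>M borel \<rightarrow>\<^sub>M borel \<Otimes>\<^sub>M (borel :: (real ^ 'd) measure)" by measurable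
    moreover have "case_prod G \<in> borel \<Otimes>\<^sub>M borel \<rightarrow>\<^sub>M borel" using factors by (simp add: factors_def)
    ultimately show ?thesis by (auto dest: measurable_compose)
  qed
  have f_meas: "?f \<in> borel_measurable (?N \<Otimes>\<^sub>M borel)"
    unfolding case_prod_beta by measurable
  have "(\<integral>\<^sup>+\<omega>. ennreal (V H (Suc t) \<omega> powr - \<theta> * f (X (Suc t) \<omega>)) \<partial>M) = (\<integral>\<^sup>+\<omega>. ?f (?Y \<omega>, W t \<omega>) \<partial>M)"
  proof (rule nn_integral_cong)
    fix \<omega> assume \<omega>: "\<omega> \<in> space M"
    have "V H (Suc t) \<omega> powr - \<theta> = V H t \<omega> powr - \<theta> * exp (- \<theta> * F (X t \<omega>) (H t \<omega>) (W t \<omega>))"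
      using V_pos[OF \<omega>, of t] by (simp add: V_Suc[OF \<omega>] powr_def ln_mult algebra_simps flip: exp_add)
    then show "ennreal (V H (Suc t) \<omega> powr - \<theta> * f (X (Suc t) \<omega>)) = ?f (?Y \<omega>, W t \<omega>)"
      using f by (simp add: X_Suc[OF \<omega>] ennreal_mult' mult.assoc)
  qed
  also have "\<dots> = (\<integral>\<^sup>+\<omega>. \<integral>\<^sup>+w. ?f (?Y \<omega>, w) \<partial>distr M borel (W t) \<partial>M)"
    by (rule nn_integral_indep[OF W_indep_Fil Fil_subalgebra Y W_measurable f_meas])
  also have "\<dots> = (\<integral>\<^sup>+\<omega>. ennreal (V H t \<omega> powr - \<theta>) * (\<integral>\<^sup>+w. ennreal (exp (- \<theta> * F (X t \<omega>) (H t \<omega>) w) * f (G (X t \<omega>) w)) \<partial>P) \<partial>M)"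
    unfolding P_eq
  proof (rule nn_integral_cong)
    fix \<omega> assume \<omega>: "\<omega> \<in> space M"
    have "(\<lambda>w. ennreal (exp (- \<theta> * F (X t \<omega>) (H t \<omega>) w) * f (G (X t \<omega>) w))) \<in> borel_measurable P"
      using kernel.F_measurable[OF H_in_U[OF \<omega>]] by measurable
    then show "(\<integral>\<^sup>+w. ?f (?Y \<omega>, w) \<partial>P) = ennreal (V H t \<omega> powr - \<theta>) * (\<integral>\<^sup>+w. ennreal (exp (- \<theta> * F (X t \<omega>) (H t \<omega>) w) * f (G (X t \<omega>) w)) \<partial>P)"
      by (simp add: nn_integral_cmult)
  qed
  finally show ?thesis .
qed

end

end

section \<open>Growth rates\<close>

text \<open>Division by \<open>- \<theta>\<close> reverses the order, so moments bounded from below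
  bound the criterion from above. The prefactor contributes \<open>ln c / (\<theta> * t)\<close>,
  which vanishes in the limit.\<close>

lemma risk_criterion_le:
  assumes \<theta>: "0 < \<theta>" and c: "0 < c"
    and le: "\<And>t. ennreal (c * exp (- \<theta> * l) ^ t) \<le> (\<integral>\<^sup>+\<omega>. ennreal (V t \<omega> powr - \<theta>) \<partial>M)"
  shows "risk_criterion M (- \<theta>) V \<le> ereal l"
proof -
  have "ereal (1 / real t) * (ereal (1 / - \<theta>) * ln_ennreal (\<integral>\<^sup>+\<omega>. ennreal (V t \<omega> powr - \<theta>) \<partial>M)) \<le>
      ereal (l - ln c / \<theta> / real t)" if t: "0 < t" for t
  proof -
    have "ereal (ln c - \<theta> * l * t) = ln_ennreal (ennreal (c * exp (- \<theta> * l) ^ t))"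
      using c by (subst ln_ennreal_ennreal) (simp_all add: ln_mult ln_realpow)
    also have "\<dots> \<le> ln_ennreal (\<integral>\<^sup>+\<omega>. ennreal (V t \<omega> powr - \<theta>) \<partial>M)" by (rule ln_ennreal_mono[OF le])
    finally have "ereal (ln c - \<theta> * l * t) \<le> ln_ennreal (\<integral>\<^sup>+\<omega>. ennreal (V t \<omega> powr - \<theta>) \<partial>M)" .
    moreover have "l - ln c / \<theta> / real t = 1 / real t * (1 / - \<theta> * (ln c - \<theta> * l * t))"
      using \<theta> t by (simp add: field_simps)
    moreover have "1 / real t * (1 / - \<theta> * r) \<le> 1 / real t * (1 / - \<theta> * s)" if "s \<le> r" for r s
      using that \<theta> by (intro mult_left_mono mult_left_mono_neg) auto
    ultimately show ?thesis
      using \<theta> t by (cases "ln_ennreal (\<integral>\<^sup>+\<omega>. ennreal (V t \<omega> powr - \<theta>) \<partial>M)") (simp_all del: minus_divide_right)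
  qed
  \<comment> \<open>The term \<open>t = 0\<close>, where \<open>1 / real t\<close> is 0, is
    discarded.\<close>
  then have "risk_criterion M (- \<theta>) V \<le> liminf (\<lambda>t. ereal (l - ln c / \<theta> / real t))"
    unfolding risk_criterion_def by (intro Liminf_mono eventually_sequentiallyI[of 1]) auto
  also have "\<dots> = ereal l"
  proof (rule lim_imp_Liminf)
    have "(\<lambda>t. l - ln c / \<theta> / real t) \<longlonglongrightarrow> l - 0"
      by (intro tendsto_diff tendsto_const lim_const_over_n)
    then show "(\<lambda>t. ereal (l - ln c / \<theta> / real t)) \<longlonglongrightarrow> ereal l" by simp
  qed simp
  finally show ?thesis .
qed

lemma risk_criterion_ge:
  assumes \<theta>: "0 < \<theta>" and c: "0 < c"
    and le: "\<And>t. (\<integral>\<^sup>+\<omega>. ennreal (V t \<omega> powr - \<theta>) \<partial>M) \<le> ennreal (c * exp (- \<theta> * l) ^ t)"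
  shows "ereal l \<le> risk_criterion M (- \<theta>) V"
proof -
  have "ereal (l - ln c / \<theta> / real t) \<le>
      ereal (1 / real t) * (ereal (1 / - \<theta>) * ln_ennreal (\<integral>\<^sup>+\<omega>. ennreal (V t \<omega> powr - \<theta>) \<partial>M))" if t: "0 < t" for t
  proof -
    have "ln_ennreal (\<integral>\<^sup>+\<omega>. ennreal (V t \<omega> powr - \<theta>) \<partial>M) \<le> ln_ennreal (ennreal (c * exp (- \<theta> * l) ^ t))"
      by (rule ln_ennreal_mono[OF le])
    also have "\<dots> = ereal (ln c - \<theta> * l * t)"
      using c by (subst ln_ennreal_ennreal) (simp_all add: ln_mult ln_realpow)
    finally have "ln_ennreal (\<integral>\<^sup>+\<omega>. ennreal (V t \<omega> powr - \<theta>) \<partial>M) \<le> ereal (ln c - \<theta> * l * t)" .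
    moreover have "l - ln c / \<theta> / real t = 1 / real t * (1 / - \<theta> * (ln c - \<theta> * l * t))"
      using \<theta> t by (simp add: field_simps)
    moreover have "1 / real t * (1 / - \<theta> * r) \<le> 1 / real t * (1 / - \<theta> * s)" if "s \<le> r" for r s
      using that \<theta> by (intro mult_left_mono mult_left_mono_neg) auto
    ultimately show ?thesis
      using \<theta> t by (cases "ln_ennreal (\<integral>\<^sup>+\<omega>. ennreal (V t \<omega> powr - \<theta>) \<partial>M)") (simp_all del: minus_divide_right)
  qed
  then have "liminf (\<lambda>t. ereal (l - ln c / \<theta> / real t)) \<le> risk_criterion M (- \<theta>) V"
    unfolding risk_criterion_def by (intro Liminf_mono eventually_sequentiallyI[of 1]) auto
  moreover have "liminf (\<lambda>t. ereal (l - ln c / \<theta> / real t)) = ereal l"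
  proof (rule lim_imp_Liminf)
    have "(\<lambda>t. l - ln c / \<theta> / real t) \<longlonglongrightarrow> l - 0"
      by (intro tendsto_diff tendsto_const lim_const_over_n)
    then show "(\<lambda>t. ereal (l - ln c / \<theta> / real t)) \<longlonglongrightarrow> ereal l" by simp
  qed simp
  ultimately show ?thesis by simp
qed

lemma C_weighted_iff:
  fixes weight :: "'x::topological_space \<Rightarrow> real"
  assumes "\<And>x. 0 \<le> weight x"
  shows "f \<in> C_weighted weight \<longleftrightarrow> continuous_on UNIV f \<and> (\<exists>C. \<forall>x. \<bar>f x\<bar> \<le> C * (1 + weight x))"
proof -
  have pos: "0 < 1 + weight x" for x using assms[of x] by simp
  have "weighted_norm weight f < \<infinity> \<longleftrightarrow> (\<exists>C. \<forall>x. \<bar>f x\<bar> \<le> C * (1 + weight x))"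
  proof
    assume fin: "weighted_norm weight f < \<infinity>"
    have le: "ereal (\<bar>f x\<bar> / (1 + weight x)) \<le> weighted_norm weight f" for x
      unfolding weighted_norm_def by (rule SUP_upper) simp
    from le[of undefined] fin obtain C where C: "weighted_norm weight f = ereal C"
      by (cases "weighted_norm weight f") auto
    have "\<bar>f x\<bar> \<le> C * (1 + weight x)" for x
      using le[of x] pos[of x] by (simp add: C field_simps)
    then show "\<exists>C. \<forall>x. \<bar>f x\<bar> \<le> C * (1 + weight x)" by blast
  next
    assume "\<exists>C. \<forall>x. \<bar>f x\<bar> \<le> C * (1 + weight x)"
    then obtain C where "\<And>x. \<bar>f x\<bar> \<le> C * (1 + weight x)" by blast
    then have "weighted_norm weight f \<le> ereal C"
      unfolding weighted_norm_def using pos by (intro SUP_least) (simp add: pos_divide_le_eq)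
    then show "weighted_norm weight f < \<infinity>" by (rule le_less_trans) simp
  qed
  then show ?thesis by (simp add: C_weighted_def)
qed

section \<open>Transfer of the kernel results to the market\<close>

context controlled_market
begin

lemma nn_integral_exp_energy:
  assumes "0 < \<theta>" "\<theta> \<le> K" "kernel.growth_class K \<theta> f" "h \<in> U"
  shows "(\<integral>\<^sup>+w. ennreal (exp (- \<theta> * (F x h w + f (G x w)))) \<partial>P) = ennreal (exp (- \<theta> * kernel.objective \<theta> f x h))"
proof -
  have "(\<integral>\<^sup>+w. ennreal (exp (- kernel.energy \<theta> f x h w)) \<partial>P) = ennreal (\<integral>w. exp (- kernel.energy \<theta> f x h w) \<partial>P)"
    by (intro nn_integral_eq_integral kernel.tame_integrable kernel.affinely_dominated_exp_minus[OF kernel.energy_dominated[OF assms]]) auto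
  then show ?thesis unfolding kernel.exp_objective[OF assms] by (simp add: kernel.energy_def)
qed

lemma bellman_objective_eq:
  assumes "0 < \<theta>" "\<theta> \<le> K" "kernel.growth_class K \<theta> f" "h \<in> U"
  shows "bellman_objective M (W 0) G F (- \<theta>) f x h = ereal (kernel.objective \<theta> f x h)"
proof -
  have [measurable]: "F x h \<in> borel_measurable borel" "f \<in> borel_measurable borel" "G x \<in> borel \<rightarrow>\<^sub>M borel"
    using kernel.F_measurable[OF assms(4), of x] kernel.growth_class_measurable[OF assms(3)] kernel.G_measurable[of x]
    by (simp_all cong: measurable_cong_sets add: sets_P)
  have "(\<integral>\<^sup>+\<omega>. ennreal (exp (- \<theta> * (F x h (W 0 \<omega>) + f (G x (W 0 \<omega>))))) \<partial>M) = ennreal (exp (- \<theta> * kernel.objective \<theta> f x h))"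
    unfolding nn_integral_exp_energy[OF assms, symmetric] by (intro nn_integral_P[symmetric]) measurable
  then show ?thesis using assms(1)
    by (simp add: bellman_objective_def entropic_def ln_ennreal_ennreal)
qed

lemma SUP_bellman_objective:
  assumes "0 < \<theta>" "\<theta> \<le> K" "kernel.growth_class K \<theta> f"
  shows "(SUP h\<in>U. bellman_objective M (W 0) G F (- \<theta>) f x h) = ereal (kernel.bellman_op \<theta> f x)"
proof (rule SUP_eqI)
  show "bellman_objective M (W 0) G F (- \<theta>) f x h \<le> ereal (kernel.bellman_op \<theta> f x)" if "h \<in> U" for h
    using kernel.objective_attains(2)[OF assms that, of x] bellman_objective_eq[OF assms that] by simp
  fix y assume y: "\<And>h. h \<in> U \<Longrightarrow> bellman_objective M (W 0) G F (- \<theta>) f x h \<le> y"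
  obtain h where "h \<in> U" "kernel.bellman_op \<theta> f x = kernel.objective \<theta> f x h"
    using kernel.objective_attains(1)[OF assms] by blast
  then show "ereal (kernel.bellman_op \<theta> f x) \<le> y" using y[of h] bellman_objective_eq[OF assms, of h x] by simp
qed

text \<open>Every weighted function belongs to some \<open>growth_class\<close>, with a constant
  that depends on the function, and there the extended supremum equals the real
  \<open>bellman_op\<close>.\<close>

lemma bellman_solution_iff:
  assumes \<theta>: "0 < \<theta>"
  shows "bellman_solution M (W 0) U G F weight (- \<theta>) v l \<longleftrightarrow> continuous_on UNIV v \<and>
    (\<exists>C. \<forall>x. \<bar>v x\<bar> \<le> C * (1 + weight x)) \<and> (\<forall>x. kernel.bellman_op \<theta> v x = v x + l)"
proof -
  have "(SUP h\<in>U. bellman_objective M (W 0) G F (- \<theta>) v x h) = ereal (kernel.bellman_op \<theta> v x)"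
    if v: "continuous_on UNIV v" "\<forall>x. \<bar>v x\<bar> \<le> C * (1 + weight x)" for C x
  proof (rule SUP_bellman_objective[OF \<theta>])
    show "\<theta> \<le> max \<theta> (\<theta> * C)" "kernel.growth_class (max \<theta> (\<theta> * C)) \<theta> v"
      using v \<theta> by (auto intro!: kernel.growth_classI[of v C])
  qed
  then have "(\<forall>x. ereal (v x + l) = (SUP h\<in>U. bellman_objective M (W 0) G F (- \<theta>) v x h)) \<longleftrightarrow>
      (\<forall>x. kernel.bellman_op \<theta> v x = v x + l)"
    if "continuous_on UNIV v" "\<forall>x. \<bar>v x\<bar> \<le> C * (1 + weight x)" for C
    using that by (metis ereal.inject)
  then show ?thesis
    unfolding bellman_solution_def C_weighted_iff[OF kernel.weight_nonneg] by blast
qed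

lemma bellman_solution_unique:
  assumes \<theta>: "0 < \<theta>" and v: "bellman_solution M (W 0) U G F weight (- \<theta>) v l"
    and v': "bellman_solution M (W 0) U G F weight (- \<theta>) v' l'"
  shows "l' = l \<and> (\<exists>c. \<forall>x. v' x = v x + c)"
proof -
  obtain C where C: "continuous_on UNIV v" "\<And>x. \<bar>v x\<bar> \<le> C * (1 + weight x)" "\<And>x. kernel.bellman_op \<theta> v x = v x + l"
    using v unfolding bellman_solution_iff[OF \<theta>] by blast
  obtain C' where C': "continuous_on UNIV v'" "\<And>x. \<bar>v' x\<bar> \<le> C' * (1 + weight x)" "\<And>x. kernel.bellman_op \<theta> v' x = v' x + l'"
    using v' unfolding bellman_solution_iff[OF \<theta>] by blast
  show ?thesis by (rule kernel.bellman_unique[OF \<theta> C C'])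
qed

lemma risk_criterion_le_eigenvalue:
  assumes \<theta>: "0 < \<theta>" and v: "bellman_solution M (W 0) U G F weight (- \<theta>) v l" and H: "H \<in> strategies Fil U"
  shows "risk_criterion M (- \<theta>) (V H) \<le> ereal l"
proof -
  obtain C where v': "continuous_on UNIV v" "\<And>x. \<bar>v x\<bar> \<le> C * (1 + weight x)" "\<And>x. kernel.bellman_op \<theta> v x = v x + l"
    using v by (auto simp: bellman_solution_iff[OF \<theta>])
  obtain \<psi> :: "nat \<Rightarrow> real ^ 'k \<Rightarrow> real" where \<psi> [measurable]: "\<And>j. \<psi> j \<in> borel_measurable borel"
    and \<psi>0: "\<And>j x. 0 \<le> \<psi> j x" and \<psi>1: "\<And>x. \<psi> 0 x \<le> 1" and \<psi>_pos: "\<And>x. \<exists>c>0. \<forall>j. c \<le> \<psi> j x"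
    and \<psi>_step: "\<And>j x h. h \<in> U \<Longrightarrow> ennreal (exp (- \<theta> * l) * \<psi> (Suc j) x) \<le> (\<integral>\<^sup>+w. ennreal (exp (- \<theta> * F x h w) * \<psi> j (G x w)) \<partial>P)"
    using kernel.lower_family[OF \<theta> v'] by blast
  note V_0 = V_0[OF H] and V0_pos = V0_pos[OF H] and V_step = V_step[OF H] and H_in_U = H_in_U[OF H]
  have [measurable]: "V H t \<in> borel_measurable M" "X t \<in> M \<rightarrow>\<^sub>M borel" for t
    using V_adapted[OF H] X_adapted measurable_from_subalg[OF Fil_subalgebra] by blast+
  define L where "L = exp (- \<theta> * l)"
  have L: "0 < L" by (simp add: L_def)
  \<comment> \<open>Each step in time lowers the index by one, from \<open>t + j\<close> at the
    start to \<open>j\<close> at time \<open>t\<close>; the induction uses the hypothesis at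
    \<open>Suc j\<close>.\<close>
  have iter: "ennreal (V0 powr - \<theta> * L ^ t * \<psi> (t + j) x0) \<le> (\<integral>\<^sup>+\<omega>. ennreal (V H t \<omega> powr - \<theta> * \<psi> j (X t \<omega>)) \<partial>M)" for t j
  proof (induction t arbitrary: j)
    case 0
    have "(\<integral>\<^sup>+\<omega>. ennreal (V H 0 \<omega> powr - \<theta> * \<psi> j (X 0 \<omega>)) \<partial>M) = (\<integral>\<^sup>+\<omega>. ennreal (V0 powr - \<theta> * \<psi> j x0) \<partial>M)"
      by (intro nn_integral_cong) (simp add: X_0 V_0)
    then show ?case by (simp add: emeasure_space_1)
  next
    case (Suc t)
    have "ennreal (V0 powr - \<theta> * L ^ Suc t * \<psi> (Suc t + j) x0) = ennreal L * ennreal (V0 powr - \<theta> * L ^ t * \<psi> (t + Suc j) x0)"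
      using L by (simp add: ennreal_mult'[symmetric] mult_ac)
    also have "\<dots> \<le> ennreal L * (\<integral>\<^sup>+\<omega>. ennreal (V H t \<omega> powr - \<theta> * \<psi> (Suc j) (X t \<omega>)) \<partial>M)"
      by (intro mult_left_mono Suc) auto
    also have "\<dots> = (\<integral>\<^sup>+\<omega>. ennreal (V H t \<omega> powr - \<theta>) * ennreal (L * \<psi> (Suc j) (X t \<omega>)) \<partial>M)"
      using L \<psi>0 by (subst nn_integral_cmult[symmetric]) (auto simp: ennreal_mult' mult_ac)
    also have "\<dots> \<le> (\<integral>\<^sup>+\<omega>. ennreal (V H t \<omega> powr - \<theta>) * (\<integral>\<^sup>+w. ennreal (exp (- \<theta> * F (X t \<omega>) (H t \<omega>) w) * \<psi> j (G (X t \<omega>) w)) \<partial>P) \<partial>M)"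
      unfolding L_def by (intro nn_integral_mono mult_left_mono \<psi>_step H_in_U) auto
    also have "\<dots> = (\<integral>\<^sup>+\<omega>. ennreal (V H (Suc t) \<omega> powr - \<theta> * \<psi> j (X (Suc t) \<omega>)) \<partial>M)"
      by (rule V_step[symmetric]) (auto simp: \<psi>0)
    finally show ?case .
  qed
  obtain c where c: "c > 0" "\<And>j. c \<le> \<psi> j x0" using \<psi>_pos by blast
  show ?thesis
  proof (rule risk_criterion_le[OF \<theta>])
    show "0 < V0 powr - \<theta> * c" using V0_pos c by simp
    fix t
    have "ennreal (V0 powr - \<theta> * c * exp (- \<theta> * l) ^ t) \<le> ennreal (V0 powr - \<theta> * L ^ t * \<psi> (t + 0) x0)"
      using mult_left_mono[OF c(2)[of t], of "V0 powr - \<theta> * L ^ t"] L by (intro ennreal_leI) (simp add: L_def mult_ac)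
    also have "\<dots> \<le> (\<integral>\<^sup>+\<omega>. ennreal (V H t \<omega> powr - \<theta> * \<psi> 0 (X t \<omega>)) \<partial>M)" by (rule iter)
    also have "\<dots> \<le> (\<integral>\<^sup>+\<omega>. ennreal (V H t \<omega> powr - \<theta>) \<partial>M)"
      by (intro nn_integral_mono ennreal_leI mult_right_le_one_le \<psi>0 \<psi>1) auto
    finally show "ennreal (V0 powr - \<theta> * c * exp (- \<theta> * l) ^ t) \<le> (\<integral>\<^sup>+\<omega>. ennreal (V H t \<omega> powr - \<theta>) \<partial>M)" .
  qed
qed

lemma selector_strategy:
  assumes "bellman_selector M (W 0) U G F \<gamma> v hsel"
  shows "(\<lambda>t \<omega>. hsel (X t \<omega>)) \<in> strategies Fil U"
proof -
  have "hsel \<in> borel_measurable borel" "\<And>x. hsel x \<in> U"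
    using assms by (auto simp: bellman_selector_def)
  then show ?thesis
    unfolding strategies_def using measurable_compose[OF X_adapted]
    by (auto intro!: measurable_restrict_space2)
qed

lemma weight_X_bounded:
  assumes "\<And>w. a1 w \<le> C"
  shows "\<exists>B. \<forall>t. \<forall>\<omega>\<in>space M. weight (X t \<omega>) \<le> B"
proof -
  \<comment> \<open>A level with \<open>C + b1 * B \<le> B\<close> that also lies above the starting
    point is never exceeded.\<close>
  define B where "B = max (weight x0) (C / (1 - b1))"
  have "C / (1 - b1) \<le> B" by (simp add: B_def)
  then have "C \<le> (1 - b1) * B" using kernel.b1 by (simp add: pos_divide_le_eq mult.commute)
  then have B: "C + b1 * B \<le> B" by (simp add: algebra_simps)
  have "weight (X t \<omega>) \<le> B" if \<omega>: "\<omega> \<in> space M" for t \<omega>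
  proof (induction t)
    case (Suc t)
    have "weight (X (Suc t) \<omega>) \<le> a1 (W t \<omega>) + b1 * weight (X t \<omega>)"
      using growth by (simp add: growth_def X_Suc[OF \<omega>])
    also have "\<dots> \<le> C + b1 * B" using assms Suc kernel.b1 by (intro add_mono mult_left_mono) auto
    also have "\<dots> \<le> B" by (fact B)
    finally show ?case .
  qed (simp add: B_def X_0[OF \<omega>])
  then show ?thesis by blast
qed

text \<open>Under a selector the Bellman inequality is an equality, so the mean of
  \<open>V\<^sub>t\<^sup>\<gamma> * exp (\<gamma> * v (X\<^sub>t))\<close> is exactly geometric with
  ratio \<open>exp (\<gamma> * l)\<close>. As \<open>v\<close> is bounded above along the path, the
  exponential factor is bounded away from 0 and costs only a constant.\<close>

lemma eigenvalue_le_risk_criterion: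
  assumes \<theta>: "0 < \<theta>" and v: "bellman_solution M (W 0) U G F weight (- \<theta>) v l"
    and hsel: "bellman_selector M (W 0) U G F (- \<theta>) v hsel" and a1: "\<And>w. a1 w \<le> C"
  shows "ereal l \<le> risk_criterion M (- \<theta>) (V (\<lambda>t \<omega>. hsel (X t \<omega>)))"
proof -
  let ?H = "\<lambda>t \<omega>. hsel (X t \<omega>)"
  have H: "?H \<in> strategies Fil U" by (rule selector_strategy[OF hsel])
  obtain D where v': "continuous_on UNIV v" "\<And>x. \<bar>v x\<bar> \<le> D * (1 + weight x)" "\<And>x. kernel.bellman_op \<theta> v x = v x + l"
    using v by (auto simp: bellman_solution_iff[OF \<theta>])
  define K where "K = max \<theta> (\<theta> * D)"
  have K: "\<theta> \<le> K" "kernel.growth_class K \<theta> v"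
    using kernel.growth_classI[OF v'(1,2) \<theta>] by (auto simp: K_def)
  have [measurable]: "v \<in> borel_measurable borel" using kernel.growth_class_measurable[OF K(2)] .
  have hU: "hsel x \<in> U" for x using hsel by (auto simp: bellman_selector_def)
  have opt: "kernel.objective \<theta> v x (hsel x) = v x + l" for x
    using hsel unfolding bellman_selector_def SUP_bellman_objective[OF \<theta> K] bellman_objective_eq[OF \<theta> K hU] v'(3) by simp
  note V_0 = V_0[OF H] and V0_pos = V0_pos[OF H] and V_step = V_step[OF H]
  have [measurable]: "V ?H t \<in> borel_measurable M" "X t \<in> M \<rightarrow>\<^sub>M borel" for t
    using V_adapted[OF H] X_adapted measurable_from_subalg[OF Fil_subalgebra] by blast+
  define L where "L = exp (- \<theta> * l)"
  have L: "0 < L" by (simp add: L_def)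
  have iter: "(\<integral>\<^sup>+\<omega>. ennreal (V ?H t \<omega> powr - \<theta> * exp (- \<theta> * v (X t \<omega>))) \<partial>M) = ennreal (V0 powr - \<theta> * exp (- \<theta> * v x0) * L ^ t)" for t
  proof (induction t)
    case 0
    have "(\<integral>\<^sup>+\<omega>. ennreal (V ?H 0 \<omega> powr - \<theta> * exp (- \<theta> * v (X 0 \<omega>))) \<partial>M) = (\<integral>\<^sup>+\<omega>. ennreal (V0 powr - \<theta> * exp (- \<theta> * v x0)) \<partial>M)"
      by (intro nn_integral_cong) (simp only: X_0 V_0)
    then show ?case by (simp add: emeasure_space_1)
  next
    case (Suc t)
    have one_step: "(\<integral>\<^sup>+w. ennreal (exp (- \<theta> * F x (hsel x) w) * exp (- \<theta> * v (G x w))) \<partial>P) = ennreal (L * exp (- \<theta> * v x))" for x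
      using nn_integral_exp_energy[OF \<theta> K hU[of x], of x]
      by (simp add: opt L_def distrib_left exp_diff exp_minus exp_add field_simps)
    have "(\<integral>\<^sup>+\<omega>. ennreal (V ?H (Suc t) \<omega> powr - \<theta> * exp (- \<theta> * v (X (Suc t) \<omega>))) \<partial>M) =
        (\<integral>\<^sup>+\<omega>. ennreal (V ?H t \<omega> powr - \<theta>) * ennreal (L * exp (- \<theta> * v (X t \<omega>))) \<partial>M)"
      unfolding one_step[symmetric] by (rule V_step) auto
    also have "\<dots> = ennreal L * (\<integral>\<^sup>+\<omega>. ennreal (V ?H t \<omega> powr - \<theta> * exp (- \<theta> * v (X t \<omega>))) \<partial>M)"
      using L by (subst nn_integral_cmult[symmetric]) (auto simp: ennreal_mult' mult_ac)
    also have "\<dots> = ennreal (V0 powr - \<theta> * exp (- \<theta> * v x0) * L ^ Suc t)"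
      unfolding Suc using L by (simp add: ennreal_mult'[symmetric] mult_ac)
    finally show ?case .
  qed
  obtain B where B: "\<And>t \<omega>. \<omega> \<in> space M \<Longrightarrow> weight (X t \<omega>) \<le> B" using weight_X_bounded[OF a1] by blast
  define E where "E = \<bar>D\<bar> * (1 + B)"
  have vE: "v (X t \<omega>) \<le> E" if \<omega>: "\<omega> \<in> space M" for t \<omega>
  proof -
    have "v (X t \<omega>) \<le> D * (1 + weight (X t \<omega>))" using v'(2)[of "X t \<omega>"] by simp
    also have "\<dots> \<le> \<bar>D\<bar> * (1 + B)"
      using B[OF \<omega>, of t] kernel.weight_nonneg[of "X t \<omega>"] by (intro mult_mono) auto
    finally show ?thesis by (simp add: E_def)
  qed
  show ?thesis
  proof (rule risk_criterion_ge[OF \<theta>])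
    show "0 < exp (\<theta> * E) * (V0 powr - \<theta> * exp (- \<theta> * v x0))" using V0_pos by simp
    fix t
    have "(\<integral>\<^sup>+\<omega>. ennreal (V ?H t \<omega> powr - \<theta>) \<partial>M) \<le> (\<integral>\<^sup>+\<omega>. ennreal (exp (\<theta> * E)) * ennreal (V ?H t \<omega> powr - \<theta> * exp (- \<theta> * v (X t \<omega>))) \<partial>M)"
    proof (rule nn_integral_mono)
      fix \<omega> assume \<omega>: "\<omega> \<in> space M"
      have "\<theta> * v (X t \<omega>) \<le> \<theta> * E" using vE[OF \<omega>, of t] \<theta> by (intro mult_left_mono) auto
      then have "1 \<le> exp (\<theta> * E) * exp (- \<theta> * v (X t \<omega>))" by (simp flip: exp_add)
      from mult_left_mono[OF this, of "V ?H t \<omega> powr - \<theta>"]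
      have "V ?H t \<omega> powr - \<theta> \<le> exp (\<theta> * E) * (V ?H t \<omega> powr - \<theta> * exp (- \<theta> * v (X t \<omega>)))"
        by (simp add: mult_ac)
      then show "ennreal (V ?H t \<omega> powr - \<theta>) \<le> ennreal (exp (\<theta> * E)) * ennreal (V ?H t \<omega> powr - \<theta> * exp (- \<theta> * v (X t \<omega>)))"
        by (subst ennreal_mult'[symmetric]) (auto intro: ennreal_leI)
    qed
    also have "\<dots> = ennreal (exp (\<theta> * E)) * ennreal (V0 powr - \<theta> * exp (- \<theta> * v x0) * L ^ t)"
      unfolding iter[of t, symmetric] by (rule nn_integral_cmult) measurable
    also have "\<dots> = ennreal (exp (\<theta> * E) * (V0 powr - \<theta> * exp (- \<theta> * v x0)) * exp (- \<theta> * l) ^ t)"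
      by (subst ennreal_mult'[symmetric]) (auto simp: L_def mult.assoc)
    finally show "(\<integral>\<^sup>+\<omega>. ennreal (V ?H t \<omega> powr - \<theta>) \<partial>M) \<le>
      ennreal (exp (\<theta> * E) * (V0 powr - \<theta> * exp (- \<theta> * v x0)) * exp (- \<theta> * l) ^ t)" .
  qed
qed

lemma selector_exists:
  assumes \<theta>: "0 < \<theta>" and v: "bellman_solution M (W 0) U G F weight (- \<theta>) v l"
  shows "\<exists>hsel. bellman_selector M (W 0) U G F (- \<theta>) v hsel"
proof -
  obtain D where v': "continuous_on UNIV v" "\<And>x. \<bar>v x\<bar> \<le> D * (1 + weight x)"
    using v by (auto simp: bellman_solution_iff[OF \<theta>])
  define K where "K = max \<theta> (\<theta> * D)"
  have K: "\<theta> \<le> K" "kernel.growth_class K \<theta> v"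
    using kernel.growth_classI[OF v'(1,2) \<theta>] by (auto simp: K_def)
  obtain s where s: "s \<in> borel_measurable borel" "\<And>x. s x \<in> U"
    "\<And>x h. h \<in> U \<Longrightarrow> kernel.objective \<theta> v x h \<le> kernel.objective \<theta> v x (s x)"
    using measurable_argmax[OF U(2,1) kernel.objective_continuous[OF \<theta> K]] by blast
  have "kernel.objective \<theta> v x (s x) = kernel.bellman_op \<theta> v x" for x
  proof -
    obtain h where "h \<in> U" "kernel.bellman_op \<theta> v x = kernel.objective \<theta> v x h"
      using kernel.objective_attains(1)[OF \<theta> K] by blast
    then show ?thesis using s(3)[of h x] kernel.objective_attains(2)[OF \<theta> K s(2), of x x] by simp
  qed
  then have "bellman_selector M (W 0) U G F (- \<theta>) v s"
    unfolding bellman_selector_def SUP_bellman_objective[OF \<theta> K] using s(1,2) bellman_objective_eq[OF \<theta> K s(2)] by simp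
  then show ?thesis by blast
qed

end

theorem proposition5p1:
  fixes M :: "'a measure"
    and Fil :: "nat \<Rightarrow> 'a measure"
    and W :: "nat \<Rightarrow> 'a \<Rightarrow> real ^ ('k::finite + 'm::finite)"
    and U :: "(real ^ 'm) set"
    and G :: "real ^ 'k \<Rightarrow> real ^ ('k + 'm) \<Rightarrow> real ^ 'k"
    and F :: "real ^ 'k \<Rightarrow> real ^ 'm \<Rightarrow> real ^ ('k + 'm) \<Rightarrow> real"
    and x0 :: "real ^ 'k"
    and X :: "nat \<Rightarrow> 'a \<Rightarrow> real ^ 'k"
    and V0 :: real
    and V :: "(nat \<Rightarrow> 'a \<Rightarrow> real ^ 'm) \<Rightarrow> nat \<Rightarrow> 'a \<Rightarrow> real"
    and a1 a2 :: "real ^ ('k + 'm) \<Rightarrow> real"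
    and b1 b2 :: real
    and weight :: "real ^ 'k \<Rightarrow> real"
  assumes "U \<noteq> {}" and "compact U"
    and "noise M Fil W"
    and "factors M W G x0 X"
    and "portfolio M Fil W U X F V0 V"
    and "growth M (W 0) U G F a1 a2 b1 b2 weight"
    and "minorization M (W 0) G weight"
  shows "\<exists>\<gamma>0<0. \<forall>\<gamma>. \<gamma>0 < \<gamma> \<and> \<gamma> < 0 \<longrightarrow>
    (\<exists>v lam.
      bellman_solution M (W 0) U G F weight \<gamma> v lam \<and>
      (\<forall>v' lam'. bellman_solution M (W 0) U G F weight \<gamma> v' lam' \<longrightarrow>
        lam' = lam \<and> (\<exists>c. \<forall>x. v' x = v x + c)) \<and>
      ereal lam \<ge> (SUP H\<in>strategies Fil U. risk_criterion M \<gamma> (V H)) \<and>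
      ((\<exists>C. \<forall>w. a1 w \<le> C) \<longrightarrow>
        ereal lam = (SUP H\<in>strategies Fil U. risk_criterion M \<gamma> (V H)) \<and>
        (\<exists>hsel. bellman_selector M (W 0) U G F \<gamma> v hsel) \<and>
        (\<forall>hsel. bellman_selector M (W 0) U G F \<gamma> v hsel \<longrightarrow>
          (\<lambda>t \<omega>. hsel (X t \<omega>)) \<in> strategies Fil U \<and>
          risk_criterion M \<gamma> (V (\<lambda>t \<omega>. hsel (X t \<omega>))) =
            (SUP H\<in>strategies Fil U. risk_criterion M \<gamma> (V H)))))"
proof -
  interpret controlled_market M Fil W U G F x0 X V0 V a1 a2 b1 b2 weight
    using assms by (intro controlled_market.intro controlled_market_axioms.intro)
  obtain \<theta>0 where \<theta>0: "\<theta>0 > 0" and ex: "\<And>\<theta>. 0 < \<theta> \<Longrightarrow> \<theta> < \<theta>0 \<Longrightarrow> \<exists>f l C. continuous_on UNIV f \<and>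
    (\<forall>x. \<bar>f x\<bar> \<le> C * (1 + weight x)) \<and> (\<forall>x. kernel.bellman_op \<theta> f x = f x + l)"
    using kernel.bellman_exists by blast
  show ?thesis
  proof (intro exI[of _ "- \<theta>0"] conjI allI impI)
    fix \<gamma> :: real assume \<gamma>: "- \<theta>0 < \<gamma> \<and> \<gamma> < 0"
    define \<theta> where "\<theta> = - \<gamma>"
    have \<theta>: "0 < \<theta>" "\<theta> < \<theta>0" "\<gamma> = - \<theta>" using \<gamma> by (auto simp: \<theta>_def)
    let ?sol = "bellman_solution M (W 0) U G F weight (- \<theta>)"
    let ?sup = "SUP H\<in>strategies Fil U. risk_criterion M (- \<theta>) (V H)"
    obtain v l where sol: "?sol v l" using ex[OF \<theta>(1,2)] unfolding bellman_solution_iff[OF \<theta>(1)] by blast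
    have le: "?sup \<le> ereal l" by (intro SUP_least risk_criterion_le_eigenvalue[OF \<theta>(1) sol])
    have unique: "l' = l \<and> (\<exists>c. \<forall>x. v' x = v x + c)" if "?sol v' l'" for v' l'
      by (rule bellman_solution_unique[OF \<theta>(1) sol that])
    \<comment> \<open>The chain \<open>l \<le> criterion of the selector \<le> ?sup \<le> l\<close>
      collapses; the existence of a selector then turns it into the equality for
      \<open>l\<close>.\<close>
    have opt: "risk_criterion M (- \<theta>) (V (\<lambda>t \<omega>. hsel (X t \<omega>))) = ?sup \<and> ereal l = ?sup"
      if "\<And>w. a1 w \<le> C" and hsel: "bellman_selector M (W 0) U G F (- \<theta>) v hsel" for C hsel
    proof -
      have ge: "ereal l \<le> risk_criterion M (- \<theta>) (V (\<lambda>t \<omega>. hsel (X t \<omega>)))"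
        by (rule eigenvalue_le_risk_criterion[OF \<theta>(1) sol hsel that(1)])
      have upper: "risk_criterion M (- \<theta>) (V (\<lambda>t \<omega>. hsel (X t \<omega>))) \<le> ?sup"
        by (rule SUP_upper[OF selector_strategy[OF hsel]])
      show ?thesis by (intro conjI antisym upper order_trans[OF le ge] order_trans[OF ge upper] le)
    qed
    obtain hsel where hsel: "bellman_selector M (W 0) U G F (- \<theta>) v hsel" using selector_exists[OF \<theta>(1) sol] by blast
    show "\<exists>v lam. bellman_solution M (W 0) U G F weight \<gamma> v lam \<and>
      (\<forall>v' lam'. bellman_solution M (W 0) U G F weight \<gamma> v' lam' \<longrightarrow>
        lam' = lam \<and> (\<exists>c. \<forall>x. v' x = v x + c)) \<and>
      ereal lam \<ge> (SUP H\<in>strategies Fil U. risk_criterion M \<gamma> (V H)) \<and>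
      ((\<exists>C. \<forall>w. a1 w \<le> C) \<longrightarrow>
        ereal lam = (SUP H\<in>strategies Fil U. risk_criterion M \<gamma> (V H)) \<and>
        (\<exists>hsel. bellman_selector M (W 0) U G F \<gamma> v hsel) \<and>
        (\<forall>hsel. bellman_selector M (W 0) U G F \<gamma> v hsel \<longrightarrow>
          (\<lambda>t \<omega>. hsel (X t \<omega>)) \<in> strategies Fil U \<and>
          risk_criterion M \<gamma> (V (\<lambda>t \<omega>. hsel (X t \<omega>))) =
            (SUP H\<in>strategies Fil U. risk_criterion M \<gamma> (V H))))"
      unfolding \<theta>(3)
    proof (intro exI[of _ v] exI[of _ l] conjI impI)
      show "\<forall>v' lam'. ?sol v' lam' \<longrightarrow> lam' = l \<and> (\<exists>c. \<forall>x. v' x = v x + c)" using unique by blast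
    next
      assume "\<exists>C. \<forall>w. a1 w \<le> C"
      then obtain C where C: "\<And>w. a1 w \<le> C" by blast
      show "ereal l = ?sup" using opt[OF C hsel] by blast
      show "\<exists>hsel. bellman_selector M (W 0) U G F (- \<theta>) v hsel" using hsel by blast
      show "\<forall>hsel. bellman_selector M (W 0) U G F (- \<theta>) v hsel \<longrightarrow>
          (\<lambda>t \<omega>. hsel (X t \<omega>)) \<in> strategies Fil U \<and> risk_criterion M (- \<theta>) (V (\<lambda>t \<omega>. hsel (X t \<omega>))) = ?sup"
        using opt[OF C] selector_strategy by blast
    qed (use sol le in auto)
  qed (use \<theta>0 in auto)
qed

end
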